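(* Let $\xi$ be a nonnegative random variable with a nondegenerate distribution, and let $\hat N(t)$ be the associated decoupled renewal process, with $U(t)=\mathbb{E}[\hat N(t)]$. Let $b>0$, $b\neq 1$. Suppose that $\mathbb{P}\{\xi>t\}\sim t^{-\alpha}\ell(t)$ as $t\to\infty$ for some $\alpha\in[0,1)$ and some function $\ell$ slowly varying at $\infty$. Then $$\lim_{t\to\infty}\frac{-\log \mathbb{P}\{\hat N(t)=\lfloor b\, U(t)\rfloor\}}{U(t)}=J_\alpha(b)\in (0,\infty).$$ Here $J_\alpha$ is the Legendre transform of $f_\alpha$, given by $J_\alpha(x):=\sup_{s\in\mathbb{R}}(sx-f_\alpha(s))$ for $x>0$, where $$f_\alpha(s):=\int_0^\infty\log\big((\mathrm{e}^s-1)\mathbb{P}\{Z_\alpha>y\}+1\big)\,\mathrm{d}y,\quad s\in\mathbb{R},$$ and $$U(t)\sim\frac{1}{\Gamma(1-\alpha)\Gamma(1+\alpha)}\frac{t^\alpha}{\ell(t)},\quad t\to\infty.$$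
   Context: Decoupled renewal process: let $\xi_1,\xi_2,\ldots$ be independent copies of $\xi$ and $S_n=\xi_1+\ldots+\xi_n$, $n\ge 1$. Let $\hat S_1,\hat S_2,\ldots$ be independent random variables such that, for each $n\geq 1$, $\hat S_n$ has the same distribution as $S_n$. Put $\hat N(t):=\sum_{n\geq 1}\mathbf{1}_{\{\hat S_n\leq t\}}$ for $t\geq 0$. Then $U(t)=\mathbb{E}[\hat N(t)]=\sum_{n\ge1}\mathbb{P}\{S_n\le t\}$. The random variable $Z_\alpha$: for $\alpha\in(0,1)$, let $(W_\alpha(t))_{t\geq 0}$ be a drift-free $\alpha$-stable subordinator with $-\log\mathbb{E}[\exp(-zW_\alpha(t))]=\Gamma(1-\alpha)tz^\alpha$ for $z\geq 0$, where $\Gamma$ is the Euler gamma function, and let $W_\alpha^\leftarrow(t):=\inf\{s\geq 0: W_\alpha(s)>t\}$, $t\ge 0$, be the inverse subordinator. It holds that $\mathbb{E}[W_\alpha^\leftarrow(1)]=(\Gamma(1-\alpha)\Gamma(1+\alpha))^{-1}$. Put $Z_\alpha:=W_\alpha^\leftarrow(1)/\mathbb{E}[W_\alpha^\leftarrow(1)]$. For $\alpha=0$, $Z_0$ denotes a random variable with the exponential distribution of unit mean. Notation: $f(t)\sim g(t)$ as $t\to\infty$ means $\lim_{t\to\infty} f(t)/g(t)=1$. *)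

theory Defs
  imports "HOL-Probability.Probability" "HOL-Library.Landau_Symbols"
begin

definition slowly_varying :: "(real \<Rightarrow> real) \<Rightarrow> bool" where
  "slowly_varying l \<longleftrightarrow>
     (\<exists>X>0. l \<in> borel_measurable (restrict_space borel {X..}) \<and> (\<forall>x\<ge>X. 0 < l x)) \<and>
     (\<forall>c>0. ((\<lambda>t. l (c * t) / l t) \<longlongrightarrow> 1) at_top)"

text \<open>
  \<open>X 1, X 2, \<dots>\<close> are independent copies of \<open>\<xi>\<close>, and \<open>T 1, T 2, \<dots>\<close> are independent with
  \<open>T n\<close> distributed as \<open>X 1 + \<dots> + X n\<close>. The values \<open>X 0\<close> and \<open>T 0\<close> play no role. The
  dependence between the sequences \<open>X\<close> and \<open>T\<close> is left unspecified.
\<close>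

definition decoupled_walk ::
  "'a measure \<Rightarrow> ('a \<Rightarrow> real) \<Rightarrow> (nat \<Rightarrow> 'a \<Rightarrow> real) \<Rightarrow> (nat \<Rightarrow> 'a \<Rightarrow> real) \<Rightarrow> bool" where
  "decoupled_walk M \<xi> X T \<longleftrightarrow>
     prob_space.indep_vars M (\<lambda>_. borel) X {1..} \<and>
     (\<forall>i\<ge>1. distr M borel (X i) = distr M borel \<xi>) \<and>
     prob_space.indep_vars M (\<lambda>_. borel) T {1..} \<and>
     (\<forall>n\<ge>1. distr M borel (T n) = distr M borel (\<lambda>\<omega>. \<Sum>i=1..n. X i \<omega>))"

text \<open>
  The number of \<open>n \<ge> 1\<close> with \<open>T n \<le> t\<close>; it may be infinite on a null set, hence the type
  \<^typ>\<open>ennreal\<close>.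
\<close>

definition renewal_count :: "(nat \<Rightarrow> 'a \<Rightarrow> real) \<Rightarrow> real \<Rightarrow> 'a \<Rightarrow> ennreal" where
  "renewal_count T t \<omega> = (\<Sum>n. indicator {..t} (T (Suc n) \<omega>))"

definition renewal_fun :: "'a measure \<Rightarrow> (nat \<Rightarrow> 'a \<Rightarrow> real) \<Rightarrow> real \<Rightarrow> real" where
  "renewal_fun M T t = enn2real (\<integral>\<^sup>+\<omega>. renewal_count T t \<omega> \<partial>M)"

text \<open>
  Path properties are required for every \<open>\<omega>\<close>, so that first passage times are measurable
  also when \<open>Q\<close> is not complete. Left limits exist by monotonicity, and the prescribed
  Laplace exponent has no linear term, i.e. there is no drift.
\<close>

definition stable_subordinator :: "'b measure \<Rightarrow> real \<Rightarrow> (real \<Rightarrow> 'b \<Rightarrow> real) \<Rightarrow> bool" where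
  "stable_subordinator Q \<alpha> W \<longleftrightarrow>
     prob_space Q \<and>
     (\<forall>t\<ge>0. W t \<in> borel_measurable Q) \<and>
     (\<forall>\<omega>\<in>space Q. W 0 \<omega> = 0 \<and> mono_on {0..} (\<lambda>t. W t \<omega>) \<and>
        (\<forall>t\<ge>0. continuous (at_right t) (\<lambda>u. W u \<omega>))) \<and>
     (\<forall>n (\<tau> :: nat \<Rightarrow> real). 0 \<le> \<tau> 0 \<and> mono \<tau> \<longrightarrow>
        prob_space.indep_vars Q (\<lambda>_. borel) (\<lambda>i \<omega>. W (\<tau> (Suc i)) \<omega> - W (\<tau> i) \<omega>) {..<n}) \<and>
     (\<forall>s\<ge>0. \<forall>t\<ge>0. distr Q borel (\<lambda>\<omega>. W (s + t) \<omega> - W s \<omega>) = distr Q borel (W t)) \<and>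
     (\<forall>t\<ge>0. \<forall>z\<ge>0. - ln (prob_space.expectation Q (\<lambda>\<omega>. exp (- z * W t \<omega>)))
        = Gamma (1 - \<alpha>) * t * z powr \<alpha>)"

text \<open>
  The underlying set is empty only on the null set of paths that never exceed \<open>t\<close>, where the
  value is an arbitrary constant.
\<close>

definition inverse_subordinator :: "(real \<Rightarrow> 'b \<Rightarrow> real) \<Rightarrow> real \<Rightarrow> 'b \<Rightarrow> real" where
  "inverse_subordinator W t \<omega> = Inf {s. 0 \<le> s \<and> W s \<omega> > t}"

text \<open>
  \<open>Z\<close>, defined on the probability space \<open>Q\<close>, is a version of the variable \<open>Z\<^sub>\<alpha>\<close>,
  \<open>0 \<le> \<alpha> < 1\<close>; its law depends on \<open>\<alpha>\<close> only.
\<close>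

definition is_Z :: "'b measure \<Rightarrow> real \<Rightarrow> ('b \<Rightarrow> real) \<Rightarrow> bool" where
  "is_Z Q \<alpha> Z \<longleftrightarrow> prob_space Q \<and>
     (if \<alpha> = 0 then distributed Q lborel Z (exponential_density 1)
      else \<exists>W. stable_subordinator Q \<alpha> W \<and>
        Z = (\<lambda>\<omega>. inverse_subordinator W 1 \<omega> /
                    prob_space.expectation Q (inverse_subordinator W 1)))"

definition log_mgf :: "'b measure \<Rightarrow> ('b \<Rightarrow> real) \<Rightarrow> real \<Rightarrow> real" where
  "log_mgf Q Z s =
     (LINT y:{0<..}|lborel. ln ((exp s - 1) * \<P>(\<omega> in Q. Z \<omega> > y) + 1))"

definition legendre :: "(real \<Rightarrow> real) \<Rightarrow> real \<Rightarrow> ereal" where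
  "legendre f x = (SUP s. ereal (s * x - f s))"

end

theory Submission
  imports Defs
begin

text \<open>
  Write \<open>G t = \<P>(\<xi> > t)\<close>. Since \<open>G\<close> is monotone and regularly varying, an Abelian argument gives
  \<open>1 - E exp (- r \<xi> / t) \<sim> \<Gamma>(1 - \<alpha>) r\<^sup>\<alpha> G t\<close>. Hence, if \<open>n(t) G t\<close> tends to \<open>v\<close>, the integer moments of
  \<open>exp (- S\<^bsub>n(t)\<^esub> / t)\<close> converge to those of \<open>exp (- W(v))\<close>, and \<open>\<P>(S\<^bsub>n(t)\<^esub> \<le> t)\<close> converges to some \<open>q v\<close> for
  almost every \<open>v\<close>, with an exponential bound that is uniform in \<open>n\<close>. By dominated convergence, sums
  \<open>G t * (\<Sum>n. g (\<P>(S\<^sub>n \<le> t)))\<close> tend to \<open>\<integral> g (q v) dv\<close> whenever \<open>g\<close> is continuous with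
  \<open>\<bar>g x\<bar> \<le> C x\<close>. This covers the renewal function (\<open>g x = x\<close>, no Tauberian theorem needed), the logarithmic
  moment generating function of the count, and its derivative. The survival function of \<open>Z\<close> is \<open>q\<close> up to
  scaling, because \<open>W\<close> exceeds level \<open>1\<close> after time \<open>v\<close> iff \<open>W v \<le> 1\<close>.

  The count is a sum of independent indicators. The upper bound for its point probabilities is
  Chernoff's. For the lower bound, two exponential tilts with means just below and just above \<open>b U(t)\<close>
  produce two values with large enough probability, and log-concavity of the Poisson binomial
  distribution carries this over to the value in between.
\<close>

subsection \<open>Poisson binomial distributions\<close>

text \<open>Passing from \<open>S / t\<close> to \<open>exp (- S / t)\<close> turns convergence in
  law into a moment problem on \<open>{0..1}\<close> and treats \<open>\<alpha> = 0\<close> on the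
  same footing: there the limit is an indicator, as if \<open>S / t\<close> tended to 0 or to
  infinity. Limits are obtained only at levels \<open>v\<close> that are not atoms; the atoms are
  countable and invisible to integrals in \<open>v\<close>.

  Two normalisations must match. Sums are measured against \<open>1 / G t\<close>, the theorem
  divides by \<open>U t\<close>. As \<open>G t * U t\<close> tends to
  \<open>stable_const \<alpha>\<close>, changing between them divides every limit by this constant,
  which is also the factor produced by rescaling \<open>Z\<close> to mean 1.

  The maximiser in the Legendre transform is the tilt whose limiting mean is \<open>b\<close>; it
  exists because \<open>0 < q v < 1\<close> for \<open>0 < v\<close>. Its optimality is not found by
  differentiation: the Chernoff bound at any other tilt must be compatible with the lower bound
  obtained near this one. The rate is positive by comparison with a Poisson variable, through
  \<open>ln x \<le> x - 1\<close>: the Poisson rate \<open>b * ln b - b + 1\<close> vanishes only at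
  \<open>b = 1\<close>.\<close>

primrec poisson_binomial :: "(nat \<Rightarrow> real) \<Rightarrow> nat \<Rightarrow> nat \<Rightarrow> real" where
  "poisson_binomial p 0 k = (if k = 0 then 1 else 0)"
| "poisson_binomial p (Suc m) k = (1 - p m) * poisson_binomial p m k +
     p m * (if k = 0 then 0 else poisson_binomial p m (k - 1))"

lemma poisson_binomial_eq_0: "m < k \<Longrightarrow> poisson_binomial p m k = 0"
  by (induction m arbitrary: k) auto

lemma poisson_binomial_nonneg:
  assumes "\<And>i. 0 \<le> p i" "\<And>i. p i \<le> 1"
  shows "0 \<le> poisson_binomial p m k"
  using assms by (induction m arbitrary: k) auto

text \<open>Conditioning on the last trial, for the expectation of an arbitrary function
  \<open>h\<close>. The generating function and the variance both follow from it by
  induction.\<close>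

lemma sum_poisson_binomial_Suc:
  "(\<Sum>k\<le>Suc m. poisson_binomial p (Suc m) k * h k) =
     (1 - p m) * (\<Sum>k\<le>m. poisson_binomial p m k * h k) +
     p m * (\<Sum>k\<le>m. poisson_binomial p m k * h (Suc k))"
proof -
  have "(\<Sum>k\<le>Suc m. poisson_binomial p (Suc m) k * h k) =
     (1 - p m) * (\<Sum>k\<le>Suc m. poisson_binomial p m k * h k) +
     p m * (\<Sum>k\<le>Suc m. (if k = 0 then 0 else poisson_binomial p m (k - 1)) * h k)"
    unfolding sum_distrib_left sum.distrib[symmetric]
    by (intro sum.cong) (auto simp: algebra_simps)
  also have "(\<Sum>k\<le>Suc m. poisson_binomial p m k * h k) = (\<Sum>k\<le>m. poisson_binomial p m k * h k)"
    by (simp add: poisson_binomial_eq_0)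
  also have "(\<Sum>k\<le>Suc m. (if k = 0 then 0 else poisson_binomial p m (k - 1)) * h k)
      = (\<Sum>k\<le>m. poisson_binomial p m k * h (Suc k))"
    by (subst sum.atMost_Suc_shift) simp
  finally show ?thesis .
qed

lemma poisson_binomial_genfun:
  "(\<Sum>k\<le>m. poisson_binomial p m k * x ^ k) = (\<Prod>i<m. 1 + (x - 1) * p i)"
proof (induction m)
  case (Suc m)
  have "(\<Sum>k\<le>m. poisson_binomial p m k * x ^ Suc k) = x * (\<Sum>k\<le>m. poisson_binomial p m k * x ^ k)"
    by (simp add: sum_distrib_left mult_ac)
  then show ?case
    unfolding sum_poisson_binomial_Suc Suc prod.lessThan_Suc by (simp add: algebra_simps)
qed simp

lemma poisson_binomial_sum: "(\<Sum>k\<le>m. poisson_binomial p m k) = 1"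
  using poisson_binomial_genfun[of p m 1] by simp

text \<open>The centre \<open>c\<close> stays free because a success in the last trial shifts it to
  \<open>c - 1\<close> in the induction; the variance itself is the case where \<open>c\<close> is
  the mean.\<close>

lemma poisson_binomial_variance:
  "(\<Sum>k\<le>m. poisson_binomial p m k * (real k - c)\<^sup>2) =
     (\<Sum>i<m. p i * (1 - p i)) + ((\<Sum>i<m. p i) - c)\<^sup>2"
proof (induction m arbitrary: c)
  case (Suc m)
  have shift: "(\<Sum>k\<le>m. poisson_binomial p m k * (real (Suc k) - c)\<^sup>2) =
      (\<Sum>i<m. p i * (1 - p i)) + ((\<Sum>i<m. p i) - (c - 1))\<^sup>2"
    unfolding Suc[symmetric] by (simp add: algebra_simps)
  show ?case
    unfolding sum_poisson_binomial_Suc Suc shift sum.lessThan_Suc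
    by (simp add: power2_eq_square algebra_simps)
qed simp

text \<open>Weighting the outcome \<open>k\<close> by \<open>x ^ k\<close> factorises over the
  trials, so the tilted law is again Poisson binomial, with each success probability tilted
  separately. The normalising product is kept on the left to avoid dividing by it.\<close>

lemma poisson_binomial_tilt:
  assumes "\<And>i. 1 + (x - 1) * p i \<noteq> 0"
  shows "poisson_binomial (\<lambda>i. x * p i / (1 + (x - 1) * p i)) m k * (\<Prod>i<m. 1 + (x - 1) * p i) =
     x ^ k * poisson_binomial p m k"
proof (induction m arbitrary: k)
  case (Suc m)
  let ?p = "\<lambda>i. x * p i / (1 + (x - 1) * p i)"
  let ?P = "\<Prod>i<m. 1 + (x - 1) * p i"
  let ?d = "1 + (x - 1) * p m"
  have 1: "(1 - ?p m) * ?d = 1 - p m" "?p m * ?d = x * p m"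
    using assms[of m] by (simp_all add: left_diff_distrib)
  have "poisson_binomial ?p (Suc m) k * (\<Prod>i<Suc m. 1 + (x - 1) * p i) =
      ((1 - ?p m) * ?d) * (poisson_binomial ?p m k * ?P) +
      (?p m * ?d) * (if k = 0 then 0 else poisson_binomial ?p m (k - 1) * ?P)"
  proof -
    have "((1 - a) * B + a * (if k = 0 then 0 else C)) * (R * D) =
        ((1 - a) * D) * (B * R) + (a * D) * (if k = 0 then 0 else C * R)" for a B C R D :: real
      by (simp add: algebra_simps)
    then show ?thesis by (simp only: poisson_binomial.simps prod.lessThan_Suc)
  qed
  also have "\<dots> = x ^ k * poisson_binomial p (Suc m) k"
    unfolding 1 Suc by (cases k) (auto simp: algebra_simps)
  finally show ?case .
qed simp

text \<open>Adding one independent trial preserves log-concavity. The inequality is taken for all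
  \<open>i \<le> j\<close> and not only for neighbouring indices: this form remains informative when
  terms vanish, and the mixed terms of the induction step use it.\<close>

lemma poisson_binomial_log_concave:
  assumes p: "\<And>i. 0 \<le> p i" "\<And>i. p i \<le> 1" and "i \<le> j"
  shows "poisson_binomial p m i * poisson_binomial p m (Suc j)
    \<le> poisson_binomial p m (Suc i) * poisson_binomial p m j"
  using \<open>i \<le> j\<close>
proof (induction m arbitrary: i j)
  case (Suc m)
  define a where "a = poisson_binomial p m"
  \<comment> \<open>The shift of \<open>a\<close> by one place, which is the contribution of a
    successful last trial.\<close>
  define A where "A k = (if k = 0 then 0 else a (k - 1))" for k
  have a0: "0 \<le> a k" for k unfolding a_def by (rule poisson_binomial_nonneg[OF p])
  have A0: "0 \<le> A k" for k using a0 by (simp add: A_def)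
  have ASuc: "A (Suc k) = a k" for k by (simp add: A_def)
  have b: "poisson_binomial p (Suc m) k = (1 - p m) * a k + p m * A k" for k
    by (simp add: a_def A_def)
  have lc: "a i * a (Suc j) \<le> a (Suc i) * a j" if "i \<le> j" for i j
    using Suc.IH[OF that] by (simp add: a_def)
  have lc': "A i * a j \<le> a i * A j" if "i \<le> j" for i j
  proof (cases "i = 0")
    case False
    then show ?thesis using lc[of "i - 1" "j - 1"] that by (simp add: A_def)
  qed (use a0 A0 in \<open>simp add: A_def\<close>)
  \<comment> \<open>When the products are expanded, \<open>a i * a j\<close> occurs in the mixed
    terms of both sides and cancels; this comparison is what remains. It moves both indices inwards
    twice, passing through \<open>a i * a j\<close>.\<close>
  have lc2: "A i * a (Suc j) \<le> a (Suc i) * A j" if "i < j" for i j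
  proof (cases "i = 0")
    case False
    with that obtain i' j' where ij: "i = Suc i'" "j = Suc j'" by (cases i; cases j) auto
    have "a i' * a (Suc (Suc j')) \<le> a (Suc i') * a (Suc j')"
      using lc[of i' "Suc j'"] ij that by simp
    also have "\<dots> \<le> a (Suc (Suc i')) * a j'"
      using lc[of "Suc i'" j'] ij that by simp
    finally show ?thesis by (simp add: ij ASuc)
  qed (use a0 A0 in \<open>simp add: A_def\<close>)
  show ?case
  proof (cases "i = j")
    case False
    with Suc.prems have "i < j" by simp
    let ?q = "1 - p m"
    have q0: "0 \<le> ?q" using p(2)[of m] by simp
    have "?q * ?q * (a i * a (Suc j)) \<le> ?q * ?q * (a (Suc i) * a j)"
      using lc[OF Suc.prems] q0 by (intro mult_left_mono) auto
    moreover have "p m * p m * (A i * a j) \<le> p m * p m * (a i * A j)"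
      using lc'[OF Suc.prems] p by (intro mult_left_mono) auto
    moreover have "?q * p m * (A i * a (Suc j)) \<le> ?q * p m * (a (Suc i) * A j)"
      using lc2[OF \<open>i < j\<close>] p q0 by (intro mult_left_mono) auto
    ultimately show ?thesis
      unfolding b ASuc by (simp add: algebra_simps)
  qed simp
qed simp

text \<open>A value below both ends would force a strict descent somewhere before \<open>k\<close>
  and a strict ascent somewhere after it, which log-concavity forbids.\<close>

lemma log_concave_ge_min:
  fixes a :: "nat \<Rightarrow> real"
  assumes a0: "\<And>i. 0 \<le> a i" and lc: "\<And>i j. i \<le> j \<Longrightarrow> a i * a (Suc j) \<le> a (Suc i) * a j"
    and "i \<le> k" "k \<le> j"
  shows "min (a i) (a j) \<le> a k"
proof (rule ccontr)
  assume "\<not> ?thesis"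
  then have ak: "a k < a i" "a k < a j" by auto
  have "\<exists>n. i \<le> n \<and> n < k \<and> a (Suc n) < a n"
  proof (rule ccontr)
    assume "\<not> ?thesis"
    then have step: "a n \<le> a (Suc n)" if "i \<le> n" "n < k" for n using that by force
    have "a i \<le> a k" using \<open>i \<le> k\<close>
      by (induction rule: dec_induct) (auto intro: order_trans step)
    then show False using ak by simp
  qed
  then obtain n where n: "i \<le> n" "n < k" "a (Suc n) < a n" by blast
  have "\<exists>n. k \<le> n \<and> n < j \<and> a n < a (Suc n)"
  proof (rule ccontr)
    assume "\<not> ?thesis"
    then have step: "a (Suc n) \<le> a n" if "k \<le> n" "n < j" for n using that by force
    have "a j \<le> a k" using \<open>k \<le> j\<close>
      by (induction rule: dec_induct) (auto intro: order_trans step)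
    then show False using ak by simp
  qed
  then obtain l where l: "k \<le> l" "l < j" "a l < a (Suc l)" by blast
  have "a (Suc n) * a l < a n * a (Suc l)"
    using n(3) l(3) a0 by (intro mult_strict_mono') auto
  then show False using lc[of n l] n l by simp
qed

lemma card_nat_near:
  assumes "0 \<le> d"
  shows "finite {k. \<bar>real k - c\<bar> \<le> d}" and "real (card {k. \<bar>real k - c\<bar> \<le> d}) \<le> 2 * d + 1"
proof -
  have sub: "int ` {k. \<bar>real k - c\<bar> \<le> d} \<subseteq> {\<lceil>c - d\<rceil>..\<lfloor>c + d\<rfloor>}"
    by (auto simp: ceiling_le_iff le_floor_iff)
  show fin: "finite {k. \<bar>real k - c\<bar> \<le> d}"
    using finite_subset[OF sub] by (rule finite_imageD) auto
  have "card {k. \<bar>real k - c\<bar> \<le> d} = card (int ` {k. \<bar>real k - c\<bar> \<le> d})"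
    by (simp add: card_image)
  also have "\<dots> \<le> card {\<lceil>c - d\<rceil>..\<lfloor>c + d\<rfloor>}" by (intro card_mono sub) simp
  also have "real \<dots> \<le> 2 * d + 1" using assms by simp linarith
  finally show "real (card {k. \<bar>real k - c\<bar> \<le> d}) \<le> 2 * d + 1" by simp
qed

text \<open>Chebyshev and pigeonhole: the variance is at most the mean, hence at most half of
  \<open>d\<^sup>2\<close>, so the window of radius \<open>d\<close> around the mean carries mass at
  least 1/2, and it contains at most \<open>2 * d + 1\<close> integers.\<close>

lemma poisson_binomial_concentration:
  assumes p: "\<And>i. 0 \<le> p i" "\<And>i. p i \<le> 1" and d: "0 < d" "2 * (\<Sum>i<m. p i) \<le> d\<^sup>2"
  shows "\<exists>k. \<bar>real k - (\<Sum>i<m. p i)\<bar> \<le> d \<and> 1 / (2 * (2 * d + 1)) \<le> poisson_binomial p m k"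
proof (rule ccontr)
  assume "\<not> ?thesis"
  then have less: "poisson_binomial p m k < 1 / (2 * (2 * d + 1))"
    if "\<bar>real k - (\<Sum>i<m. p i)\<bar> \<le> d" for k using that by force
  let ?a = "poisson_binomial p m" and ?\<mu> = "\<Sum>i<m. p i"
  let ?A = "{k. \<bar>real k - ?\<mu>\<bar> \<le> d}"
  note fin = card_nat_near[OF less_imp_le[OF d(1)], of ?\<mu>]
  have a0: "0 \<le> ?a k" for k by (rule poisson_binomial_nonneg[OF p])
  have "(\<Sum>k\<in>{..m} - ?A. ?a k) * d\<^sup>2 \<le> (\<Sum>k\<in>{..m} - ?A. ?a k * (real k - ?\<mu>)\<^sup>2)"
    unfolding sum_distrib_right
  proof (intro sum_mono mult_left_mono a0)
    fix k assume "k \<in> {..m} - ?A"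
    then have "d \<le> \<bar>real k - ?\<mu>\<bar>" by auto
    then show "d\<^sup>2 \<le> (real k - ?\<mu>)\<^sup>2" using d by (metis abs_le_square_iff abs_of_pos)
  qed
  also have "\<dots> \<le> (\<Sum>k\<le>m. ?a k * (real k - ?\<mu>)\<^sup>2)"
    by (intro sum_mono2) (auto simp: a0)
  also have "\<dots> = (\<Sum>i<m. p i * (1 - p i))" by (simp add: poisson_binomial_variance)
  also have "\<dots> \<le> ?\<mu>" by (intro sum_mono) (use p in \<open>auto simp: mult_left_le\<close>)
  also have "\<dots> \<le> 1/2 * d\<^sup>2" using d by simp
  finally have "(\<Sum>k\<in>{..m} - ?A. ?a k) \<le> 1/2" using d by (simp only: mult_le_cancel_right) auto
  moreover have "(\<Sum>k\<in>{..m} \<inter> ?A. ?a k) + (\<Sum>k\<in>{..m} - ?A. ?a k) = 1"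
    using sum.Int_Diff[of "{..m}" ?a ?A] poisson_binomial_sum[of p m] by simp
  ultimately have "1/2 \<le> (\<Sum>k\<in>{..m} \<inter> ?A. ?a k)" by simp
  also have "\<dots> < 1/2"
  proof (cases "{..m} \<inter> ?A = {}")
    case False
    have "(\<Sum>k\<in>{..m} \<inter> ?A. ?a k) < (\<Sum>k\<in>{..m} \<inter> ?A. 1 / (2 * (2 * d + 1)))"
      by (intro sum_strict_mono) (use False less in auto)
    also have "\<dots> = real (card ({..m} \<inter> ?A)) * (1 / (2 * (2 * d + 1)))" by simp
    also have "\<dots> \<le> (2 * d + 1) * (1 / (2 * (2 * d + 1)))"
    proof (intro mult_right_mono)
      have "card ({..m} \<inter> ?A) \<le> card ?A" by (intro card_mono fin) auto
      then show "real (card ({..m} \<inter> ?A)) \<le> 2 * d + 1" using fin(2) by linarith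
    qed (use d in auto)
    also have "\<dots> = 1/2" using d by (simp add: field_simps)
    finally show ?thesis .
  qed simp
  finally show False by simp
qed

section \<open>Exponential tilting of sums of independent indicators\<close>

text \<open>The success probability of a Bernoulli variable with parameter \<open>x\<close> after
  reweighting by \<open>exp (s * k)\<close>; equally the derivative in \<open>s\<close> of its log
  moment generating function \<open>ln (1 + (exp s - 1) * x)\<close>.\<close>

definition tilt :: "real \<Rightarrow> real \<Rightarrow> real" where
  "tilt s x = exp s * x / (1 + (exp s - 1) * x)"

text \<open>The denominator is the convex combination of 1 and \<open>exp s\<close> with weights
  \<open>1 - x\<close> and \<open>x\<close>.\<close>

lemma tilt_denom_ge:
  fixes s x :: real
  assumes "0 \<le> x" "x \<le> 1"
  shows "min 1 (exp s) \<le> 1 + (exp s - 1) * x"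
proof (cases "0 \<le> s")
  case True
  then show ?thesis using assms by simp
next
  case False
  then have "(1 - exp s) * x \<le> (1 - exp s) * 1" using assms by (intro mult_left_mono) auto
  then show ?thesis by (simp add: algebra_simps)
qed

lemma tilt_denom_pos:
  fixes s x :: real
  assumes "0 \<le> x" "x \<le> 1"
  shows "0 < 1 + (exp s - 1) * x"
  by (rule less_le_trans[OF _ tilt_denom_ge[OF assms]]) simp

lemma tilt_nonneg: "0 \<le> x \<Longrightarrow> x \<le> 1 \<Longrightarrow> 0 \<le> tilt s x"
  using tilt_denom_pos[of x s] by (simp add: tilt_def)

lemma tilt_le_1: "0 \<le> x \<Longrightarrow> x \<le> 1 \<Longrightarrow> tilt s x \<le> 1"
  using tilt_denom_pos[of x s] by (simp add: tilt_def divide_le_eq algebra_simps)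

text \<open>Linear domination in \<open>x\<close> makes sums of tilted probabilities converge with
  those of the original ones, and serves as the bound with \<open>C = exp \<bar>s\<bar>\<close> in
  the passage from sums to integrals. The next lemma does the same for the logarithm.\<close>

lemma tilt_le:
  assumes "0 \<le> x" "x \<le> 1" shows "tilt s x \<le> exp \<bar>s\<bar> * x"
proof -
  have "tilt s x \<le> exp s * x / min 1 (exp s)"
    unfolding tilt_def by (intro divide_left_mono tilt_denom_ge) (use assms tilt_denom_pos in auto)
  also have "\<dots> = exp s / min 1 (exp s) * x" by simp
  also have "\<dots> \<le> exp \<bar>s\<bar> * x"
    using assms by (intro mult_right_mono) (auto simp: min_def)
  finally show ?thesis .
qed

lemma abs_ln_tilt_denom_le:
  fixes s x :: real
  assumes "0 \<le> x" "x \<le> 1"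
  shows "\<bar>ln (1 + (exp s - 1) * x)\<bar> \<le> exp \<bar>s\<bar> * x"
proof -
  let ?d = "1 + (exp s - 1) * x"
  have pos: "0 < ?d" by (rule tilt_denom_pos[OF assms])
  have up: "ln ?d \<le> (exp s - 1) * x" using ln_le_minus_one[OF pos] by simp
  have "- ln ?d = ln (1 / ?d)" using pos by (simp add: ln_div)
  also have "\<dots> \<le> 1 / ?d - 1" using pos by (intro ln_le_minus_one) simp
  also have "\<dots> = (1 - exp s) * x / ?d" using pos by (simp add: field_simps)
  finally have lo: "- ln ?d \<le> (1 - exp s) * x / ?d" .
  show ?thesis
  proof (cases "0 \<le> s")
    case True
    then have "0 \<le> ln ?d" using assms by (intro ln_ge_zero) auto
    moreover have "(exp s - 1) * x \<le> exp s * x" using assms by (simp add: algebra_simps)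
    ultimately show ?thesis using up True by simp
  next
    case False
    have "ln ?d \<le> 0" using False assms pos by (simp add: ln_le_zero_iff mult_nonpos_nonneg)
    moreover have "(1 - exp s) * x / ?d \<le> (1 - exp s) * x / exp s"
      using tilt_denom_ge[OF assms, of s] False assms pos
      by (intro divide_left_mono) auto
    moreover have "(1 - exp s) * x / exp s \<le> exp (-s) * x"
      using assms by (simp add: exp_minus field_simps mult_right_mono)
    ultimately show ?thesis using lo False by simp
  qed
qed

text \<open>\<open>P\<close> is the law of an infinite sum of independent indicators, accessible as
  the limit of the laws of its finite partial sums. All bounds are therefore proved for
  \<open>m\<close> trials and then passed to the limit.\<close>

context
  fixes p :: "nat \<Rightarrow> real" and P :: "nat \<Rightarrow> real"
  assumes p: "\<And>i. 0 \<le> p i" "\<And>i. p i \<le> 1" and sum_p: "summable p"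
    and P: "\<And>k. (\<lambda>m. poisson_binomial p m k) \<longlonglongrightarrow> P k"
begin

lemma summable_ln_tilt_denom: "summable (\<lambda>n. ln (1 + (exp s - 1) * p n))"
  by (rule summable_comparison_test'[of "\<lambda>n. exp \<bar>s\<bar> * p n" 0])
     (use sum_p abs_ln_tilt_denom_le p in \<open>auto intro: summable_mult\<close>)

lemma summable_tilt: "summable (\<lambda>n. tilt s (p n))"
  by (rule summable_comparison_test'[of "\<lambda>n. exp \<bar>s\<bar> * p n" 0])
     (use sum_p tilt_le tilt_nonneg p in \<open>auto intro: summable_mult\<close>)

lemma prod_tilt_denom: "(\<Prod>i<m. 1 + (exp s - 1) * p i) = exp (\<Sum>i<m. ln (1 + (exp s - 1) * p i))"
  by (simp add: exp_sum tilt_denom_pos p)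

text \<open>A single term of the generating function at \<open>exp s\<close> is at most the whole
  sum, which is a product over the trials.\<close>

lemma Chernoff_bound:
  "P k \<le> exp ((\<Sum>n. ln (1 + (exp s - 1) * p n)) - s * real k)"
proof (rule LIMSEQ_le[OF P])
  show "(\<lambda>m. exp ((\<Sum>i<m. ln (1 + (exp s - 1) * p i)) - s * real k)) \<longlonglongrightarrow>
      exp ((\<Sum>n. ln (1 + (exp s - 1) * p n)) - s * real k)"
    by (intro tendsto_intros summable_LIMSEQ summable_ln_tilt_denom)
  have "poisson_binomial p m k \<le> exp ((\<Sum>i<m. ln (1 + (exp s - 1) * p i)) - s * real k)" if "k \<le> m" for m
  proof -
    have "poisson_binomial p m k * exp s ^ k \<le> (\<Sum>k\<le>m. poisson_binomial p m k * exp s ^ k)"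
      using that by (intro member_le_sum) (auto simp: poisson_binomial_nonneg p)
    also have "\<dots> = exp (\<Sum>i<m. ln (1 + (exp s - 1) * p i))"
      by (simp add: poisson_binomial_genfun prod_tilt_denom)
    finally show ?thesis by (simp add: exp_diff pos_le_divide_eq exp_of_nat2_mult)
  qed
  then show "\<exists>N. \<forall>m\<ge>N. poisson_binomial p m k \<le> exp ((\<Sum>i<m. ln (1 + (exp s - 1) * p i)) - s * real k)"
    by blast
qed

text \<open>Under the tilted law some \<open>k\<close> within \<open>d\<close> of the tilted mean is
  likely. Undoing the tilt costs the factor \<open>exp (?L - s * real k)\<close>, and replacing
  \<open>k\<close> by the mean costs at most \<open>\<bar>s\<bar> * d\<close> in the exponent. Since
  \<open>d\<close> is controlled by the full series, one \<open>d\<close> serves every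
  \<open>m\<close>.\<close>

lemma tilted_local_bound:
  assumes d: "0 < d" "2 * (\<Sum>n. tilt s (p n)) \<le> d\<^sup>2"
  shows "\<exists>k. \<bar>real k - (\<Sum>i<m. tilt s (p i))\<bar> \<le> d \<and>
    exp ((\<Sum>i<m. ln (1 + (exp s - 1) * p i)) - s * (\<Sum>i<m. tilt s (p i)) - \<bar>s\<bar> * d) / (2 * (2 * d + 1))
      \<le> poisson_binomial p m k"
proof -
  let ?\<mu> = "\<Sum>i<m. tilt s (p i)" and ?L = "\<Sum>i<m. ln (1 + (exp s - 1) * p i)"
  have "?\<mu> \<le> (\<Sum>n. tilt s (p n))"
    by (intro sum_le_suminf summable_tilt) (auto simp: tilt_nonneg p)
  then have "2 * ?\<mu> \<le> d\<^sup>2" using d by simp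
  from poisson_binomial_concentration[OF _ _ d(1) this]
  obtain k where k: "\<bar>real k - ?\<mu>\<bar> \<le> d"
    and pb: "1 / (2 * (2 * d + 1)) \<le> poisson_binomial (\<lambda>i. tilt s (p i)) m k"
    using tilt_nonneg tilt_le_1 p by blast
  have "1 / (2 * (2 * d + 1)) * exp ?L \<le> poisson_binomial (\<lambda>i. tilt s (p i)) m k * exp ?L"
    using pb by (intro mult_right_mono) auto
  also have "\<dots> = exp s ^ k * poisson_binomial p m k"
    using poisson_binomial_tilt[of "exp s" p m k] tilt_denom_pos p
    by (metis (no_types, lifting) ext less_irrefl prod_tilt_denom tilt_def)
  finally have 1: "exp ?L / (2 * (2 * d + 1)) / exp (s * real k) \<le> poisson_binomial p m k"
    using d by (subst pos_divide_le_eq) (simp_all add: exp_of_nat2_mult mult.commute)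
  have "s * real k - s * ?\<mu> \<le> \<bar>s\<bar> * \<bar>real k - ?\<mu>\<bar>"
    by (metis abs_ge_self abs_mult right_diff_distrib)
  also have "\<dots> \<le> \<bar>s\<bar> * d" using k by (intro mult_left_mono) auto
  finally have "exp (?L - s * ?\<mu> - \<bar>s\<bar> * d) \<le> exp (?L - s * real k)" by simp
  then have "exp (?L - s * ?\<mu> - \<bar>s\<bar> * d) / (2 * (2 * d + 1)) \<le> exp (?L - s * real k) / (2 * (2 * d + 1))"
    using d by (intro divide_right_mono) auto
  also have "\<dots> = exp ?L / (2 * (2 * d + 1)) / exp (s * real k)" by (simp add: exp_diff)
  finally show ?thesis using k 1 by (intro exI[of _ k]) linarith
qed

text \<open>
  Two exponential tilts put mass on either side of \<open>k\<close>; log-concavity transfers the resulting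
  local bounds to \<open>k\<close> itself, so no local limit theorem is needed.
\<close>

lemma local_lower_bound:
  assumes d: "0 < d" "2 * (\<Sum>n. tilt r (p n)) \<le> d\<^sup>2" "2 * (\<Sum>n. tilt s (p n)) \<le> d\<^sup>2"
    and k: "(\<Sum>n. tilt r (p n)) + d < real k" "real k < (\<Sum>n. tilt s (p n)) - d"
  defines "B \<equiv> \<lambda>s. (\<Sum>n. ln (1 + (exp s - 1) * p n)) - s * (\<Sum>n. tilt s (p n)) - \<bar>s\<bar> * d"
  shows "exp (min (B r) (B s)) / (2 * (2 * d + 1)) \<le> P k"
proof (rule LIMSEQ_le[OF _ P])
  define b where "b s m = (\<Sum>i<m. ln (1 + (exp s - 1) * p i)) - s * (\<Sum>i<m. tilt s (p i)) - \<bar>s\<bar> * d" for s m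
  have b: "b s \<longlonglongrightarrow> B s" for s
    unfolding b_def B_def by (intro tendsto_intros summable_LIMSEQ summable_tilt summable_ln_tilt_denom)
  show "(\<lambda>m. exp (min (b r m) (b s m)) / (2 * (2 * d + 1))) \<longlonglongrightarrow> exp (min (B r) (B s)) / (2 * (2 * d + 1))"
    using d by (intro tendsto_intros b) auto
  \<comment> \<open>Partial means increase to their limits. On the \<open>r\<close> side the
    required upper bound thus holds for every \<open>m\<close>; on the \<open>s\<close> side
    \<open>m\<close> must be large enough for the partial mean to pass
    \<open>real k + d\<close>.\<close>
  have "\<forall>\<^sub>F m in sequentially. real k + d < (\<Sum>i<m. tilt s (p i))"
    using k(2) by (intro order_tendstoD(1)[OF summable_LIMSEQ[OF summable_tilt]]) auto
  then have "\<forall>\<^sub>F m in sequentially. exp (min (b r m) (b s m)) / (2 * (2 * d + 1)) \<le> poisson_binomial p m k"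
  proof eventually_elim
    case (elim m)
    have "(\<Sum>i<m. tilt r (p i)) \<le> (\<Sum>n. tilt r (p n))"
      by (intro sum_le_suminf summable_tilt) (auto simp: tilt_nonneg p)
    moreover obtain i where "\<bar>real i - (\<Sum>i<m. tilt r (p i))\<bar> \<le> d"
       and i: "exp (b r m) / (2 * (2 * d + 1)) \<le> poisson_binomial p m i"
      using tilted_local_bound[OF d(1,2)] unfolding b_def by blast
    moreover obtain j where "\<bar>real j - (\<Sum>i<m. tilt s (p i))\<bar> \<le> d"
       and j: "exp (b s m) / (2 * (2 * d + 1)) \<le> poisson_binomial p m j"
      using tilted_local_bound[OF d(1,3)] unfolding b_def by blast
    ultimately have "real i \<le> real k" "real k \<le> real j" using elim k by linarith+
    then have "min (poisson_binomial p m i) (poisson_binomial p m j) \<le> poisson_binomial p m k"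
      by (intro log_concave_ge_min poisson_binomial_nonneg poisson_binomial_log_concave p) auto
    moreover have "exp (min (b r m) (b s m)) / (2 * (2 * d + 1)) \<le>
        min (poisson_binomial p m i) (poisson_binomial p m j)"
      using i j d(1) by (smt (verit) divide_right_mono exp_le_cancel_iff)
    ultimately show ?case by linarith
  qed
  then show "\<exists>N. \<forall>m\<ge>N. exp (min (b r m) (b s m)) / (2 * (2 * d + 1)) \<le> poisson_binomial p m k"
    by (simp add: eventually_sequentially)
qed

end

subsection \<open>Convergence of moments on the unit interval\<close>

lemma integrable_continuous_unit_interval:
  fixes h :: "real \<Rightarrow> real"
  assumes "prob_space M" "X \<in> borel_measurable M" "AE \<omega> in M. X \<omega> \<in> {0..1}"
    and h: "continuous_on UNIV h"
  shows "integrable M (\<lambda>\<omega>. h (X \<omega>))"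
proof -
  interpret prob_space M by fact
  have "compact (h ` {0..1})"
    by (intro compact_continuous_image continuous_on_subset[OF h]) auto
  then have "bounded (h ` {0..1})" by (rule compact_imp_bounded)
  then obtain B where "\<forall>y\<in>h ` {0..1}. norm y \<le> B" unfolding bounded_iff ..
  then have B: "norm (h x) \<le> B" if "x \<in> {0..1}" for x using that by blast
  show ?thesis
  proof (rule integrable_const_bound)
    show "AE \<omega> in M. norm (h (X \<omega>)) \<le> B" using assms(3) by eventually_elim (rule B)
    show "(\<lambda>\<omega>. h (X \<omega>)) \<in> borel_measurable M"
      by (rule measurable_compose[OF assms(2) borel_measurable_continuous_onI[OF h]])
  qed
qed

lemma expectation_uniform_approx:
  fixes h g :: "real \<Rightarrow> real"
  assumes P: "prob_space P" "Z \<in> borel_measurable P" "AE \<omega> in P. Z \<omega> \<in> {0..1}"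
    and hg: "continuous_on UNIV h" "continuous_on UNIV g"
    and close: "\<And>x. x \<in> {0..1} \<Longrightarrow> \<bar>h x - g x\<bar> \<le> e"
  shows "\<bar>(LINT \<omega>|P. h (Z \<omega>)) - (LINT \<omega>|P. g (Z \<omega>))\<bar> \<le> e"
proof -
  interpret P: prob_space P by fact
  note int = integrable_continuous_unit_interval[OF P hg(1)] integrable_continuous_unit_interval[OF P hg(2)]
  have "(LINT \<omega>|P. h (Z \<omega>)) - (LINT \<omega>|P. g (Z \<omega>)) = (LINT \<omega>|P. h (Z \<omega>) - g (Z \<omega>))"
    by (rule Bochner_Integration.integral_diff[symmetric]) (rule int)+
  also have "\<bar>\<dots>\<bar> \<le> (LINT \<omega>|P. \<bar>h (Z \<omega>) - g (Z \<omega>)\<bar>)"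
    by (rule integral_abs_bound)
  also have "\<dots> \<le> (LINT \<omega>|P. e)"
  proof (rule integral_mono_AE)
    show "integrable P (\<lambda>\<omega>. \<bar>h (Z \<omega>) - g (Z \<omega>)\<bar>)"
      by (intro integrable_abs Bochner_Integration.integrable_diff int)
    show "AE \<omega> in P. \<bar>h (Z \<omega>) - g (Z \<omega>)\<bar> \<le> e"
      using P(3) by eventually_elim (rule close)
  qed simp
  finally show ?thesis by (simp add: P.prob_space)
qed

lemma expectation_polynomial:
  fixes a :: "nat \<Rightarrow> real"
  assumes P: "prob_space P" "Z \<in> borel_measurable P" "AE \<omega> in P. Z \<omega> \<in> {0..1}"
  shows "(LINT \<omega>|P. (\<Sum>i\<le>n. a i * Z \<omega> ^ i)) = (\<Sum>i\<le>n. a i * (LINT \<omega>|P. Z \<omega> ^ i))"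
proof -
  have "integrable P (\<lambda>\<omega>. Z \<omega> ^ i)" for i
    by (rule integrable_continuous_unit_interval[OF P]) (intro continuous_intros)
  then show ?thesis by (subst Bochner_Integration.integral_sum) auto
qed

text \<open>On a bounded interval moments determine the law, by the Weierstrass approximation theorem.\<close>

lemma tendsto_expectation_of_moments:
  fixes X :: "'i \<Rightarrow> 'a \<Rightarrow> real" and Y :: "'b \<Rightarrow> real" and h :: "real \<Rightarrow> real"
  assumes M: "prob_space M" and N: "prob_space N"
    and X: "\<forall>\<^sub>F i in F. X i \<in> borel_measurable M \<and> (AE \<omega> in M. X i \<omega> \<in> {0..1})"
    and Y: "Y \<in> borel_measurable N" "AE \<omega> in N. Y \<omega> \<in> {0..1}"
    and mom: "\<And>k. 0 < k \<Longrightarrow> ((\<lambda>i. LINT \<omega>|M. X i \<omega> ^ k) \<longlongrightarrow> (LINT \<omega>|N. Y \<omega> ^ k)) F"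
    and h: "continuous_on UNIV h"
  shows "((\<lambda>i. LINT \<omega>|M. h (X i \<omega>)) \<longlongrightarrow> (LINT \<omega>|N. h (Y \<omega>))) F"
proof (rule tendstoI)
  fix e :: real assume e: "0 < e"
  interpret M: prob_space M by fact
  interpret N: prob_space N by fact
  obtain g where g: "real_polynomial_function g" "\<And>x. x \<in> {0..1} \<Longrightarrow> \<bar>h x - g x\<bar> < e / 3"
    using Stone_Weierstrass_real_polynomial_function[of "{0..1}" h "e/3"] e continuous_on_subset[OF h]
    by auto
  then obtain a n where gan: "g = (\<lambda>x. \<Sum>i\<le>n. a i * x ^ i)"
    by (auto simp: real_polynomial_function_iff_sum)
  have close: "\<bar>h x - g x\<bar> \<le> e / 3" if "x \<in> {0..1}" for x using g(2)[OF that] by simp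
  have gc: "continuous_on UNIV g" unfolding gan by (intro continuous_intros)
  have "((\<lambda>i. \<Sum>j\<le>n. a j * (LINT \<omega>|M. X i \<omega> ^ j)) \<longlongrightarrow> (\<Sum>j\<le>n. a j * (LINT \<omega>|N. Y \<omega> ^ j))) F"
  proof (intro tendsto_intros)
    fix j show "((\<lambda>i. LINT \<omega>|M. X i \<omega> ^ j) \<longlongrightarrow> (LINT \<omega>|N. Y \<omega> ^ j)) F"
      \<comment> \<open>The zeroth moments are 1 on both sides, so convergence is assumed only for
        positive exponents.\<close>
      by (cases "j = 0") (auto simp: M.prob_space N.prob_space intro: mom)
  qed
  then have "\<forall>\<^sub>F i in F. dist (\<Sum>j\<le>n. a j * (LINT \<omega>|M. X i \<omega> ^ j)) (\<Sum>j\<le>n. a j * (LINT \<omega>|N. Y \<omega> ^ j)) < e / 3"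
    using e by (intro tendstoD) auto
  with X show "\<forall>\<^sub>F i in F. dist (LINT \<omega>|M. h (X i \<omega>)) (LINT \<omega>|N. h (Y \<omega>)) < e"
  proof eventually_elim
    case (elim i)
    note X' = elim(1)[THEN conjunct1] elim(1)[THEN conjunct2]
    have tri: "\<bar>x - y\<bar> < e" if "\<bar>x - x'\<bar> \<le> e / 3" "\<bar>y - y'\<bar> \<le> e / 3" "\<bar>x' - y'\<bar> < e / 3"
      for x y x' y' :: real
      using that by linarith
    have "\<bar>(LINT \<omega>|M. g (X i \<omega>)) - (LINT \<omega>|N. g (Y \<omega>))\<bar> < e / 3"
      using elim(2) expectation_polynomial[OF M X', of a n] expectation_polynomial[OF N Y, of a n]
      unfolding dist_real_def gan by (simp only:)
    then show ?case
      unfolding dist_real_def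
      using expectation_uniform_approx[OF M X' h gc, of "e / 3"] expectation_uniform_approx[OF N Y h gc, of "e / 3"] close
      by (intro tri[of _ "LINT \<omega>|M. g (X i \<omega>)" _ "LINT \<omega>|N. g (Y \<omega>)"]) blast+
  qed
qed

text \<open>The indicator of a half-line is squeezed between continuous ramps on either side of
  \<open>a\<close>; the absence of an atom at \<open>a\<close> makes both ramps give the same
  limit.\<close>

lemma tendsto_prob_ge_of_moments:
  fixes X :: "'i \<Rightarrow> 'a \<Rightarrow> real" and Y :: "'b \<Rightarrow> real" and a :: real
  assumes M: "prob_space M" and N: "prob_space N"
    and X: "\<forall>\<^sub>F i in F. X i \<in> borel_measurable M \<and> (AE \<omega> in M. X i \<omega> \<in> {0..1})"
    and Y: "Y \<in> borel_measurable N" "AE \<omega> in N. Y \<omega> \<in> {0..1}"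
    and mom: "\<And>k. 0 < k \<Longrightarrow> ((\<lambda>i. LINT \<omega>|M. X i \<omega> ^ k) \<longlongrightarrow> (LINT \<omega>|N. Y \<omega> ^ k)) F"
    and atom: "measure N {\<omega> \<in> space N. Y \<omega> = a} = 0"
  shows "((\<lambda>i. measure M {\<omega> \<in> space M. a \<le> X i \<omega>}) \<longlongrightarrow> measure N {\<omega> \<in> space N. a \<le> Y \<omega>}) F"
proof -
  interpret M: prob_space M by fact
  interpret N: prob_space N by fact
  note [measurable] = Y(1)
  \<comment> \<open>A ramp that is 0 up to \<open>u\<close> and 1 from \<open>v\<close> on, when
    \<open>u < v\<close>.\<close>
  define h where "h u v x = max 0 (min 1 ((x - u) * inverse (v - u)))" for u v x :: real
  have h_cont: "continuous_on UNIV (h u v)" for u v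
    unfolding h_def by (intro continuous_intros)
  have h1: "h u v x = 1" if "u < v" "v \<le> x" for u v x using that by (simp add: h_def field_simps)
  have h0: "h u v x = 0" if "u < v" "x \<le> u" for u v x
    using mult_nonpos_nonneg[of "x - u" "inverse (v - u)"] that by (simp add: h_def)
  have h01: "0 \<le> h u v x" "h u v x \<le> 1" for u v x by (auto simp: h_def)
  have E: "((\<lambda>i. LINT \<omega>|M. h u v (X i \<omega>)) \<longlongrightarrow> (LINT \<omega>|N. h u v (Y \<omega>))) F" for u v
    by (rule tendsto_expectation_of_moments[OF M N X Y _ h_cont]) (rule mom)
  have [measurable]: "h u v \<in> borel_measurable borel" for u v
    by (rule borel_measurable_continuous_onI[OF h_cont])
  define \<epsilon> where "\<epsilon> n = inverse (real (Suc n))" for n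
  have \<epsilon>: "\<epsilon> n > 0" for n by (simp add: \<epsilon>_def)
  have \<epsilon>0: "\<epsilon> \<longlonglongrightarrow> 0" unfolding \<epsilon>_def by (rule LIMSEQ_inverse_real_of_nat)
  have noatom: "AE \<omega> in N. Y \<omega> \<noteq> a"
    by (rule AE_I[of _ _ "{\<omega> \<in> space N. Y \<omega> = a}"]) (auto simp: N.emeasure_eq_measure atom)
  \<comment> \<open>Both one-sided approximations at once: \<open>c = 0\<close> puts the ramp to the
    right of \<open>a\<close> and yields the lower bound, \<open>c = -1\<close> puts it to the left
    and yields the upper bound.\<close>
  have lim: "(\<lambda>n. LINT \<omega>|N. h (a + c * \<epsilon> n) (a + (c + 1) * \<epsilon> n) (Y \<omega>)) \<longlonglongrightarrow>
      measure N {\<omega> \<in> space N. a \<le> Y \<omega>}" for c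
  proof -
    have "(\<lambda>n. LINT \<omega>|N. h (a + c * \<epsilon> n) (a + (c + 1) * \<epsilon> n) (Y \<omega>)) \<longlonglongrightarrow>
      (LINT \<omega>|N. indicator {\<omega> \<in> space N. a \<le> Y \<omega>} \<omega>)"
    proof (rule integral_dominated_convergence[where w = "\<lambda>_. 1"])
      show "AE \<omega> in N. (\<lambda>n. h (a + c * \<epsilon> n) (a + (c + 1) * \<epsilon> n) (Y \<omega>)) \<longlonglongrightarrow>
          indicator {\<omega> \<in> space N. a \<le> Y \<omega>} \<omega>"
        using noatom AE_space
      proof eventually_elim
        case (elim \<omega>)
        have L: "(\<lambda>n. a + c' * \<epsilon> n) \<longlonglongrightarrow> a" for c'
          using tendsto_add[OF tendsto_const tendsto_mult[OF tendsto_const \<epsilon>0], of a c'] by simp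
        have lt: "a + c * \<epsilon> n < a + (c + 1) * \<epsilon> n" for n using \<epsilon>[of n] by (simp add: algebra_simps)
        show ?case
        proof (cases "a < Y \<omega>")
          case True
          have "\<forall>\<^sub>F n in sequentially. h (a + c * \<epsilon> n) (a + (c + 1) * \<epsilon> n) (Y \<omega>) = 1"
            using order_tendstoD(2)[OF L[of "c + 1"] True] by eventually_elim (auto intro: h1[OF lt])
          then show ?thesis using True elim by (simp add: tendsto_eventually)
        next
          case False
          with elim have "Y \<omega> < a" by simp
          have "\<forall>\<^sub>F n in sequentially. h (a + c * \<epsilon> n) (a + (c + 1) * \<epsilon> n) (Y \<omega>) = 0"
            using order_tendstoD(1)[OF L[of c] \<open>Y \<omega> < a\<close>] by eventually_elim (auto intro: h0[OF lt])
          then show ?thesis using \<open>Y \<omega> < a\<close> by (simp add: tendsto_eventually)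
        qed
      qed
    qed (simp_all add: h01)
    then show ?thesis by simp
  qed
  show ?thesis
  proof (rule order_tendstoI)
    fix c assume c: "c < measure N {\<omega> \<in> space N. a \<le> Y \<omega>}"
    obtain n where n: "c < (LINT \<omega>|N. h a (a + \<epsilon> n) (Y \<omega>))"
      using eventually_happens'[OF sequentially_bot order_tendstoD(1)[OF lim[of 0] c]] by auto
    from order_tendstoD(1)[OF E n] X
    show "\<forall>\<^sub>F i in F. c < measure M {\<omega> \<in> space M. a \<le> X i \<omega>}"
    proof eventually_elim
      case (elim i)
      then have [measurable]: "X i \<in> borel_measurable M" by simp
      have "{\<omega> \<in> space M. a \<le> X i \<omega>} \<in> sets M" by measurable
      then have int1: "integrable M (indicat_real {\<omega> \<in> space M. a \<le> X i \<omega>})"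
        by (simp add: M.emeasure_eq_measure)
      have int2: "integrable M (\<lambda>\<omega>. h u v (X i \<omega>))" for u v
        using elim by (intro integrable_continuous_unit_interval[OF M _ _ h_cont]) auto
      have "(LINT \<omega>|M. h a (a + \<epsilon> n) (X i \<omega>)) \<le> (LINT \<omega>|M. indicator {\<omega> \<in> space M. a \<le> X i \<omega>} \<omega>)"
      proof (rule integral_mono)
        show "h a (a + \<epsilon> n) (X i \<omega>) \<le> indicator {\<omega> \<in> space M. a \<le> X i \<omega>} \<omega>"
          if "\<omega> \<in> space M" for \<omega>
          using that h0[of a "a + \<epsilon> n" "X i \<omega>"] \<epsilon>[of n] h01(2) by (cases "a \<le> X i \<omega>") auto
      qed (fact int1 int2)+
      then show ?case using elim by simp
    qed
  next
    fix c assume c: "measure N {\<omega> \<in> space N. a \<le> Y \<omega>} < c"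
    obtain n where n: "(LINT \<omega>|N. h (a - \<epsilon> n) a (Y \<omega>)) < c"
      using eventually_happens'[OF sequentially_bot order_tendstoD(2)[OF lim[of "-1"] c]] by auto
    from order_tendstoD(2)[OF E n] X
    show "\<forall>\<^sub>F i in F. measure M {\<omega> \<in> space M. a \<le> X i \<omega>} < c"
    proof eventually_elim
      case (elim i)
      then have [measurable]: "X i \<in> borel_measurable M" by simp
      have "{\<omega> \<in> space M. a \<le> X i \<omega>} \<in> sets M" by measurable
      then have int1: "integrable M (indicat_real {\<omega> \<in> space M. a \<le> X i \<omega>})"
        by (simp add: M.emeasure_eq_measure)
      have int2: "integrable M (\<lambda>\<omega>. h u v (X i \<omega>))" for u v
        using elim by (intro integrable_continuous_unit_interval[OF M _ _ h_cont]) auto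
      have "(LINT \<omega>|M. indicator {\<omega> \<in> space M. a \<le> X i \<omega>} \<omega>) \<le> (LINT \<omega>|M. h (a - \<epsilon> n) a (X i \<omega>))"
      proof (rule integral_mono)
        show "indicator {\<omega> \<in> space M. a \<le> X i \<omega>} \<omega> \<le> h (a - \<epsilon> n) a (X i \<omega>)"
          if "\<omega> \<in> space M" for \<omega>
          using that h1[of "a - \<epsilon> n" a "X i \<omega>"] \<epsilon>[of n] h01(1) by (cases "a \<le> X i \<omega>") auto
      qed (fact int1 int2)+
      then show ?case using elim by simp
    qed
  qed
qed

subsection \<open>Laplace transforms of regularly varying tails\<close>

text \<open>Tonelli. It is used with an exponential density for Laplace transforms and with the
  constant 1 for means.\<close>

lemma layer_cake:
  fixes f :: "real \<Rightarrow> ennreal"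
  assumes "prob_space M" and [measurable]: "X \<in> borel_measurable M" "f \<in> borel_measurable borel"
  shows "(\<integral>\<^sup>+\<omega>. (\<integral>\<^sup>+y. f y * indicator {0<..<X \<omega>} y \<partial>lborel) \<partial>M) =
    (\<integral>\<^sup>+y. f y * indicator {0<..} y * emeasure M {\<omega> \<in> space M. y < X \<omega>} \<partial>lborel)"
proof -
  interpret prob_space M by fact
  interpret pair_sigma_finite lborel M ..
  have "(\<integral>\<^sup>+\<omega>. (\<integral>\<^sup>+y. f y * indicator {0<..<X \<omega>} y \<partial>lborel) \<partial>M) =
      (\<integral>\<^sup>+\<omega>. (\<integral>\<^sup>+y. f y * indicator {0<..} y * (if y < X \<omega> then 1 else 0) \<partial>lborel) \<partial>M)"
    by (intro nn_integral_cong) (auto split: split_indicator)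
  also have "\<dots> = (\<integral>\<^sup>+y. (\<integral>\<^sup>+\<omega>. f y * indicator {0<..} y * (if y < X \<omega> then 1 else 0) \<partial>M) \<partial>lborel)"
    by (rule Fubini') measurable
  also have "\<dots> = (\<integral>\<^sup>+y. f y * indicator {0<..} y * emeasure M {\<omega> \<in> space M. y < X \<omega>} \<partial>lborel)"
  proof (intro nn_integral_cong)
    fix y :: real
    have "(\<integral>\<^sup>+\<omega>. f y * indicator {0<..} y * (if y < X \<omega> then 1 else 0) \<partial>M) =
        f y * indicator {0<..} y * (\<integral>\<^sup>+\<omega>. (if y < X \<omega> then 1 else 0) \<partial>M)"
      by (rule nn_integral_cmult) measurable
    also have "(\<integral>\<^sup>+\<omega>. (if y < X \<omega> then 1 else 0) \<partial>M) = (\<integral>\<^sup>+\<omega>. indicator {\<omega> \<in> space M. y < X \<omega>} \<omega> \<partial>M)"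
      by (intro nn_integral_cong) (auto split: split_indicator)
    also have "\<dots> = emeasure M {\<omega> \<in> space M. y < X \<omega>}" by simp
    finally show "(\<integral>\<^sup>+\<omega>. f y * indicator {0<..} y * (if y < X \<omega> then 1 else 0) \<partial>M) =
      f y * indicator {0<..} y * emeasure M {\<omega> \<in> space M. y < X \<omega>}" .
  qed
  finally show ?thesis .
qed

lemma nn_integral_exponential_Ioo:
  fixes r x :: real
  assumes "0 < r" "0 \<le> x"
  shows "(\<integral>\<^sup>+y. ennreal (r * exp (- r * y)) * indicator {0<..<x} y \<partial>lborel) = ennreal (1 - exp (- r * x))"
proof -
  have "(\<integral>\<^sup>+y. ennreal (r * exp (- r * y)) * indicator {0<..<x} y \<partial>lborel) =
      (\<integral>\<^sup>+y. ennreal (r * exp (- r * y)) * indicator {0..x} y \<partial>lborel)"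
  proof (rule nn_integral_cong_AE)
    show "AE y in lborel. ennreal (r * exp (- r * y)) * indicator {0<..<x} y =
        ennreal (r * exp (- r * y)) * indicator {0..x} y"
      using AE_lborel_singleton[of 0] AE_lborel_singleton[of x]
      by eventually_elim (auto split: split_indicator)
  qed
  also have "\<dots> = ennreal ((- exp (- r * x)) - (- exp (- r * 0)))"
    by (rule nn_integral_FTC_Icc) (use assms in \<open>auto intro!: derivative_eq_intros\<close>)
  finally show ?thesis by simp
qed

text \<open>Layer cake applied to \<open>\<xi> / t\<close>, using that
  \<open>1 - exp (- r * x)\<close> is the integral of \<open>r * exp (- r * y)\<close> over
  \<open>0 < y < x\<close>. The rescaling leaves the tail at \<open>t * y\<close>, ready to be
  divided by the tail at \<open>t\<close>.\<close>

lemma laplace_transform_tail: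
  assumes M: "prob_space M" and [measurable]: "\<xi> \<in> borel_measurable M" and nonneg: "AE \<omega> in M. 0 \<le> \<xi> \<omega>"
    and r: "0 < r" and t: "0 < t"
  defines "f \<equiv> \<lambda>y. indicator {0<..} y * (r * exp (- r * y)) * measure M {\<omega> \<in> space M. t * y < \<xi> \<omega>}"
  shows "integrable lborel f" and "(LINT y|lborel. f y) = 1 - (LINT \<omega>|M. exp (- (r / t) * \<xi> \<omega>))"
proof -
  interpret prob_space M by fact
  have f0: "0 \<le> f y" for y using r by (simp add: f_def)
  have [measurable]: "f \<in> borel_measurable borel"
  proof -
    have "mono (\<lambda>y. - measure M {\<omega> \<in> space M. t * y < \<xi> \<omega>})"
    proof (rule monoI)
      fix x y :: real assume "x \<le> y"
      then have "t * x \<le> t * y" using t by simp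
      then show "- measure M {\<omega> \<in> space M. t * x < \<xi> \<omega>} \<le> - measure M {\<omega> \<in> space M. t * y < \<xi> \<omega>}"
        by (auto intro!: finite_measure_mono)
    qed
    from borel_measurable_mono[OF this]
    have [measurable]: "(\<lambda>y. measure M {\<omega> \<in> space M. t * y < \<xi> \<omega>}) \<in> borel_measurable borel" by simp
    show ?thesis unfolding f_def by measurable
  qed
  have le1: "exp (- (r / t) * \<xi> \<omega>) \<le> 1" if "0 \<le> \<xi> \<omega>" for \<omega>
    using that r t by simp
  have int_exp: "integrable M (\<lambda>\<omega>. exp (- (r / t) * \<xi> \<omega>))"
  proof (rule integrable_const_bound)
    show "AE \<omega> in M. norm (exp (- (r / t) * \<xi> \<omega>)) \<le> 1"
      using nonneg by eventually_elim (use le1 in simp)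
  qed measurable
  have "(\<integral>\<^sup>+y. ennreal (f y) \<partial>lborel) =
      (\<integral>\<^sup>+y. ennreal (r * exp (- r * y)) * indicator {0<..} y * emeasure M {\<omega> \<in> space M. y < \<xi> \<omega> / t} \<partial>lborel)"
    using t r by (intro nn_integral_cong)
      (simp add: f_def emeasure_eq_measure ennreal_mult field_simps split: split_indicator)
  also have "\<dots> = (\<integral>\<^sup>+\<omega>. (\<integral>\<^sup>+y. ennreal (r * exp (- r * y)) * indicator {0<..<\<xi> \<omega> / t} y \<partial>lborel) \<partial>M)"
    by (rule layer_cake[OF M, symmetric]) measurable
  also have "\<dots> = (\<integral>\<^sup>+\<omega>. ennreal (1 - exp (- (r / t) * \<xi> \<omega>)) \<partial>M)"
  proof (rule nn_integral_cong_AE)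
    show "AE \<omega> in M. (\<integral>\<^sup>+y. ennreal (r * exp (- r * y)) * indicator {0<..<\<xi> \<omega> / t} y \<partial>lborel) =
        ennreal (1 - exp (- (r / t) * \<xi> \<omega>))"
      using nonneg
    proof eventually_elim
      case (elim \<omega>)
      then have "0 \<le> \<xi> \<omega> / t" using t by simp
      from nn_integral_exponential_Ioo[OF r this] show ?case by simp
    qed
  qed
  also have "\<dots> = ennreal (LINT \<omega>|M. 1 - exp (- (r / t) * \<xi> \<omega>))"
  proof (rule nn_integral_eq_integral)
    show "AE \<omega> in M. 0 \<le> 1 - exp (- (r / t) * \<xi> \<omega>)"
      using nonneg by eventually_elim (use le1 in simp)
  qed (use int_exp in simp)
  finally have eq: "(\<integral>\<^sup>+y. ennreal (f y) \<partial>lborel) = ennreal (LINT \<omega>|M. 1 - exp (- (r / t) * \<xi> \<omega>))" .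
  show int: "integrable lborel f"
    by (rule integrableI_nonneg) (auto simp: f0 eq)
  have "0 \<le> (LINT \<omega>|M. 1 - exp (- (r / t) * \<xi> \<omega>))"
    by (rule integral_nonneg_AE) (use nonneg in eventually_elim, use le1 in simp)
  then have "(LINT y|lborel. f y) = (LINT \<omega>|M. 1 - exp (- (r / t) * \<xi> \<omega>))"
    using eq f0 by (subst integral_eq_nn_integral) auto
  also have "\<dots> = 1 - (LINT \<omega>|M. exp (- (r / t) * \<xi> \<omega>))"
    using int_exp by (simp add: prob_space)
  finally show "(LINT y|lborel. f y) = 1 - (LINT \<omega>|M. exp (- (r / t) * \<xi> \<omega>))" .
qed

lemma Gamma_integral_scaled:
  fixes a r :: real
  assumes a: "0 < a" and r: "0 < r"
  defines "f \<equiv> \<lambda>y. indicator {0<..} y * (y powr (a - 1) * exp (- r * y))"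
  shows "integrable lborel f" and "(LINT y|lborel. f y) = Gamma a * r powr (- a)"
proof -
  have f0: "0 \<le> f y" for y by (simp add: f_def)
  have [measurable]: "f \<in> borel_measurable borel" unfolding f_def by measurable
  let ?g = "\<lambda>t::real. indicator {0..} t * t powr (a - 1) / exp t"
  have "Gamma a = (\<integral>\<^sup>+t. ennreal (?g t) \<partial>lborel)" by (rule Gamma_conv_nn_integral_real[OF a])
  also have "\<dots> = ennreal \<bar>r\<bar> * (\<integral>\<^sup>+t. ennreal (?g (0 + r * t)) \<partial>lborel)"
    by (rule nn_integral_real_affine) (use r in auto)
  also have "(\<integral>\<^sup>+t. ennreal (?g (0 + r * t)) \<partial>lborel) = (\<integral>\<^sup>+t. ennreal (r powr (a - 1)) * ennreal (f t) \<partial>lborel)"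
  proof (rule nn_integral_cong_AE)
    show "AE t in lborel. ennreal (?g (0 + r * t)) = ennreal (r powr (a - 1)) * ennreal (f t)"
      using AE_lborel_singleton[of 0]
    proof eventually_elim
      case (elim t)
      then show ?case using r
        by (auto simp: f_def ennreal_mult[symmetric] powr_mult exp_minus zero_le_mult_iff field_simps
            split: split_indicator)
    qed
  qed
  also have "\<dots> = ennreal (r powr (a - 1)) * (\<integral>\<^sup>+t. ennreal (f t) \<partial>lborel)"
    by (rule nn_integral_cmult) measurable
  finally have "ennreal (Gamma a) = ennreal (r powr a) * (\<integral>\<^sup>+t. ennreal (f t) \<partial>lborel)"
    using r by (simp add: mult.assoc[symmetric] ennreal_mult[symmetric] powr_diff)
  then have "ennreal (r powr (- a)) * ennreal (Gamma a) =
      ennreal (r powr (- a) * r powr a) * (\<integral>\<^sup>+t. ennreal (f t) \<partial>lborel)"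
    by (simp add: ennreal_mult mult.assoc)
  then have eq: "(\<integral>\<^sup>+t. ennreal (f t) \<partial>lborel) = ennreal (Gamma a * r powr (- a))"
    using r a by (simp add: powr_add[symmetric] ennreal_mult[symmetric] mult.commute less_imp_le[OF Gamma_real_pos])
  show "integrable lborel f"
    by (rule integrableI_nonneg) (auto simp: f0 eq)
  show "(LINT y|lborel. f y) = Gamma a * r powr (- a)"
    using eq f0 a by (subst integral_eq_nn_integral) (auto simp: less_imp_le[OF Gamma_real_pos])
qed

lemma regularly_varying_ratio:
  fixes G l :: "real \<Rightarrow> real"
  assumes l: "slowly_varying l" and G: "G \<sim>[at_top] (\<lambda>t. t powr (- \<alpha>) * l t)" and c: "0 < c"
  shows "((\<lambda>t. G (c * t) / G t) \<longlongrightarrow> c powr (- \<alpha>)) at_top"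
proof -
  let ?g = "\<lambda>t. t powr (- \<alpha>) * l t"
  have "filterlim (\<lambda>t. c * t) at_top at_top"
    using c by (simp add: filterlim_tendsto_pos_mult_at_top[OF tendsto_const] filterlim_ident)
  from asymp_equiv_compose'[OF G this]
  have "(\<lambda>t. G (c * t) / G t) \<sim>[at_top] (\<lambda>t. ?g (c * t) / ?g t)"
    by (intro asymp_equiv_divide G)
  then have equiv: "(\<lambda>t. ?g (c * t) / ?g t) \<sim>[at_top] (\<lambda>t. G (c * t) / G t)"
    by (rule asymp_equiv_symI)
  have "((\<lambda>t. c powr (- \<alpha>) * (l (c * t) / l t)) \<longlongrightarrow> c powr (- \<alpha>) * 1) at_top"
    using l c by (intro tendsto_intros) (auto simp: slowly_varying_def)
  moreover have "\<forall>\<^sub>F t in at_top. c powr (- \<alpha>) * (l (c * t) / l t) = ?g (c * t) / ?g t"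
    using eventually_gt_at_top[of 0] by eventually_elim (use c in \<open>simp add: powr_mult\<close>)
  ultimately have "((\<lambda>t. ?g (c * t) / ?g t) \<longlongrightarrow> c powr (- \<alpha>)) at_top"
    by (simp add: tendsto_cong)
  with equiv show ?thesis by (rule asymp_equiv_tendsto_transfer)
qed

text \<open>Asymptotic equivalence tolerates common zeros of the two sides, so that \<open>G\<close>
  does not vanish has to be drawn from the positivity of \<open>l\<close>.\<close>

lemma regularly_varying_nonzero:
  fixes G l :: "real \<Rightarrow> real"
  assumes l: "slowly_varying l" and G: "G \<sim>[at_top] (\<lambda>t. t powr (- \<alpha>) * l t)"
  shows "\<forall>\<^sub>F t in at_top. G t \<noteq> 0"
proof -
  obtain X where X: "0 < X" "\<And>x. X \<le> x \<Longrightarrow> 0 < l x" using l by (auto simp: slowly_varying_def)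
  show ?thesis
    using asymp_equiv_eventually_zeros[OF G] eventually_ge_at_top[of X]
  proof eventually_elim
    case (elim t)
    then show ?case using X(1) X(2)[of t] by simp
  qed
qed

text \<open>For monotone functions the Potter bound only needs the ratio at the single scale \<open>1/2\<close>.\<close>

lemma Potter_bound:
  fixes G :: "real \<Rightarrow> real"
  assumes G: "antimono G" "\<And>t. 0 < G t" "\<And>t. G t \<le> 1"
    and half: "((\<lambda>t. G (t / 2) / G t) \<longlongrightarrow> 2 powr \<alpha>) at_top" and \<delta>: "\<alpha> < \<delta>" "0 < \<delta>"
  shows "\<exists>X>0. \<exists>C>0. \<forall>t\<ge>X. \<forall>y>0. G (t * y) \<le> (C * y powr (- \<delta>) + 1) * G t"
proof -
  have "(2::real) powr \<alpha> < 2 powr \<delta>" using \<delta> by simp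
  from order_tendstoD(2)[OF half this]
  obtain X0 where X0: "\<And>t. X0 \<le> t \<Longrightarrow> G (t / 2) / G t < 2 powr \<delta>"
    by (auto simp: eventually_at_top_linorder)
  define X where "X = max 1 X0"
  have X: "0 < X" "\<And>t. X \<le> t \<Longrightarrow> G (t / 2) \<le> 2 powr \<delta> * G t"
    using X0 G(2) by (auto simp: X_def divide_less_eq intro: less_imp_le)
  \<comment> \<open>Halving is controlled only from \<open>X\<close> on, so the argument is clipped
    at \<open>X\<close>; the factor \<open>1 / G X\<close> in \<open>C\<close> pays for the
    clipping.\<close>
  have iter: "G (max X (t / 2 ^ k)) \<le> 2 powr (\<delta> * real k) * G t" if t: "X \<le> t" for t k
  proof (induction k)
    case (Suc k)
    let ?m = "max X (t / 2 ^ k)"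
    have "max X a / 2 \<le> max X (a / 2)" for a using X(1) by (auto simp: max_def)
    from this[of "t / 2 ^ k"] have "G (max X (t / 2 ^ Suc k)) \<le> G (?m / 2)"
      by (intro antimonoD[OF G(1)]) (simp add: mult.commute)
    also have "\<dots> \<le> 2 powr \<delta> * G ?m" by (intro X(2)) simp
    also have "\<dots> \<le> 2 powr \<delta> * (2 powr (\<delta> * real k) * G t)" by (intro mult_left_mono Suc) simp
    finally show ?case by (simp add: powr_add algebra_simps)
  qed (use t in simp)
  define C where "C = 2 powr \<delta> / G X"
  have C: "0 < C" using G(2)[of X] by (simp add: C_def)
  have "G (t * y) \<le> (C * y powr (- \<delta>) + 1) * G t" if t: "X \<le> t" and y: "0 < y" for t y
  proof (cases "y \<le> 1")
    case False
    then have "t * 1 \<le> t * y" using t X(1) by (intro mult_left_mono) auto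
    then have "G (t * y) \<le> 1 * G t" using antimonoD[OF G(1)] by simp
    also have "\<dots> \<le> (C * y powr (- \<delta>) + 1) * G t"
      using C G(2)[of t] by (intro mult_right_mono) auto
    finally show ?thesis .
  next
    case True
    \<comment> \<open>The number of halvings that takes \<open>t\<close> to \<open>t * y\<close> or
      below. Rounding up adds at most one halving, whence the factor \<open>2 powr \<delta>\<close>
      in \<open>C\<close>.\<close>
    define k where "k = nat \<lceil>- log 2 y\<rceil>"
    have "0 \<le> - log 2 y" using True y by simp
    then have k: "- log 2 y \<le> real k" "real k \<le> - log 2 y + 1" unfolding k_def by linarith+
    have "2 powr (- real k) \<le> 2 powr (log 2 y)" using k(1) by simp
    then have ky: "1 / 2 ^ k \<le> y" using y by (simp add: powr_minus powr_realpow field_simps)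
    have "t * (1 / 2 ^ k) \<le> t * y" using t X(1) by (intro mult_left_mono ky) auto
    then have tk: "t / 2 ^ k \<le> t * y" by simp
    have "2 powr (\<delta> * real k) \<le> 2 powr (\<delta> * (- log 2 y + 1))" using k(2) \<delta> by simp
    also have "\<dots> = 2 powr \<delta> * (2 powr (log 2 y)) powr (- \<delta>)"
      by (subst powr_powr) (simp add: powr_add[symmetric] algebra_simps)
    also have "\<dots> = 2 powr \<delta> * y powr (- \<delta>)" using y by simp
    finally have pk: "2 powr (\<delta> * real k) \<le> 2 powr \<delta> * y powr (- \<delta>)" .
    have "G (t * y) \<le> G (max X (t / 2 ^ k)) / G X"
    proof (cases "X \<le> t / 2 ^ k")
      case True
      have "G (t * y) \<le> G (t / 2 ^ k)" using tk antimonoD[OF G(1)] by simp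
      also have "\<dots> \<le> G (t / 2 ^ k) / G X" using G(2)[of X] G(2)[of "t / 2 ^ k"] G(3)[of X]
        by (simp add: le_divide_eq mult_left_le)
      finally show ?thesis using True by (simp add: max_def)
    next
      case False
      then show ?thesis using G(2)[of X] G(3)[of "t * y"] by (simp add: max_def)
    qed
    also have "\<dots> \<le> 2 powr (\<delta> * real k) * G t / G X"
      using iter[OF t, of k] G(2)[of X] by (intro divide_right_mono) auto
    also have "\<dots> \<le> (2 powr \<delta> * y powr (- \<delta>)) * G t / G X"
      using pk G(2)[of X] G(2)[of t] by (intro divide_right_mono mult_right_mono) auto
    also have "\<dots> = C * y powr (- \<delta>) * G t" by (simp add: C_def)
    also have "\<dots> \<le> (C * y powr (- \<delta>) + 1) * G t" using G(2)[of t] by (simp add: algebra_simps)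
    finally show ?thesis .
  qed
  with X(1) C show ?thesis by blast
qed

text \<open>By \<open>laplace_transform_tail\<close> the quotient is the integral of
  \<open>r * exp (- r * y) * (G (t * y) / G t)\<close> over \<open>0 < y\<close>. The ratio tends to
  \<open>y powr (- \<alpha>)\<close>, the Potter bound dominates, and the limit is a Gamma
  integral.\<close>

lemma laplace_transform_asymptotics:
  fixes \<xi> :: "'a \<Rightarrow> real"
  assumes M: "prob_space M" and \<xi>[measurable]: "\<xi> \<in> borel_measurable M" and nonneg: "AE \<omega> in M. 0 \<le> \<xi> \<omega>"
    and \<alpha>: "0 \<le> \<alpha>" "\<alpha> < 1" and r: "0 < r"
    and pos: "\<And>t. 0 < measure M {\<omega> \<in> space M. t < \<xi> \<omega>}"
    and ratio: "\<And>c. 0 < c \<Longrightarrow> ((\<lambda>t. measure M {\<omega> \<in> space M. c * t < \<xi> \<omega>} / measure M {\<omega> \<in> space M. t < \<xi> \<omega>})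
        \<longlongrightarrow> c powr (- \<alpha>)) at_top"
  shows "((\<lambda>t. (1 - (LINT \<omega>|M. exp (- (r / t) * \<xi> \<omega>))) / measure M {\<omega> \<in> space M. t < \<xi> \<omega>})
    \<longlongrightarrow> Gamma (1 - \<alpha>) * r powr \<alpha>) at_top"
proof -
  interpret prob_space M by fact
  define G where "G t = measure M {\<omega> \<in> space M. t < \<xi> \<omega>}" for t
  have G0: "0 < G t" for t using pos by (simp add: G_def)
  have Gmono: "antimono G" by (intro antimonoI) (auto simp: G_def intro!: finite_measure_mono)
  have G1: "G t \<le> 1" for t by (simp add: G_def)
  \<comment> \<open>The midpoint of \<open>\<alpha>\<close> and 1: above \<open>\<alpha>\<close> for
    the Potter bound, below 1 so that \<open>y powr (- \<delta>)\<close> is integrable at 0.\<close>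
  define \<delta> where "\<delta> = (\<alpha> + 1) / 2"
  have \<delta>: "\<alpha> < \<delta>" "0 < \<delta>" "\<delta> < 1" using \<alpha> by (auto simp: \<delta>_def)
  have half: "((\<lambda>t. G (t / 2) / G t) \<longlongrightarrow> 2 powr \<alpha>) at_top"
    using ratio[of "1/2"] by (simp add: G_def powr_divide powr_minus_divide)
  obtain C X where X: "0 < X" and C: "0 < C"
    and bound: "\<forall>t\<ge>X. \<forall>y>0. G (t * y) \<le> (C * y powr (- \<delta>) + 1) * G t"
    using Potter_bound[OF Gmono G0 G1 half \<delta>(1,2)] by auto
  let ?s = "\<lambda>t y. indicator {0<..} y * (r * exp (- r * y)) * (G (t * y) / G t)"
  let ?f = "\<lambda>y. indicator {0<..} y * (r * exp (- r * y)) * y powr (- \<alpha>)"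
  let ?w = "\<lambda>y. indicator {0<..} y * (r * exp (- r * y)) * (C * y powr (- \<delta>) + 1)"
  have s_eq: "(LINT y|lborel. ?s t y) = (1 - (LINT \<omega>|M. exp (- (r / t) * \<xi> \<omega>))) / G t" if "0 < t" for t
  proof -
    have "(LINT y|lborel. ?s t y) = (LINT y|lborel. indicator {0<..} y * (r * exp (- r * y)) * G (t * y)) / G t"
      by simp
    also have "\<dots> = (1 - (LINT \<omega>|M. exp (- (r / t) * \<xi> \<omega>))) / G t"
      unfolding G_def using laplace_transform_tail(2)[OF M \<xi> nonneg r that] by simp
    finally show ?thesis .
  qed
  have [measurable]: "G \<in> borel_measurable borel"
    using borel_measurable_mono[of "\<lambda>t. - G t"] Gmono by (simp add: mono_def antimono_def)
  have "((\<lambda>t. LINT y|lborel. ?s t y) \<longlongrightarrow> (LINT y|lborel. ?f y)) at_top"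
  proof (rule integral_dominated_convergence_at_top[where w = ?w])
    \<comment> \<open>The factor \<open>y powr (1 - 1)\<close> equals 1 for \<open>0 < y\<close>; it
      gives the second summand the shape of \<open>Gamma_integral_scaled\<close>.\<close>
    have *: "?w = (\<lambda>y. r * C * (indicator {0<..} y * (y powr ((1 - \<delta>) - 1) * exp (- r * y))) +
        r * (indicator {0<..} y * (y powr (1 - 1) * exp (- r * y))))"
      by (auto simp: fun_eq_iff algebra_simps split: split_indicator)
    show "integrable lborel ?w"
      unfolding * using \<delta> r
      by (intro Bochner_Integration.integrable_add integrable_mult_right Gamma_integral_scaled(1)) auto
    show "\<forall>\<^sub>F t in at_top. AE y in lborel. norm (?s t y) \<le> ?w y"
      using eventually_ge_at_top[of X]
    proof eventually_elim
      case (elim t)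
      have "norm (?s t y) \<le> ?w y" for y
      proof (cases "0 < y")
        case True
        then have "G (t * y) / G t \<le> C * y powr (- \<delta>) + 1"
          using bound elim True G0[of t] by (simp add: divide_le_eq)
        then have "?s t y \<le> ?w y" using r by (intro mult_left_mono) auto
        moreover have "0 \<le> ?s t y"
          using r G0[of t] G0[of "t * y"] by (intro mult_nonneg_nonneg divide_nonneg_nonneg) auto
        ultimately show ?thesis by simp
      qed simp
      then show ?case by simp
    qed
    show "AE y in lborel. ((\<lambda>t. ?s t y) \<longlongrightarrow> ?f y) at_top"
    proof (rule AE_I2)
      fix y :: real
      show "((\<lambda>t. ?s t y) \<longlongrightarrow> ?f y) at_top"
      proof (cases "0 < y")
        case True
        have "((\<lambda>t. G (t * y) / G t) \<longlongrightarrow> y powr (- \<alpha>)) at_top"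
          using ratio[OF True] by (simp add: G_def mult.commute)
        then show ?thesis by (intro tendsto_mult tendsto_const)
      qed simp
    qed
  qed measurable
  also have "(LINT y|lborel. ?f y) = r * (LINT y|lborel. indicator {0<..} y * (y powr ((1 - \<alpha>) - 1) * exp (- r * y)))"
    unfolding integral_mult_right_zero[symmetric]
    by (intro Bochner_Integration.integral_cong) auto
  also have "\<dots> = r * (Gamma (1 - \<alpha>) * r powr (- (1 - \<alpha>)))"
    by (subst Gamma_integral_scaled(2)) (use \<alpha> r in auto)
  also have "\<dots> = Gamma (1 - \<alpha>) * r powr \<alpha>"
    using r by (simp add: powr_diff powr_minus_divide)
  finally have lim: "((\<lambda>t. LINT y|lborel. ?s t y) \<longlongrightarrow> Gamma (1 - \<alpha>) * r powr \<alpha>) at_top" .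
  have "\<forall>\<^sub>F t in at_top. (LINT y|lborel. ?s t y) = (1 - (LINT \<omega>|M. exp (- (r / t) * \<xi> \<omega>))) / G t"
    using eventually_gt_at_top[of 0] by eventually_elim (rule s_eq)
  from tendsto_cong[OF this] lim show ?thesis by (simp add: G_def)
qed

text \<open>The power lies between \<open>exp (- n * x / (1 - x))\<close> and
  \<open>exp (- n * x)\<close>, and \<open>1 - x\<close> tends to 1.\<close>

lemma one_minus_power_tendsto_exp:
  fixes x :: "'i \<Rightarrow> real" and n :: "'i \<Rightarrow> nat"
  assumes x: "(x \<longlongrightarrow> 0) F" "\<forall>\<^sub>F i in F. 0 \<le> x i" and n: "((\<lambda>i. real (n i) * x i) \<longlongrightarrow> c) F"
  shows "((\<lambda>i. (1 - x i) ^ n i) \<longlongrightarrow> exp (- c)) F"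
proof (rule tendsto_sandwich)
  have x1: "\<forall>\<^sub>F i in F. x i < 1" using order_tendstoD(2)[OF x(1)] by simp
  have "((\<lambda>i. exp (- (real (n i) * x i / (1 - x i)))) \<longlongrightarrow> exp (- (c / (1 - 0)))) F"
    by (intro tendsto_intros n x) simp
  then show "((\<lambda>i. exp (- (real (n i) * x i / (1 - x i)))) \<longlongrightarrow> exp (- c)) F" by simp
  show "((\<lambda>i. exp (- (real (n i) * x i))) \<longlongrightarrow> exp (- c)) F" by (intro tendsto_intros n)
  show "\<forall>\<^sub>F i in F. exp (- (real (n i) * x i / (1 - x i))) \<le> (1 - x i) ^ n i"
    using x1
  proof eventually_elim
    case (elim i)
    have "1 + x i / (1 - x i) \<le> exp (x i / (1 - x i))" by (rule exp_ge_add_one_self)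
    then have "1 / (1 - x i) \<le> exp (x i / (1 - x i))" using elim by (simp add: field_simps)
    then have "exp (- (x i / (1 - x i))) \<le> 1 - x i"
      using elim by (simp add: exp_minus field_simps)
    then have "exp (- (x i / (1 - x i))) ^ n i \<le> (1 - x i) ^ n i" by (rule power_mono) simp
    then show ?case by (simp add: exp_of_nat_mult[symmetric])
  qed
  show "\<forall>\<^sub>F i in F. (1 - x i) ^ n i \<le> exp (- (real (n i) * x i))"
    using x1
  proof eventually_elim
    case (elim i)
    have "1 - x i \<le> exp (- x i)" using exp_ge_add_one_self[of "- x i"] by simp
    then have "(1 - x i) ^ n i \<le> exp (- x i) ^ n i" using elim by (intro power_mono) auto
    then show ?case by (simp add: exp_of_nat_mult[symmetric])
  qed
qed

subsection \<open>Random walks with regularly varying steps\<close>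

lemma prob_eq_of_distr_eq:
  assumes "distr M borel X = distr M' borel Y" "X \<in> borel_measurable M" "Y \<in> borel_measurable M'"
    and "{x. P x} \<in> sets (borel :: real measure)"
  shows "measure M {\<omega> \<in> space M. P (X \<omega>)} = measure M' {\<omega> \<in> space M'. P (Y \<omega>)}"
proof -
  have "X -` {x. P x} \<inter> space M = {\<omega> \<in> space M. P (X \<omega>)}"
    "Y -` {x. P x} \<inter> space M' = {\<omega> \<in> space M'. P (Y \<omega>)}" by auto
  moreover have "measure M (X -` {x. P x} \<inter> space M) = measure M' (Y -` {x. P x} \<inter> space M')"
    by (simp only: measure_distr[OF assms(2,4), symmetric] measure_distr[OF assms(3,4), symmetric] assms(1))
  ultimately show ?thesis by simp
qed

text \<open>Regular variation is present only through the ratio limits of the tail, so the slowly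
  varying function itself no longer appears.\<close>

locale regularly_varying_walk =
  fixes M :: "'a measure" and \<xi> :: "'a \<Rightarrow> real" and X :: "nat \<Rightarrow> 'a \<Rightarrow> real" and \<alpha> :: real
  assumes prob_space_M: "prob_space M"
    and meas_\<xi> [measurable]: "\<xi> \<in> borel_measurable M" and \<xi>_nonneg: "AE \<omega> in M. 0 \<le> \<xi> \<omega>"
    and indep_X: "prob_space.indep_vars M (\<lambda>_. borel) X {1..}"
    and distr_X: "\<And>i. 1 \<le> i \<Longrightarrow> distr M borel (X i) = distr M borel \<xi>"
    and \<alpha>: "0 \<le> \<alpha>" "\<alpha> < 1"
    and tail_pos: "\<And>t. 0 < measure M {\<omega> \<in> space M. t < \<xi> \<omega>}"
    and tail_ratio: "\<And>c. 0 < c \<Longrightarrow>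
      ((\<lambda>t. measure M {\<omega> \<in> space M. c * t < \<xi> \<omega>} / measure M {\<omega> \<in> space M. t < \<xi> \<omega>})
        \<longlongrightarrow> c powr (- \<alpha>)) at_top"
begin

sublocale prob_space M by (rule prob_space_M)

definition G :: "real \<Rightarrow> real" where "G t = prob {\<omega> \<in> space M. t < \<xi> \<omega>}"

text \<open>The index is shifted: \<open>p n\<close> belongs to the sum of \<open>n + 1\<close>
  steps, so that a series over all naturals is a sum over \<open>n \<ge> 1\<close> of the
  walk.\<close>

definition p :: "nat \<Rightarrow> real \<Rightarrow> real" where "p n t = prob {\<omega> \<in> space M. (\<Sum>i=1..Suc n. X i \<omega>) \<le> t}"

definition \<phi> :: "real \<Rightarrow> real" where "\<phi> z = expectation (\<lambda>\<omega>. exp (- z * \<xi> \<omega>))"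

lemma G_pos: "0 < G t" unfolding G_def by (rule tail_pos)

lemma meas_X: "1 \<le> i \<Longrightarrow> X i \<in> borel_measurable M"
  using indep_X by (auto simp: indep_vars_def)

lemma meas_sum_X [measurable]: "(\<lambda>\<omega>. \<Sum>i=1..n. X i \<omega>) \<in> borel_measurable M"
  by (intro borel_measurable_sum meas_X) auto

lemma X_nonneg: assumes "1 \<le> i" shows "AE \<omega> in M. 0 \<le> X i \<omega>"
proof -
  have "AE x in distr M borel \<xi>. 0 \<le> x" using \<xi>_nonneg by (subst AE_distr_iff) auto
  then have "AE x in distr M borel (X i). 0 \<le> x" unfolding distr_X[OF assms] .
  then show ?thesis using meas_X[OF assms] by (subst (asm) AE_distr_iff) auto
qed

lemma sum_X_nonneg: "AE \<omega> in M. 0 \<le> (\<Sum>i=1..n. X i \<omega>)"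
proof -
  have "AE \<omega> in M. \<forall>i\<in>{1..n}. 0 \<le> X i \<omega>" by (rule AE_finite_allI) (auto intro: X_nonneg)
  then show ?thesis by eventually_elim (auto intro: sum_nonneg)
qed

lemma integrable_exp:
  fixes Y :: "'a \<Rightarrow> real"
  assumes "Y \<in> borel_measurable M" "AE \<omega> in M. 0 \<le> Y \<omega>" "0 \<le> z"
  shows "integrable M (\<lambda>\<omega>. exp (- z * Y \<omega>))"
proof (rule integrable_const_bound)
  show "AE \<omega> in M. norm (exp (- z * Y \<omega>)) \<le> 1" using assms(2) by eventually_elim (use assms(3) in simp)
  show "(\<lambda>\<omega>. exp (- z * Y \<omega>)) \<in> borel_measurable M" using assms(1) by measurable
qed

lemma laplace_sum_X:
  assumes "0 \<le> z" shows "(LINT \<omega>|M. exp (- z * (\<Sum>i=1..n. X i \<omega>))) = \<phi> z ^ n"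
proof -
  have each: "(LINT \<omega>|M. exp (- z * X i \<omega>)) = \<phi> z" if "1 \<le> i" for i
  proof -
    have "(LINT \<omega>|M. exp (- z * X i \<omega>)) = (LINT x|distr M borel (X i). exp (- z * x))"
      using meas_X[OF that] by (subst integral_distr) auto
    also have "\<dots> = \<phi> z" unfolding distr_X[OF that] \<phi>_def by (subst integral_distr) auto
    finally show ?thesis .
  qed
  have "indep_vars (\<lambda>_. borel) X {1..n}"
    by (rule indep_vars_subset[OF indep_X]) auto
  then have indep: "indep_vars (\<lambda>_. borel) (\<lambda>i \<omega>. exp (- z * X i \<omega>)) {1..n}"
    by (rule indep_vars_compose2) auto
  have "(LINT \<omega>|M. exp (- z * (\<Sum>i=1..n. X i \<omega>))) = (LINT \<omega>|M. (\<Prod>i=1..n. exp (- z * X i \<omega>)))"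
    by (simp add: exp_sum sum_distrib_left)
  also have "\<dots> = (\<Prod>i=1..n. LINT \<omega>|M. exp (- z * X i \<omega>))"
    by (rule indep_vars_lebesgue_integral[OF _ indep])
       (use integrable_exp[OF meas_X X_nonneg assms] in auto)
  also have "\<dots> = (\<Prod>i=1..n. \<phi> z)" by (intro prod.cong refl each) auto
  finally show ?thesis by simp
qed

lemma G_tendsto_0: "(G \<longlongrightarrow> 0) at_top"
proof -
  interpret D: real_distribution "distr M borel \<xi>" by (intro real_distribution_distr) simp
  have "G = (\<lambda>t. 1 - cdf (distr M borel \<xi>) t)"
  proof
    fix t
    have "cdf (distr M borel \<xi>) t = prob {\<omega> \<in> space M. \<xi> \<omega> \<le> t}"
      by (simp add: cdf_def measure_distr vimage_def Int_def conj_commute)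
    also have "\<dots> = 1 - prob (space M - {\<omega> \<in> space M. \<xi> \<omega> \<le> t})"
      by (subst prob_compl) auto
    also have "space M - {\<omega> \<in> space M. \<xi> \<omega> \<le> t} = {\<omega> \<in> space M. t < \<xi> \<omega>}" by auto
    finally show "G t = 1 - cdf (distr M borel \<xi>) t" by (simp add: G_def)
  qed
  moreover have "((\<lambda>t. 1 - cdf (distr M borel \<xi>) t) \<longlongrightarrow> 1 - 1) at_top"
    by (intro tendsto_intros D.cdf_lim_at_top_prob)
  ultimately show ?thesis by simp
qed

lemma \<phi>_asymp:
  assumes "0 < r" shows "((\<lambda>t. (1 - \<phi> (r / t)) / G t) \<longlongrightarrow> Gamma (1 - \<alpha>) * r powr \<alpha>) at_top"
  using laplace_transform_asymptotics[OF prob_space_M meas_\<xi> \<xi>_nonneg \<alpha> assms tail_pos tail_ratio]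
  unfolding G_def \<phi>_def by simp

lemma \<phi>_le_1: assumes "0 \<le> z" shows "\<phi> z \<le> 1"
proof -
  have "\<phi> z \<le> (LINT \<omega>|M. 1)"
    unfolding \<phi>_def
  proof (rule integral_mono_AE)
    show "AE \<omega> in M. exp (- z * \<xi> \<omega>) \<le> 1" using \<xi>_nonneg by eventually_elim (use assms in simp)
  qed (use integrable_exp[OF meas_\<xi> \<xi>_nonneg assms] in auto)
  then show ?thesis by (simp add: prob_space)
qed

lemma p_bounds: "0 \<le> p n t" "p n t \<le> 1" by (auto simp: p_def)

text \<open>Markov's inequality for \<open>exp (- S / t)\<close> gives
  \<open>exp 1 * \<phi> (1 / t) ^ Suc n\<close>. Since \<open>1 - \<phi> (1 / t)\<close> is
  asymptotically \<open>Gamma (1 - \<alpha>) * G t\<close>, half of this constant is eventually a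
  valid rate, uniformly in \<open>n\<close>.\<close>

lemma p_exponential_bound:
  obtains \<kappa> where "0 < \<kappa>" "\<forall>\<^sub>F t in at_top. \<forall>n. p n t \<le> exp 1 * exp (- \<kappa> * (real (Suc n) * G t))"
proof -
  define \<kappa> where "\<kappa> = Gamma (1 - \<alpha>) / 2"
  have \<kappa>: "0 < \<kappa>" "\<kappa> < Gamma (1 - \<alpha>) * 1 powr \<alpha>"
    using Gamma_real_pos[of "1 - \<alpha>"] \<alpha> by (auto simp: \<kappa>_def)
  have "\<forall>\<^sub>F t in at_top. \<forall>n. p n t \<le> exp 1 * exp (- \<kappa> * (real (Suc n) * G t))"
    using order_tendstoD(1)[OF \<phi>_asymp[OF zero_less_one] \<kappa>(2)] eventually_gt_at_top[of 0]
  proof eventually_elim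
    case (elim t)
    then have kG: "\<kappa> * G t \<le> 1 - \<phi> (1 / t)" using G_pos[of t] by (simp add: less_divide_eq)
    have "p n t \<le> exp 1 * exp (- \<kappa> * (real (Suc n) * G t))" for n
    proof -
      define S where "S \<omega> = (\<Sum>i=1..Suc n. X i \<omega>)" for \<omega>
      have t: "0 \<le> 1 / t" using elim by simp
      have [measurable]: "S \<in> borel_measurable M" unfolding S_def by (rule meas_sum_X)
      have S_nonneg: "AE \<omega> in M. 0 \<le> S \<omega>" unfolding S_def by (rule sum_X_nonneg)
      have set: "{\<omega> \<in> space M. S \<omega> \<le> t} \<in> sets M" by measurable
      have "{\<omega> \<in> space M. S \<omega> \<le> t} \<inter> space M = {\<omega> \<in> space M. S \<omega> \<le> t}" by auto
      then have "p n t = (LINT \<omega>|M. indicator {\<omega> \<in> space M. S \<omega> \<le> t} \<omega>)"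
        unfolding p_def S_def by simp
      also have "\<dots> \<le> (LINT \<omega>|M. exp 1 * exp (- (1 / t) * S \<omega>))"
      proof (rule integral_mono)
        show "integrable M (indicat_real {\<omega> \<in> space M. S \<omega> \<le> t})"
          using set by (simp add: emeasure_eq_measure)
        show "integrable M (\<lambda>\<omega>. exp 1 * exp (- (1 / t) * S \<omega>))"
          by (intro integrable_mult_right integrable_exp S_nonneg t) measurable
        show "indicat_real {\<omega> \<in> space M. S \<omega> \<le> t} \<omega> \<le> exp 1 * exp (- (1 / t) * S \<omega>)" for \<omega>
        proof (cases "S \<omega> \<le> t")
          case True
          then have "0 \<le> 1 + - (1 / t) * S \<omega>" using elim by (simp add: field_simps)
          then have "1 \<le> exp (1 + - (1 / t) * S \<omega>)" by simp
          then show ?thesis by (simp only: exp_add) (auto split: split_indicator)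
        qed simp
      qed
      also have "\<dots> = exp 1 * \<phi> (1 / t) ^ Suc n"
        using laplace_sum_X[OF t, of "Suc n"] by (simp only: S_def integral_mult_right_zero)
      also have "\<phi> (1 / t) ^ Suc n \<le> exp (- (\<kappa> * G t)) ^ Suc n"
      proof (rule power_mono)
        have "\<phi> (1 / t) \<le> 1 + - (\<kappa> * G t)" using kG by simp
        also have "\<dots> \<le> exp (- (\<kappa> * G t))" by (rule exp_ge_add_one_self)
        finally show "\<phi> (1 / t) \<le> exp (- (\<kappa> * G t))" .
        show "0 \<le> \<phi> (1 / t)" unfolding \<phi>_def by (rule Bochner_Integration.integral_nonneg) simp
      qed
      also have "\<dots> = exp (- \<kappa> * (real (Suc n) * G t))"
        unfolding exp_of_nat_mult[symmetric] by (simp add: algebra_simps)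
      finally show ?thesis by simp
    qed
    then show ?case by blast
  qed
  with \<kappa>(1) show ?thesis by (rule that)
qed

text \<open>For \<open>0 < t\<close> the event that the sum is at most \<open>t\<close> says that
  its exponential \<open>?X t\<close> is at least \<open>exp (-1)\<close>, and the
  \<open>k\<close>-th moment of \<open>?X t\<close> is a power of
  \<open>\<phi> (real k / t)\<close>. These moments converge to those of \<open>Y\<close>.\<close>

lemma p_tendsto:
  fixes Q :: "'b measure" and Y :: "'b \<Rightarrow> real" and n :: "real \<Rightarrow> nat"
  assumes Q: "prob_space Q" and Y: "Y \<in> borel_measurable Q" "AE \<omega> in Q. Y \<omega> \<in> {0..1}"
    and mom: "\<And>k. 0 < k \<Longrightarrow> (LINT \<omega>|Q. Y \<omega> ^ k) = exp (- (v * (Gamma (1 - \<alpha>) * real k powr \<alpha>)))"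
    and atom: "measure Q {\<omega> \<in> space Q. Y \<omega> = exp (-1)} = 0"
    and n: "((\<lambda>t. real (n t) * G t) \<longlongrightarrow> v) at_top"
  shows "((\<lambda>t. p (n t) t) \<longlongrightarrow> measure Q {\<omega> \<in> space Q. exp (-1) \<le> Y \<omega>}) at_top"
proof -
  let ?X = "\<lambda>t \<omega>. exp (- (1 / t) * (\<Sum>i=1..Suc (n t). X i \<omega>))"
  \<comment> \<open>The extra step in \<open>p\<close> is harmless because \<open>G t\<close> tends
    to 0.\<close>
  have n': "((\<lambda>t. real (Suc (n t)) * G t) \<longlongrightarrow> v) at_top"
    using tendsto_add[OF n G_tendsto_0] by (simp add: algebra_simps)
  have "((\<lambda>t. measure M {\<omega> \<in> space M. exp (-1) \<le> ?X t \<omega>})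
      \<longlongrightarrow> measure Q {\<omega> \<in> space Q. exp (-1) \<le> Y \<omega>}) at_top"
  proof (rule tendsto_prob_ge_of_moments[OF prob_space_M Q _ Y _ atom])
    show "\<forall>\<^sub>F t in at_top. ?X t \<in> borel_measurable M \<and> (AE \<omega> in M. ?X t \<omega> \<in> {0..1})"
      using eventually_gt_at_top[of 0]
    proof eventually_elim
      case (elim t)
      have "AE \<omega> in M. ?X t \<omega> \<in> {0..1}"
        using sum_X_nonneg[of "Suc (n t)"] by eventually_elim (use elim in \<open>simp del: sum.cl_ivl_Suc\<close>)
      moreover have "?X t \<in> borel_measurable M" by measurable
      ultimately show ?case by blast
    qed
    fix k :: nat assume k: "0 < k"
    have lim: "((\<lambda>t. (1 - \<phi> (real k / t)) / G t) \<longlongrightarrow> Gamma (1 - \<alpha>) * real k powr \<alpha>) at_top"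
      using k by (intro \<phi>_asymp) simp
    have cancel: "(1 - \<phi> (real k / t)) / G t * G t = 1 - \<phi> (real k / t)" for t
      using G_pos[of t] by simp
    have "((\<lambda>t. (1 - (1 - \<phi> (real k / t))) ^ Suc (n t)) \<longlongrightarrow>
        exp (- (v * (Gamma (1 - \<alpha>) * real k powr \<alpha>)))) at_top"
    proof (rule one_minus_power_tendsto_exp)
      show "((\<lambda>t. 1 - \<phi> (real k / t)) \<longlongrightarrow> 0) at_top"
        using tendsto_mult[OF lim G_tendsto_0] by (simp only: cancel mult_zero_right)
      show "\<forall>\<^sub>F t in at_top. 0 \<le> 1 - \<phi> (real k / t)"
        using eventually_gt_at_top[of 0] by eventually_elim (use \<phi>_le_1 in simp)
      have "((\<lambda>t. (real (Suc (n t)) * G t) * ((1 - \<phi> (real k / t)) / G t)) \<longlongrightarrow>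
          v * (Gamma (1 - \<alpha>) * real k powr \<alpha>)) at_top"
        by (intro tendsto_mult n' lim)
      moreover have "(real (Suc (n t)) * G t) * ((1 - \<phi> (real k / t)) / G t) =
          real (Suc (n t)) * (1 - \<phi> (real k / t))" for t
        using G_pos[of t] by simp
      ultimately show "((\<lambda>t. real (Suc (n t)) * (1 - \<phi> (real k / t))) \<longlongrightarrow>
          v * (Gamma (1 - \<alpha>) * real k powr \<alpha>)) at_top"
        by simp
    qed
    moreover have ev: "\<forall>\<^sub>F t in at_top. (1 - (1 - \<phi> (real k / t))) ^ Suc (n t) = (LINT \<omega>|M. ?X t \<omega> ^ k)"
      using eventually_gt_at_top[of 0]
    proof eventually_elim
      case (elim t)
      have "?X t \<omega> ^ k = exp (- (real k / t) * (\<Sum>i=1..Suc (n t). X i \<omega>))" for \<omega>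
        by (simp only: exp_of_nat_mult[symmetric]) (simp only: mult_minus_left mult_minus_right times_divide_eq_left times_divide_eq_right mult_1 mult_1_right mult.assoc)
      then show ?case using laplace_sum_X[of "real k / t" "Suc (n t)"] elim by simp
    qed
    ultimately show "((\<lambda>t. LINT \<omega>|M. ?X t \<omega> ^ k) \<longlongrightarrow> (LINT \<omega>|Q. Y \<omega> ^ k)) at_top"
      unfolding mom[OF k] by (subst (asm) tendsto_cong[OF ev])
  qed
  moreover have ev: "\<forall>\<^sub>F t in at_top. measure M {\<omega> \<in> space M. exp (-1) \<le> ?X t \<omega>} = p (n t) t"
    using eventually_gt_at_top[of 0]
  proof eventually_elim
    case (elim t)
    then have "exp (-1) \<le> ?X t \<omega> \<longleftrightarrow> (\<Sum>i=1..Suc (n t). X i \<omega>) \<le> t" for \<omega>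
      by (simp del: sum.cl_ivl_Suc)
    then show ?case unfolding p_def by simp
  qed
  ultimately show ?thesis by (subst (asm) tendsto_cong[OF ev])
qed

end

section \<open>Scaled sums over the walk as integrals\<close>

text \<open>The series is the integral of a step function with steps of width \<open>G\<close>. This
  turns limits of scaled series into dominated convergence on a fixed measure space.\<close>

lemma lborel_integral_step:
  fixes h :: "nat \<Rightarrow> real"
  assumes G: "0 < G" and h: "summable (\<lambda>n. \<bar>h n\<bar>)"
  shows "(LINT y|lborel. indicator {0..} y * h (nat \<lfloor>y / G\<rfloor>)) = G * (\<Sum>n. h n)"
proof -
  define I where "I n = {real n * G..<real (Suc n) * G}" for n
  define f where "f n y = indicator (I n) y * h n" for n y
  have I_iff: "y \<in> I n \<longleftrightarrow> 0 \<le> y \<and> n = nat \<lfloor>y / G\<rfloor>" for y n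
  proof -
    have "y \<in> I n \<longleftrightarrow> real n \<le> y / G \<and> y / G < real n + 1"
      using G by (auto simp: I_def field_simps)
    also have "\<dots> \<longleftrightarrow> \<lfloor>y / G\<rfloor> = int n" by (auto simp: floor_eq_iff)
    also have "\<dots> \<longleftrightarrow> 0 \<le> y / G \<and> n = nat \<lfloor>y / G\<rfloor>"
      by (auto simp: zero_le_floor[symmetric] simp del: zero_le_floor)
    also have "0 \<le> y / G \<longleftrightarrow> 0 \<le> y" using G by (simp add: zero_le_divide_iff)
    finally show ?thesis .
  qed
  have f_eq: "f n y = (if n = nat \<lfloor>y / G\<rfloor> then indicator {0..} y * h n else 0)" for n y
    by (auto simp: f_def I_iff split: split_indicator)
  have meas: "emeasure lborel (I n) = ennreal G" for n
    using G by (simp add: I_def algebra_simps)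
  have int: "integrable lborel (f n)" for n
    unfolding f_def using meas by (intro integrable_mult_left) (simp add: I_def)
  have val: "(LINT y|lborel. f n y) = G * h n" for n
    unfolding f_def using meas[of n] G by (simp add: measure_def I_def)
  have nval: "(LINT y|lborel. norm (f n y)) = G * \<bar>h n\<bar>" for n
  proof -
    have "(\<lambda>y. norm (f n y)) = (\<lambda>y. indicator (I n) y * \<bar>h n\<bar>)"
      by (auto simp: f_def fun_eq_iff split: split_indicator)
    then show ?thesis using meas[of n] G by (simp add: measure_def I_def)
  qed
  have "(LINT y|lborel. (\<Sum>n. f n y)) = (\<Sum>n. LINT y|lborel. f n y)"
  proof (rule integral_suminf[OF int])
    show "AE y in lborel. summable (\<lambda>n. norm (f n y))"
    proof (rule AE_I2)
      fix y show "summable (\<lambda>n. norm (f n y))"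
        by (rule summable_finite[of "{nat \<lfloor>y / G\<rfloor>}"]) (auto simp: f_eq)
    qed
    show "summable (\<lambda>n. LINT y|lborel. norm (f n y))"
      unfolding nval by (intro summable_mult h)
  qed
  also have "(\<lambda>y. \<Sum>n. f n y) = (\<lambda>y. indicator {0..} y * h (nat \<lfloor>y / G\<rfloor>))"
  proof
    fix y
    have "(\<Sum>n. f n y) = (\<Sum>n\<in>{nat \<lfloor>y / G\<rfloor>}. f n y)"
      by (rule suminf_finite) (auto simp: f_eq)
    also have "\<dots> = f (nat \<lfloor>y / G\<rfloor>) y" by simp
    also have "\<dots> = indicator {0..} y * h (nat \<lfloor>y / G\<rfloor>)" by (simp only: f_eq refl if_True)
    finally show "(\<Sum>n. f n y) = indicator {0..} y * h (nat \<lfloor>y / G\<rfloor>)" .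
  qed
  also have "(\<Sum>n. LINT y|lborel. f n y) = G * (\<Sum>n. h n)"
    unfolding val by (rule suminf_mult) (rule summable_rabs_cancel[OF h])
  finally show ?thesis .
qed

lemma floor_div_times_tendsto:
  fixes G :: "'i \<Rightarrow> real"
  assumes "\<And>t. 0 < G t" "(G \<longlongrightarrow> 0) F" and y: "0 \<le> y"
  shows "((\<lambda>t. real (nat \<lfloor>y / G t\<rfloor>) * G t) \<longlongrightarrow> y) F"
proof (rule tendsto_sandwich)
  have fl: "real (nat \<lfloor>y / G t\<rfloor>) = of_int \<lfloor>y / G t\<rfloor>" for t
    using assms(1)[of t] y by simp
  show "\<forall>\<^sub>F t in F. y - G t \<le> real (nat \<lfloor>y / G t\<rfloor>) * G t"
  proof (intro always_eventually allI)
    fix t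
    have "(y / G t - 1) * G t \<le> of_int \<lfloor>y / G t\<rfloor> * G t"
      using assms(1)[of t] by (intro mult_right_mono) linarith+
    then show "y - G t \<le> real (nat \<lfloor>y / G t\<rfloor>) * G t"
      unfolding fl using assms(1)[of t] by (simp add: left_diff_distrib)
  qed
  show "\<forall>\<^sub>F t in F. real (nat \<lfloor>y / G t\<rfloor>) * G t \<le> y"
  proof (intro always_eventually allI)
    fix t
    have "of_int \<lfloor>y / G t\<rfloor> * G t \<le> y / G t * G t"
      using assms(1)[of t] by (intro mult_right_mono) linarith+
    then show "real (nat \<lfloor>y / G t\<rfloor>) * G t \<le> y" unfolding fl using assms(1)[of t] by simp
  qed
  show "((\<lambda>t. y - G t) \<longlongrightarrow> y) F" using tendsto_diff[OF tendsto_const assms(2), of y] by simp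
qed simp

text \<open>Read the index as \<open>nat \<lfloor>y / G t\<rfloor>\<close>: the integrand then
  converges to \<open>g (q y)\<close> for almost every \<open>y\<close>, which suffices under the
  integral, and the uniform exponential bound on \<open>p\<close> together with
  \<open>\<bar>g x\<bar> \<le> C * x\<close> dominates it.\<close>

lemma scaled_sum_tendsto_integral:
  fixes p :: "nat \<Rightarrow> real \<Rightarrow> real" and G q g :: "real \<Rightarrow> real"
  assumes G: "\<And>t. 0 < G t" "(G \<longlongrightarrow> 0) at_top"
    and p: "\<And>n t. 0 \<le> p n t" "\<And>n t. p n t \<le> 1"
    and \<kappa>: "0 < \<kappa>" and dom: "\<forall>\<^sub>F t in at_top. \<forall>n. p n t \<le> A * exp (- \<kappa> * (real (Suc n) * G t))"
    and q: "q \<in> borel_measurable borel" "\<And>y. y \<le> 0 \<Longrightarrow> q y = 0"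
    and lim: "AE y in lborel. 0 < y \<longrightarrow> (\<forall>n. ((\<lambda>t. real (n t) * G t) \<longlongrightarrow> y) at_top \<longrightarrow> ((\<lambda>t. p (n t) t) \<longlongrightarrow> q y) at_top)"
    and g: "continuous_on {0..1} g" "g \<in> borel_measurable borel" "0 \<le> C" "\<And>x. 0 \<le> x \<Longrightarrow> x \<le> 1 \<Longrightarrow> \<bar>g x\<bar> \<le> C * x"
  shows "\<forall>\<^sub>F t in at_top. summable (\<lambda>n. \<bar>g (p n t)\<bar>)" (is ?summable)
    and "((\<lambda>t. G t * (\<Sum>n. g (p n t))) \<longlongrightarrow> (LINT y|lborel. g (q y))) at_top"
proof -
  note [measurable] = q(1) g(2)
  have g0: "g 0 = 0" using g(4)[of 0] by simp
  show summ: ?summable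
    using dom
  proof eventually_elim
    case (elim t)
    have "summable (\<lambda>n. C * A * exp (- \<kappa> * G t) * exp (- \<kappa> * G t) ^ n)"
      using \<kappa> G(1)[of t] by (intro summable_mult summable_geometric) simp
    then show ?case
    proof (rule summable_comparison_test'[where N = 0])
      fix n
      have "\<bar>g (p n t)\<bar> \<le> C * (A * exp (- \<kappa> * (real (Suc n) * G t)))"
        using g(4)[OF p(1,2)[of n t]] mult_left_mono[OF elim[rule_format, of n] g(3)] by linarith
      also have "\<dots> = C * A * exp (- \<kappa> * G t) * exp (- \<kappa> * G t) ^ n"
        by (simp add: exp_of_nat_mult[symmetric] exp_add[symmetric] algebra_simps)
      finally show "norm \<bar>g (p n t)\<bar> \<le> C * A * exp (- \<kappa> * G t) * exp (- \<kappa> * G t) ^ n" by simp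
    qed
  qed
  let ?s = "\<lambda>t y. indicator {0..} y * g (p (nat \<lfloor>y / G t\<rfloor>) t)"
  let ?w = "\<lambda>y. C * A * (indicator {0<..} y * (y powr (1 - 1) * exp (- \<kappa> * y)))"
  have "((\<lambda>t. LINT y|lborel. ?s t y) \<longlongrightarrow> (LINT y|lborel. g (q y))) at_top"
  proof (rule integral_dominated_convergence_at_top[where w = ?w])
    show "integrable lborel ?w"
      using \<kappa> by (intro integrable_mult_right Gamma_integral_scaled(1)) auto
    show "\<forall>\<^sub>F t in at_top. AE y in lborel. norm (?s t y) \<le> ?w y"
      using dom
    proof eventually_elim
      case (elim t)
      note pA = elim[rule_format]
      show ?case
        using AE_lborel_singleton[of 0]
      proof eventually_elim
        case (elim y)
        show ?case
        proof (cases "0 < y")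
          case True
          let ?n = "nat \<lfloor>y / G t\<rfloor>"
          have A: "0 \<le> A * exp (- \<kappa> * (real (Suc ?n) * G t))"
            using p(1) pA by (rule order_trans)
          then have A0: "0 \<le> A" by (simp add: zero_le_mult_iff)
          \<comment> \<open>The successor in the exponential bound absorbs the rounding of the
            index, so the dominating function does not depend on \<open>t\<close>.\<close>
          have "y / G t \<le> real (Suc ?n)" by linarith
          then have "y \<le> real (Suc ?n) * G t" using G(1)[of t] by (simp add: divide_le_eq)
          then have e: "exp (- \<kappa> * (real (Suc ?n) * G t)) \<le> exp (- \<kappa> * y)" using \<kappa> by simp
          have "\<bar>g (p ?n t)\<bar> \<le> C * p ?n t" by (intro g(4) p)
          also have "\<dots> \<le> C * (A * exp (- \<kappa> * (real (Suc ?n) * G t)))"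
            by (intro mult_left_mono g(3) pA)
          also have "\<dots> \<le> C * (A * exp (- \<kappa> * y))" by (intro mult_left_mono e A0 g(3))
          finally show ?thesis using True by (simp add: mult.assoc)
        qed (use elim in simp)
      qed
    qed
    show "AE y in lborel. ((\<lambda>t. ?s t y) \<longlongrightarrow> g (q y)) at_top"
      using lim AE_lborel_singleton[of 0]
    proof eventually_elim
      case (elim y)
      show ?case
      proof (cases "0 < y")
        case True
        have pq: "((\<lambda>t. p (nat \<lfloor>y / G t\<rfloor>) t) \<longlongrightarrow> q y) at_top"
          using elim(1) True floor_div_times_tendsto[OF G, of y] by simp
        have "0 \<le> q y" by (rule tendsto_lowerbound[OF pq]) (auto simp: p)
        moreover have "q y \<le> 1" by (rule tendsto_upperbound[OF pq]) (auto simp: p)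
        ultimately have "q y \<in> {0..1}" by simp
        then have "((\<lambda>t. g (p (nat \<lfloor>y / G t\<rfloor>) t)) \<longlongrightarrow> g (q y)) at_top"
          by (intro continuous_on_tendsto_compose[OF g(1) pq]) (auto simp: p)
        then show ?thesis using True by simp
      next
        case False
        then have "y < 0" using elim by simp
        then show ?thesis using q(2)[of y] by (simp add: g0)
      qed
    qed
  qed measurable
  moreover have ev: "\<forall>\<^sub>F t in at_top. (LINT y|lborel. ?s t y) = G t * (\<Sum>n. g (p n t))"
    using summ by eventually_elim (rule lborel_integral_step[OF G(1)])
  ultimately show "((\<lambda>t. G t * (\<Sum>n. g (p n t))) \<longlongrightarrow> (LINT y|lborel. g (q y))) at_top"
    by (subst (asm) tendsto_cong[OF ev])
qed

subsection \<open>Stable subordinators and their inverses\<close>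

text \<open>A probability law has at most countably many atoms.\<close>

lemma AE_lborel_no_atom:
  fixes R :: "'a \<Rightarrow> real"
  assumes "prob_space M" and [measurable]: "R \<in> borel_measurable M"
  shows "AE v in lborel. measure M {\<omega> \<in> space M. R \<omega> = v} = 0"
proof -
  interpret prob_space M by fact
  interpret D: prob_space "distr M borel R" by (rule prob_space_distr) simp
  let ?C = "{v. measure (distr M borel R) {v} \<noteq> 0}"
  have "?C \<in> null_sets lborel" by (intro countable_imp_null_set_lborel D.countable_support)
  moreover have "measure (distr M borel R) {v} = measure M {\<omega> \<in> space M. R \<omega> = v}" for v
    by (subst measure_distr) (auto intro!: arg_cong[where f = "measure M"])
  ultimately show ?thesis by (intro AE_I'[of ?C]) auto
qed

lemma survival_measurable:
  fixes R :: "'a \<Rightarrow> real"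
  assumes "prob_space M" and [measurable]: "R \<in> borel_measurable M"
  shows "(\<lambda>v. indicator {0<..} v * measure M {\<omega> \<in> space M. v < R \<omega>}) \<in> borel_measurable borel"
proof -
  interpret prob_space M by fact
  have "mono (\<lambda>v. - measure M {\<omega> \<in> space M. v < R \<omega>})"
    by (intro monoI) (auto intro!: finite_measure_mono)
  from borel_measurable_mono[OF this]
  have [measurable]: "(\<lambda>v. measure M {\<omega> \<in> space M. v < R \<omega>}) \<in> borel_measurable borel" by simp
  show ?thesis by measurable
qed

lemma nn_integral_survival:
  fixes R :: "'a \<Rightarrow> real"
  assumes M: "prob_space M" and [measurable]: "R \<in> borel_measurable M" and R: "AE \<omega> in M. 0 \<le> R \<omega>"
  shows "(\<integral>\<^sup>+v. ennreal (indicator {0<..} v * measure M {\<omega> \<in> space M. v < R \<omega>}) \<partial>lborel) =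
    (\<integral>\<^sup>+\<omega>. ennreal (R \<omega>) \<partial>M)"
proof -
  interpret prob_space M by fact
  have "(\<integral>\<^sup>+v. ennreal (indicator {0<..} v * measure M {\<omega> \<in> space M. v < R \<omega>}) \<partial>lborel) =
      (\<integral>\<^sup>+v. 1 * indicator {0<..} v * emeasure M {\<omega> \<in> space M. v < R \<omega>} \<partial>lborel)"
    by (intro nn_integral_cong) (auto simp: emeasure_eq_measure split: split_indicator)
  also have "\<dots> = (\<integral>\<^sup>+\<omega>. (\<integral>\<^sup>+y. 1 * indicator {0<..<R \<omega>} y \<partial>lborel) \<partial>M)"
    by (rule layer_cake[OF M, symmetric]) measurable
  also have "\<dots> = (\<integral>\<^sup>+\<omega>. ennreal (R \<omega>) \<partial>M)"
    by (rule nn_integral_cong_AE) (use R in eventually_elim, simp)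
  finally show ?thesis .
qed

text \<open>The mean of the inverse subordinator at level 1 for \<open>0 < \<alpha>\<close>, shown
  in \<open>expectation_inv\<close>, and 1 for \<open>\<alpha> = 0\<close>. It reappears as the
  limit of the renewal function times the tail.\<close>

definition stable_const :: "real \<Rightarrow> real" where
  "stable_const \<alpha> = 1 / (Gamma (1 - \<alpha>) * Gamma (1 + \<alpha>))"

lemma stable_const_pos: "0 \<le> \<alpha> \<Longrightarrow> \<alpha> < 1 \<Longrightarrow> 0 < stable_const \<alpha>"
  unfolding stable_const_def by (simp add: Gamma_real_pos)

lemma filterlim_powr_at_top:
  fixes a :: real
  assumes "0 < a" shows "filterlim (\<lambda>z. z powr a) at_top at_top"
proof -
  have "filterlim (\<lambda>z. exp (a * ln z)) at_top at_top"
    by (intro filterlim_compose[OF exp_at_top] filterlim_tendsto_pos_mult_at_top[OF tendsto_const assms] ln_at_top)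
  moreover have "\<forall>\<^sub>F z in at_top. exp (a * ln z) = z powr a"
    using eventually_gt_at_top[of 0] by eventually_elim (simp add: powr_def)
  ultimately show ?thesis by (simp add: filterlim_cong)
qed

lemma nonneg_powr_le_iff:
  fixes a x y :: real
  assumes "0 < a" "0 \<le> x" "0 \<le> y" shows "x powr a \<le> y powr a \<longleftrightarrow> x \<le> y"
  using assms powr_less_mono2[of a y x] powr_mono2[of a x y] by linarith

lemma nn_integral_powr_exp_powr:
  fixes a c :: real
  assumes a: "0 < a" and c: "0 < c"
  shows "(\<integral>\<^sup>+z. ennreal (indicator {0<..} z * (z powr (a - 1) * exp (- (c * z powr a)))) \<partial>lborel) = ennreal (1 / (c * a))"
proof -
  let ?f = "\<lambda>z. z powr (a - 1) * exp (- (c * z powr a))"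
  let ?F = "\<lambda>z. - exp (- (c * z powr a)) / (c * a)"
  have ein: "einterval 0 \<infinity> = {0<..}" by (auto simp: einterval_def zero_ereal_def)
  have F: "DERIV ?F x :> ?f x" if "0 < x" for x
    using that a c by (auto intro!: derivative_eq_intros simp: field_simps powr_diff)
  have cont: "isCont ?f x" if "0 < x" for x
    using that by (auto intro!: continuous_intros)
  have "((\<lambda>z. z powr a) \<longlongrightarrow> 0 powr a) (at_right 0)"
  proof (rule tendsto_powr2)
    show "\<forall>\<^sub>F z in at_right 0. (0::real) \<le> z"
      using eventually_at_right_less[of "0::real"] by eventually_elim simp
  qed (use a in \<open>auto intro: tendsto_ident_at\<close>)
  then have "((\<lambda>z. exp (- (c * z powr a))) \<longlongrightarrow> exp (- (c * 0 powr a))) (at_right 0)"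
    by (intro tendsto_exp tendsto_minus tendsto_mult_left)
  then have A: "(?F \<longlongrightarrow> - 1 / (c * a)) (at_right 0)"
    using a c tendsto_divide[OF tendsto_minus tendsto_const, of _ "exp (- (c * 0 powr a))" "at_right 0" "c * a"] by simp
  have "filterlim (\<lambda>z. z powr a) at_top at_top" by (rule filterlim_powr_at_top[OF a])
  then have "filterlim (\<lambda>z. c * z powr a) at_top at_top"
    using c by (intro filterlim_tendsto_pos_mult_at_top[OF tendsto_const])
  then have "((\<lambda>z. exp (- (c * z powr a))) \<longlongrightarrow> 0) at_top"
    by (intro filterlim_compose[OF exp_at_bot]) (simp add: filterlim_uminus_at_top[symmetric])
  then have "(?F \<longlongrightarrow> - 0 / (c * a)) at_top" using a c by (intro tendsto_intros) auto
  then have B: "(?F \<longlongrightarrow> 0) at_top" by simp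
  have A': "((?F \<circ> real_of_ereal) \<longlongrightarrow> - 1 / (c * a)) (at_right 0)"
    using A by (simp add: zero_ereal_def ereal_tendsto_simps)
  have B': "((?F \<circ> real_of_ereal) \<longlongrightarrow> 0) (at_left \<infinity>)"
    using B by (simp add: ereal_tendsto_simps)
  have "set_integrable lborel (einterval 0 \<infinity>) ?f"
    by (rule interval_integral_FTC_nonneg(1)[OF _ _ _ _ A' B']) (use F cont in \<open>auto simp: zero_ereal_def\<close>)
  moreover have "(LBINT x=0..\<infinity>. ?f x) = 0 - (- 1 / (c * a))"
    by (rule interval_integral_FTC_nonneg(2)[OF _ _ _ _ A' B']) (use F cont in \<open>auto simp: zero_ereal_def\<close>)
  ultimately have "set_integrable lborel {0<..} ?f" "(LINT x:{0<..}|lborel. ?f x) = 1 / (c * a)"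
    unfolding ein by (simp_all add: interval_lebesgue_integral_def ein)
  then have "integrable lborel (\<lambda>z. indicator {0<..} z * ?f z)"
    "(LINT z|lborel. indicator {0<..} z * ?f z) = 1 / (c * a)"
    by (simp_all add: set_integrable_def set_lebesgue_integral_def)
  then show ?thesis by (subst nn_integral_eq_integral) auto
qed

locale subordinator =
  fixes Q :: "'b measure" and \<alpha> :: real and W :: "real \<Rightarrow> 'b \<Rightarrow> real"
  assumes stable: "stable_subordinator Q \<alpha> W" and \<alpha>: "0 < \<alpha>" "\<alpha> < 1"
begin

sublocale prob_space Q using stable by (simp add: stable_subordinator_def)

abbreviation c where "c \<equiv> Gamma (1 - \<alpha>)"

lemma c_pos: "0 < c" using \<alpha> by (simp add: Gamma_real_pos)

lemma meas_W [measurable]: "0 \<le> t \<Longrightarrow> W t \<in> borel_measurable Q"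
  using stable by (simp add: stable_subordinator_def)

lemma W_mono: "\<omega> \<in> space Q \<Longrightarrow> 0 \<le> s \<Longrightarrow> s \<le> t \<Longrightarrow> W s \<omega> \<le> W t \<omega>"
  using stable by (auto simp: stable_subordinator_def mono_on_def)

lemma W_nonneg: "\<omega> \<in> space Q \<Longrightarrow> 0 \<le> t \<Longrightarrow> 0 \<le> W t \<omega>"
  using W_mono[of \<omega> 0 t] stable by (auto simp: stable_subordinator_def)

lemma exp_W_integrable:
  assumes "0 \<le> t" "0 \<le> z" shows "integrable Q (\<lambda>\<omega>. exp (- z * W t \<omega>))"
proof (rule integrable_const_bound)
  show "AE \<omega> in Q. norm (exp (- z * W t \<omega>)) \<le> 1" using assms W_nonneg by (intro AE_I2) simp
  show "(\<lambda>\<omega>. exp (- z * W t \<omega>)) \<in> borel_measurable Q" using meas_W[OF assms(1)] by measurable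
qed

lemma laplace_W:
  assumes "0 \<le> t" "0 \<le> z"
  shows "expectation (\<lambda>\<omega>. exp (- z * W t \<omega>)) = exp (- (c * t * z powr \<alpha>))"
proof -
  let ?E = "expectation (\<lambda>\<omega>. exp (- z * W t \<omega>))"
  \<comment> \<open>The definition prescribes only \<open>- ln ?E\<close>; positivity of
    \<open>?E\<close> is what allows \<open>exp\<close> to recover it.\<close>
  have "expectation (\<lambda>\<omega>. 0) < ?E"
    by (rule integral_less_AE_space) (use exp_W_integrable[OF assms] emeasure_space_1 in auto)
  then have "0 < ?E" by simp
  moreover have "- ln ?E = c * t * z powr \<alpha>"
    using stable assms by (simp add: stable_subordinator_def)
  ultimately show ?thesis by (metis exp_ln minus_minus)
qed

lemma prob_W_le:
  assumes "0 \<le> t" "0 \<le> z"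
  shows "prob {\<omega> \<in> space Q. W t \<omega> \<le> x} \<le> exp (z * x) * exp (- (c * t * z powr \<alpha>))"
proof -
  note [measurable] = meas_W[OF assms(1)]
  have set: "{\<omega> \<in> space Q. W t \<omega> \<le> x} \<in> sets Q" by measurable
  have "{\<omega> \<in> space Q. W t \<omega> \<le> x} \<inter> space Q = {\<omega> \<in> space Q. W t \<omega> \<le> x}" by auto
  then have "prob {\<omega> \<in> space Q. W t \<omega> \<le> x} = expectation (indicator {\<omega> \<in> space Q. W t \<omega> \<le> x})" by simp
  also have "\<dots> \<le> expectation (\<lambda>\<omega>. exp (z * x) * exp (- z * W t \<omega>))"
  proof (rule integral_mono)
    show "integrable Q (indicat_real {\<omega> \<in> space Q. W t \<omega> \<le> x})"
      using set by (simp add: emeasure_eq_measure)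
    show "integrable Q (\<lambda>\<omega>. exp (z * x) * exp (- z * W t \<omega>))"
      by (intro integrable_mult_right exp_W_integrable assms)
    show "indicat_real {\<omega> \<in> space Q. W t \<omega> \<le> x} \<omega> \<le> exp (z * x) * exp (- z * W t \<omega>)" for \<omega>
    proof (cases "W t \<omega> \<le> x")
      case True
      then have "z * W t \<omega> \<le> z * x" using assms by (intro mult_left_mono) auto
      then have "1 \<le> exp (z * x + - z * W t \<omega>)" by simp
      then show ?thesis by (simp only: exp_add) (auto split: split_indicator)
    qed simp
  qed
  also have "\<dots> = exp (z * x) * exp (- (c * t * z powr \<alpha>))"
    by (simp only: integral_mult_right_zero laplace_W[OF assms])
  finally show ?thesis .
qed

text \<open>Let \<open>z\<close> tend to infinity in the exponential Markov bound at level
  0.\<close>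

lemma AE_W1_pos: "AE \<omega> in Q. 0 < W 1 \<omega>"
proof -
  have "filterlim (\<lambda>z. c * z powr \<alpha>) at_top at_top"
    using c_pos \<alpha> by (intro filterlim_tendsto_pos_mult_at_top[OF tendsto_const] filterlim_powr_at_top)
  then have "((\<lambda>z. exp (- (c * z powr \<alpha>))) \<longlongrightarrow> 0) at_top"
    by (intro filterlim_compose[OF exp_at_bot]) (simp add: filterlim_uminus_at_top[symmetric])
  moreover have "\<forall>\<^sub>F z in at_top. prob {\<omega> \<in> space Q. W 1 \<omega> \<le> 0} \<le> exp (- (c * z powr \<alpha>))"
    using eventually_ge_at_top[of 0] by eventually_elim (use prob_W_le[of 1 _ 0] in simp)
  ultimately have "prob {\<omega> \<in> space Q. W 1 \<omega> \<le> 0} \<le> 0"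
    by (intro tendsto_lowerbound[of _ _ at_top]) auto
  then have "prob {\<omega> \<in> space Q. W 1 \<omega> \<le> 0} = 0" by (simp add: measure_le_0_iff)
  then have "AE \<omega> in Q. \<not> W 1 \<omega> \<le> 0"
    by (intro AE_I[of _ _ "{\<omega> \<in> space Q. W 1 \<omega> \<le> 0}"]) (auto simp: emeasure_eq_measure)
  then show ?thesis by eventually_elim simp
qed

text \<open>By scaling, \<open>W v\<close> has the law of \<open>v powr (1 / \<alpha>) * W 1\<close>, so \<open>W v \<le> 1\<close> has the probability of \<open>v \<le> R\<close>.\<close>

definition R :: "'b \<Rightarrow> real" where "R \<omega> = W 1 \<omega> powr (- \<alpha>)"

definition surv :: "real \<Rightarrow> real" where
  "surv v = indicator {0<..} v * prob {\<omega> \<in> space Q. v < R \<omega>}"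

lemma meas_R [measurable]: "R \<in> borel_measurable Q"
  unfolding R_def using meas_W[of 1] by measurable

lemma le_R_iff:
  assumes "0 < w" "0 < v"
  shows "v \<le> w powr (- \<alpha>) \<longleftrightarrow> v powr (1 / \<alpha>) * w \<le> 1"
    and "v = w powr (- \<alpha>) \<longleftrightarrow> v powr (1 / \<alpha>) * w = 1"
proof -
  have eq: "(v powr (1 / \<alpha>) * w) powr \<alpha> = v * w powr \<alpha>"
    using assms \<alpha> by (simp add: powr_mult powr_powr)
  have "v \<le> w powr (- \<alpha>) \<longleftrightarrow> v * w powr \<alpha> \<le> 1"
    using assms by (simp add: powr_minus field_simps)
  also have "\<dots> \<longleftrightarrow> (v powr (1 / \<alpha>) * w) powr \<alpha> \<le> 1 powr \<alpha>" unfolding eq by simp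
  also have "\<dots> \<longleftrightarrow> v powr (1 / \<alpha>) * w \<le> 1"
    using assms \<alpha> by (intro nonneg_powr_le_iff) auto
  finally show "v \<le> w powr (- \<alpha>) \<longleftrightarrow> v powr (1 / \<alpha>) * w \<le> 1" .
  have "v = w powr (- \<alpha>) \<longleftrightarrow> v * w powr \<alpha> = 1"
    using assms by (simp add: powr_minus field_simps)
  also have "\<dots> \<longleftrightarrow> (v powr (1 / \<alpha>) * w) powr \<alpha> = 1 powr \<alpha>" unfolding eq by simp
  also have "\<dots> \<longleftrightarrow> v powr (1 / \<alpha>) * w = 1"
    using nonneg_powr_le_iff[of \<alpha> "v powr (1 / \<alpha>) * w" 1] nonneg_powr_le_iff[of \<alpha> 1 "v powr (1 / \<alpha>) * w"]
      assms \<alpha> by (auto simp: order_eq_iff)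
  finally show "v = w powr (- \<alpha>) \<longleftrightarrow> v powr (1 / \<alpha>) * w = 1" .
qed

lemma scaled_moments:
  assumes "0 < v" "0 < k"
  shows "expectation (\<lambda>\<omega>. exp (- (v powr (1 / \<alpha>)) * W 1 \<omega>) ^ k) = exp (- (v * (c * real k powr \<alpha>)))"
proof -
  have "exp (- (v powr (1 / \<alpha>)) * W 1 \<omega>) ^ k = exp (- (real k * v powr (1 / \<alpha>)) * W 1 \<omega>)" for \<omega>
    by (simp add: exp_of_nat_mult[symmetric] algebra_simps)
  then have "expectation (\<lambda>\<omega>. exp (- (v powr (1 / \<alpha>)) * W 1 \<omega>) ^ k) =
      exp (- (c * 1 * (real k * v powr (1 / \<alpha>)) powr \<alpha>))"
    using laplace_W[of 1 "real k * v powr (1 / \<alpha>)"] by simp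
  also have "(real k * v powr (1 / \<alpha>)) powr \<alpha> = real k powr \<alpha> * v"
    using assms \<alpha> by (simp add: powr_mult powr_powr)
  finally show ?thesis by (simp add: mult_ac)
qed

lemma W_moments:
  assumes "0 < v"
  shows "expectation (\<lambda>\<omega>. exp (- 1 * W v \<omega>) ^ k) = exp (- (v * (c * real k powr \<alpha>)))"
proof -
  have "exp (- 1 * W v \<omega>) ^ k = exp (- real k * W v \<omega>)" for \<omega>
    by (simp add: exp_of_nat_mult[symmetric])
  then show ?thesis using laplace_W[of v "real k"] assms by (simp add: mult_ac)
qed

text \<open>By \<open>le_R_iff\<close>, \<open>exp (-1) \<le> Y\<close> means
  \<open>v \<le> R\<close> almost surely, and the atom of \<open>Y\<close> at
  \<open>exp (-1)\<close> is the atom of \<open>R\<close> at \<open>v\<close>. The conclusions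
  supply, together with \<open>scaled_moments\<close>, the limit law at \<open>v\<close>.\<close>

lemma no_atom_R:
  assumes v: "0 < v" and atom: "prob {\<omega> \<in> space Q. R \<omega> = v} = 0"
  defines "Y \<equiv> \<lambda>\<omega>. exp (- (v powr (1 / \<alpha>)) * W 1 \<omega>)"
  shows "Y \<in> borel_measurable Q" "AE \<omega> in Q. Y \<omega> \<in> {0..1}"
    "prob {\<omega> \<in> space Q. Y \<omega> = exp (-1)} = 0" "prob {\<omega> \<in> space Q. exp (-1) \<le> Y \<omega>} = surv v"
proof -
  have [measurable]: "W 1 \<in> borel_measurable Q" by simp
  show [measurable]: "Y \<in> borel_measurable Q" unfolding Y_def by measurable
  show "AE \<omega> in Q. Y \<omega> \<in> {0..1}" unfolding Y_def using W_nonneg by (intro AE_I2) simp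
  have "prob {\<omega> \<in> space Q. Y \<omega> = exp (-1)} = prob {\<omega> \<in> space Q. R \<omega> = v}"
  proof (rule finite_measure_eq_AE)
    show "AE \<omega> in Q. \<omega> \<in> {\<omega> \<in> space Q. Y \<omega> = exp (-1)} \<longleftrightarrow> \<omega> \<in> {\<omega> \<in> space Q. R \<omega> = v}"
      using AE_W1_pos by eventually_elim (use le_R_iff(2)[OF _ v] in \<open>auto simp: Y_def R_def\<close>)
  qed measurable
  then show "prob {\<omega> \<in> space Q. Y \<omega> = exp (-1)} = 0" using atom by simp
  have noatom: "AE \<omega> in Q. R \<omega> \<noteq> v"
    by (rule AE_I[of _ _ "{\<omega> \<in> space Q. R \<omega> = v}"]) (auto simp: emeasure_eq_measure atom)
  have "prob {\<omega> \<in> space Q. exp (-1) \<le> Y \<omega>} = prob {\<omega> \<in> space Q. v < R \<omega>}"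
  proof (rule finite_measure_eq_AE)
    show "AE \<omega> in Q. \<omega> \<in> {\<omega> \<in> space Q. exp (-1) \<le> Y \<omega>} \<longleftrightarrow> \<omega> \<in> {\<omega> \<in> space Q. v < R \<omega>}"
      using AE_W1_pos noatom
      by eventually_elim (use le_R_iff(1)[OF _ v] in \<open>auto simp: Y_def R_def less_le\<close>)
  qed measurable
  then show "prob {\<omega> \<in> space Q. exp (-1) \<le> Y \<omega>} = surv v" using v by (simp add: surv_def)
qed

text \<open>The exponentials of \<open>- W v\<close> and of
  \<open>- v powr (1 / \<alpha>) * W 1\<close> have the same moments. Applied to a constant
  sequence, the moment criterion becomes an identity of probabilities.\<close>

lemma prob_W_le_1:
  assumes v: "0 < v" and atom: "prob {\<omega> \<in> space Q. R \<omega> = v} = 0"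
  shows "prob {\<omega> \<in> space Q. W v \<omega> \<le> 1} = surv v"
proof -
  note Y = no_atom_R[OF v atom]
  have [measurable]: "W v \<in> borel_measurable Q" using v by simp
  have "(\<lambda>_::nat. prob {\<omega> \<in> space Q. exp (-1) \<le> exp (- 1 * W v \<omega>)}) \<longlonglongrightarrow>
      prob {\<omega> \<in> space Q. exp (-1) \<le> exp (- (v powr (1 / \<alpha>)) * W 1 \<omega>)}"
  proof (rule tendsto_prob_ge_of_moments[OF prob_space_axioms prob_space_axioms _ Y(1-2) _ Y(3)])
    show "\<forall>\<^sub>F i in sequentially. (\<lambda>\<omega>. exp (- 1 * W v \<omega>)) \<in> borel_measurable Q \<and>
        (AE \<omega> in Q. exp (- 1 * W v \<omega>) \<in> {0..1})"
      using W_nonneg v by (intro always_eventually allI conjI AE_I2) auto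
    show "(\<lambda>_. expectation (\<lambda>\<omega>. exp (- 1 * W v \<omega>) ^ k)) \<longlonglongrightarrow>
        expectation (\<lambda>\<omega>. exp (- (v powr (1 / \<alpha>)) * W 1 \<omega>) ^ k)" if "0 < k" for k
      unfolding scaled_moments[OF v that] W_moments[OF v] by (rule tendsto_const)
  qed
  then show ?thesis using Y(4) by (simp add: LIMSEQ_const_iff)
qed

lemma surv_measurable [measurable]: "surv \<in> borel_measurable borel"
  using survival_measurable[OF prob_space_axioms meas_R] by (simp add: surv_def[abs_def])

lemma surv_nonneg: "0 \<le> surv v" by (simp add: surv_def)

text \<open>The left side is the mean of \<open>W 1 powr (- \<alpha>)\<close>. This power times
  \<open>Gamma \<alpha>\<close> is the integral of
  \<open>z powr (\<alpha> - 1) * exp (- z * W 1)\<close> over \<open>0 < z\<close>; Tonelli brings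
  in the Laplace transform of \<open>W 1\<close>, and the remaining integral is elementary.\<close>

lemma nn_integral_surv: "(\<integral>\<^sup>+v. ennreal (surv v) \<partial>lborel) = ennreal (stable_const \<alpha>)"
proof -
  have [measurable]: "W 1 \<in> borel_measurable Q" by simp
  interpret P: pair_sigma_finite lborel Q ..
  let ?k = "\<lambda>z \<omega>. ennreal (indicator {0<..} z * (z powr (\<alpha> - 1) * exp (- z * W 1 \<omega>)))"
  have "ennreal (Gamma \<alpha>) * (\<integral>\<^sup>+v. ennreal (surv v) \<partial>lborel) = ennreal (Gamma \<alpha>) * (\<integral>\<^sup>+\<omega>. ennreal (R \<omega>) \<partial>Q)"
    unfolding surv_def by (subst nn_integral_survival[OF prob_space_axioms meas_R]) (auto simp: R_def)
  also have "\<dots> = (\<integral>\<^sup>+\<omega>. ennreal (Gamma \<alpha> * R \<omega>) \<partial>Q)"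
    using \<alpha> by (simp add: nn_integral_cmult[symmetric] ennreal_mult R_def less_imp_le[OF Gamma_real_pos])
  also have "\<dots> = (\<integral>\<^sup>+\<omega>. (\<integral>\<^sup>+z. ?k z \<omega> \<partial>lborel) \<partial>Q)"
  proof (rule nn_integral_cong_AE)
    show "AE \<omega> in Q. ennreal (Gamma \<alpha> * R \<omega>) = (\<integral>\<^sup>+z. ?k z \<omega> \<partial>lborel)"
      using AE_W1_pos
    proof eventually_elim
      case (elim \<omega>)
      note G = Gamma_integral_scaled[OF \<alpha>(1) elim]
      show ?case
        unfolding R_def using G(1)
        by (subst G(2)[symmetric]) (simp add: nn_integral_eq_integral mult.commute[of "W 1 \<omega>"])
    qed
  qed
  also have "\<dots> = (\<integral>\<^sup>+z. (\<integral>\<^sup>+\<omega>. ?k z \<omega> \<partial>Q) \<partial>lborel)"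
    by (rule P.Fubini') measurable
  also have "\<dots> = (\<integral>\<^sup>+z. ennreal (indicator {0<..} z * (z powr (\<alpha> - 1) * exp (- (c * z powr \<alpha>)))) \<partial>lborel)"
  proof (intro nn_integral_cong)
    fix z :: real
    show "(\<integral>\<^sup>+\<omega>. ?k z \<omega> \<partial>Q) = ennreal (indicator {0<..} z * (z powr (\<alpha> - 1) * exp (- (c * z powr \<alpha>))))"
    proof (cases "0 < z")
      case True
      then show ?thesis
        using laplace_W[of 1 z] exp_W_integrable[of 1 z]
        by (subst nn_integral_eq_integral) (auto intro!: integrable_mult_right)
    qed simp
  qed
  also have "\<dots> = ennreal (1 / (c * \<alpha>))" by (rule nn_integral_powr_exp_powr[OF \<alpha>(1) c_pos])
  finally have "ennreal (1 / Gamma \<alpha>) * (ennreal (Gamma \<alpha>) * (\<integral>\<^sup>+v. ennreal (surv v) \<partial>lborel)) =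
      ennreal (1 / Gamma \<alpha>) * ennreal (1 / (c * \<alpha>))" by simp
  moreover have "1 / Gamma \<alpha> * (1 / (c * \<alpha>)) = stable_const \<alpha>"
  proof -
    have "\<alpha> \<notin> \<int>\<^sub>\<le>\<^sub>0" using \<alpha> by (auto elim!: nonpos_Ints_cases)
    then have "Gamma (1 + \<alpha>) = \<alpha> * Gamma \<alpha>" by (simp only: add.commute[of 1 \<alpha>] Gamma_plus1 simp_thms)
    then show ?thesis by (simp add: stable_const_def mult_ac)
  qed
  ultimately show ?thesis
    using \<alpha> c_pos Gamma_real_pos[OF \<alpha>(1)]
    by (simp add: mult.assoc[symmetric] ennreal_mult[symmetric])
qed

end

context subordinator
begin

text \<open>Provides the point \<open>z\<close> at which the linear exponent \<open>z * x\<close>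
  and the stable exponent \<open>c * z powr \<alpha>\<close> stand in a prescribed ratio.\<close>

lemma power_scale:
  assumes "0 < y"
  obtains z where "0 < z" "z = y * z powr \<alpha>"
proof
  let ?z = "y powr (1 / (1 - \<alpha>))"
  show "0 < ?z" using assms by simp
  have "1 + \<alpha> / (1 - \<alpha>) = 1 / (1 - \<alpha>)" using \<alpha> by (simp add: field_simps)
  then have "y powr 1 * y powr (\<alpha> / (1 - \<alpha>)) = ?z" by (simp only: powr_add[symmetric])
  then show "?z = y * ?z powr \<alpha>" using assms by (simp add: powr_powr)
qed

lemma R_eq_iff_W1:
  assumes "0 < v" "0 < W 1 \<omega>"
  shows "v < R \<omega> \<longleftrightarrow> W 1 \<omega> < v powr (- (1 / \<alpha>))"
proof -
  have "v < R \<omega> \<longleftrightarrow> v powr (1 / \<alpha>) * W 1 \<omega> < 1"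
    using le_R_iff[OF assms(2,1)] by (auto simp: R_def less_le)
  then show ?thesis using assms by (simp add: powr_minus field_simps)
qed

text \<open>Otherwise \<open>W 1\<close> would be bounded below by some \<open>x > 0\<close> almost
  surely and its Laplace transform would be at most \<open>exp (- z * x)\<close>, which is too small
  as soon as \<open>z * x\<close> exceeds \<open>c * z powr \<alpha>\<close>.\<close>

lemma surv_pos:
  assumes v: "0 < v" shows "0 < surv v"
proof (rule ccontr)
  assume "\<not> 0 < surv v"
  then have "prob {\<omega> \<in> space Q. v < R \<omega>} = 0" using v by (simp add: surv_def zero_less_measure_iff)
  then have "AE \<omega> in Q. \<not> v < R \<omega>"
    by (intro AE_I[of _ _ "{\<omega> \<in> space Q. v < R \<omega>}"]) (auto simp: emeasure_eq_measure)
  define x where "x = v powr (- (1 / \<alpha>))"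
  have x: "0 < x" using v by (simp add: x_def)
  \<comment> \<open>Chosen so that \<open>z * x = (c + x) * z powr \<alpha>\<close>, which exceeds
    the stable exponent.\<close>
  obtain z where z: "0 < z" "z = (c / x + 1) * z powr \<alpha>"
    using power_scale[of "c / x + 1"] c_pos x by (metis add_pos_pos divide_pos_pos zero_less_one)
  have "expectation (\<lambda>\<omega>. exp (- z * W 1 \<omega>)) \<le> expectation (\<lambda>\<omega>. exp (- z * x))"
  proof (rule integral_mono_AE)
    show "integrable Q (\<lambda>\<omega>. exp (- z * W 1 \<omega>))" using z by (intro exp_W_integrable) auto
    show "AE \<omega> in Q. exp (- z * W 1 \<omega>) \<le> exp (- z * x)"
      using \<open>AE \<omega> in Q. \<not> v < R \<omega>\<close> AE_W1_pos
      by eventually_elim (use z R_eq_iff_W1[OF v] in \<open>auto simp: x_def\<close>)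
  qed simp
  then have "exp (- (c * z powr \<alpha>)) \<le> exp (- z * x)"
    using laplace_W[of 1 z] z(1) by (simp add: prob_space)
  then have "z * x \<le> c * z powr \<alpha>" by simp
  moreover have "z * x = c * z powr \<alpha> + x * z powr \<alpha>"
    using arg_cong[OF z(2), of "\<lambda>u. u * x"] x by (simp add: algebra_simps)
  moreover have "0 < x * z powr \<alpha>" using x z(1) by simp
  ultimately show False by linarith
qed

text \<open>The mirror image: an almost sure upper bound \<open>x\<close> on \<open>W 1\<close>
  would make the Laplace transform at least \<open>exp (- z * x)\<close>, too large at the
  \<open>z\<close> where \<open>z * x\<close> is half of \<open>c * z powr \<alpha>\<close>.\<close>

lemma surv_less_1:
  assumes v: "0 < v" shows "surv v < 1"
proof (rule ccontr)
  assume "\<not> surv v < 1"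
  then have "prob {\<omega> \<in> space Q. v < R \<omega>} = 1"
    using v prob_le_1[of "{\<omega> \<in> space Q. v < R \<omega>}"] by (simp add: surv_def)
  then have ae: "AE \<omega> in Q. v < R \<omega>" by (subst (asm) prob_Collect_eq_1) auto
  define x where "x = v powr (- (1 / \<alpha>))"
  have x: "0 < x" using v by (simp add: x_def)
  obtain z where z: "0 < z" "z = (c / (2 * x)) * z powr \<alpha>"
    using power_scale[of "c / (2 * x)"] c_pos x by (metis divide_pos_pos mult_pos_pos zero_less_numeral)
  have "expectation (\<lambda>\<omega>. exp (- z * x)) \<le> expectation (\<lambda>\<omega>. exp (- z * W 1 \<omega>))"
  proof (rule integral_mono_AE)
    show "integrable Q (\<lambda>\<omega>. exp (- z * W 1 \<omega>))" using z by (intro exp_W_integrable) auto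
    show "AE \<omega> in Q. exp (- z * x) \<le> exp (- z * W 1 \<omega>)"
      using ae AE_W1_pos
      by eventually_elim (use z R_eq_iff_W1[OF v] in \<open>auto simp: x_def\<close>)
  qed simp
  then have "exp (- z * x) \<le> exp (- (c * z powr \<alpha>))"
    using laplace_W[of 1 z] z(1) by (simp add: prob_space)
  then have "c * z powr \<alpha> \<le> z * x" by simp
  moreover have "z * x = c * z powr \<alpha> / 2"
    using arg_cong[OF z(2), of "\<lambda>u. u * x"] x by simp
  moreover have "0 < c * z powr \<alpha>" using c_pos z(1) by simp
  ultimately show False by linarith
qed

lemma surv_integral: "integrable lborel surv" "(LINT v|lborel. surv v) = stable_const \<alpha>"
proof -
  show "integrable lborel surv"
    by (rule integrableI_nonneg) (auto simp: surv_nonneg nn_integral_surv)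
  show "(LINT v|lborel. surv v) = stable_const \<alpha>"
    using nn_integral_surv surv_nonneg stable_const_pos[of \<alpha>] \<alpha>
    by (subst integral_eq_nn_integral) auto
qed

section \<open>The inverse subordinator at level 1\<close>

abbreviation inv where "inv \<equiv> inverse_subordinator W 1"

text \<open>The probability of \<open>W n \<le> 1\<close> decays geometrically in \<open>n\<close>.
  Hence the set whose infimum defines the first passage time is almost surely nonempty.\<close>

lemma AE_W_unbounded: "AE \<omega> in Q. \<exists>n::nat. 1 < W (real n) \<omega>"
proof -
  let ?A = "{\<omega> \<in> space Q. \<forall>n::nat. W (real n) \<omega> \<le> 1}"
  have [measurable]: "W (real n) \<in> borel_measurable Q" for n by simp
  have "(\<lambda>n. exp (- c) ^ n) \<longlonglongrightarrow> 0" using c_pos by (intro LIMSEQ_power_zero) simp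
  then have lim: "(\<lambda>n. exp 1 * exp (- c) ^ n) \<longlonglongrightarrow> 0" by (rule tendsto_mult_right_zero)
  have "prob ?A \<le> exp 1 * exp (- c) ^ n" for n
  proof -
    have "prob ?A \<le> prob {\<omega> \<in> space Q. W (real n) \<omega> \<le> 1}" by (intro finite_measure_mono) auto
    also have "\<dots> \<le> exp 1 * exp (- c) ^ n"
      using prob_W_le[of "real n" 1 1] by (simp add: exp_of_nat_mult[symmetric] mult.commute)
    finally show ?thesis .
  qed
  then have "prob ?A \<le> 0" by (intro LIMSEQ_le_const[OF lim]) auto
  then have "prob ?A = 0" by (simp add: measure_le_0_iff)
  moreover have "?A \<in> sets Q" by measurable
  ultimately have "AE \<omega> in Q. \<not> (\<forall>n::nat. W (real n) \<omega> \<le> 1)"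
    by (intro AE_I[of _ _ ?A]) (auto simp: emeasure_eq_measure)
  then show ?thesis by eventually_elim (auto simp: not_le)
qed

lemma inv_bdd: "bdd_below {s. 0 \<le> s \<and> 1 < W s \<omega>}" by (rule bdd_belowI[of _ 0]) auto

text \<open>Since paths are monotone, passage before time \<open>a\<close> can be tested at rational
  times.\<close>

lemma inv_measurable [measurable]: "inv \<in> borel_measurable Q"
proof (rule borel_measurable_iff_less[THEN iffD2, rule_format])
  fix a :: real
  have [measurable]: "W (real n) \<in> borel_measurable Q" for n :: nat by simp
  have [measurable]: "W (real_of_rat r) \<in> borel_measurable Q" if "0 \<le> r" for r using that by simp
  let ?B = "\<Union>r\<in>{r. 0 \<le> r \<and> real_of_rat r < a}. {\<omega> \<in> space Q. 1 < W (real_of_rat r) \<omega>}"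
  let ?N = "{\<omega> \<in> space Q. \<forall>n::nat. W (real n) \<omega> \<le> 1}"
  have empty: "{s. 0 \<le> s \<and> 1 < W s \<omega>} = {} \<longleftrightarrow> (\<forall>n::nat. W (real n) \<omega> \<le> 1)" if "\<omega> \<in> space Q" for \<omega>
  proof
    assume *: "\<forall>n::nat. W (real n) \<omega> \<le> 1"
    have "W s \<omega> \<le> 1" if "0 \<le> s" for s
    proof -
      obtain n :: nat where "s \<le> real n" using real_arch_simple by blast
      then show ?thesis using W_mono[OF \<open>\<omega> \<in> space Q\<close> that] * by (meson order_trans)
    qed
    then show "{s. 0 \<le> s \<and> 1 < W s \<omega>} = {}" by (auto simp: not_less)
  next
    assume *: "{s. 0 \<le> s \<and> 1 < W s \<omega>} = {}"
    have "real n \<notin> {s. 0 \<le> s \<and> 1 < W s \<omega>}" for n :: nat unfolding * by simp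
    then show "\<forall>n::nat. W (real n) \<omega> \<le> 1" by (simp add: not_less)
  qed
  have mem: "inv \<omega> < a \<longleftrightarrow> \<omega> \<in> ?B" if "\<omega> \<in> space Q" "\<omega> \<notin> ?N" for \<omega>
  proof -
    have ne: "{s. 0 \<le> s \<and> 1 < W s \<omega>} \<noteq> {}" using empty that by auto
    have "inv \<omega> < a \<longleftrightarrow> (\<exists>s. 0 \<le> s \<and> 1 < W s \<omega> \<and> s < a)"
      unfolding inverse_subordinator_def using cInf_less_iff[OF ne inv_bdd] by auto
    also have "\<dots> \<longleftrightarrow> \<omega> \<in> ?B"
    proof
      assume "\<exists>s. 0 \<le> s \<and> 1 < W s \<omega> \<and> s < a"
      then obtain s where s: "0 \<le> s" "1 < W s \<omega>" "s < a" by blast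
      obtain r where r: "s < real_of_rat r" "real_of_rat r < a" using of_rat_dense[OF s(3)] by blast
      then have "1 < W (real_of_rat r) \<omega>" using W_mono[OF that(1) s(1), of "real_of_rat r"] s(2) by simp
      moreover have "0 \<le> r" using r(1) s(1) by (simp add: zero_le_of_rat_iff[symmetric, where 'a = real] del: zero_le_of_rat_iff)
      ultimately show "\<omega> \<in> ?B" using r that(1) by auto
    next
      assume "\<omega> \<in> ?B"
      then obtain r where "0 \<le> r" "real_of_rat r < a" "1 < W (real_of_rat r) \<omega>" by auto
      then show "\<exists>s. 0 \<le> s \<and> 1 < W s \<omega> \<and> s < a"
        by (intro exI[of _ "real_of_rat r"]) simp
    qed
    finally show ?thesis .
  qed
  \<comment> \<open>On the paths that never exceed level 1 the first passage time is the fixed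
    constant \<open>Inf {}\<close>, so this set is counted entirely or not at all.\<close>
  have eq: "{\<omega> \<in> space Q. inv \<omega> < a} = (?B - ?N) \<union> (if Inf {} < a then ?N else {})"
  proof (intro set_eqI)
    fix \<omega>
    show "\<omega> \<in> {\<omega> \<in> space Q. inv \<omega> < a} \<longleftrightarrow> \<omega> \<in> (?B - ?N) \<union> (if Inf {} < a then ?N else {})"
    proof (cases "\<omega> \<in> ?N")
      case True
      then have "{s. 0 \<le> s \<and> 1 < W s \<omega>} = {}" using empty[of \<omega>] by blast
      then have "inv \<omega> = Inf {}" by (simp only: inverse_subordinator_def)
      then show ?thesis using True by auto
    next
      case False
      then show ?thesis using mem[of \<omega>] by auto
    qed
  qed
  have B: "?B \<in> sets Q" by (intro sets.countable_UN') auto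
  have N: "?N \<in> sets Q" by measurable
  then have "(if Inf {} < a then ?N else {}) \<in> sets Q" by simp
  then show "{\<omega> \<in> space Q. inv \<omega> < a} \<in> sets Q"
    unfolding eq by (intro sets.Un sets.Diff B N)
qed

lemma AE_inv_nonneg: "AE \<omega> in Q. 0 \<le> inv \<omega>"
  using AE_W_unbounded
proof eventually_elim
  case (elim \<omega>)
  then have "{s. 0 \<le> s \<and> 1 < W s \<omega>} \<noteq> {}" by (metis (mono_tags, lifting) Collect_empty_eq of_nat_0_le_iff)
  then show ?case unfolding inverse_subordinator_def by (intro cInf_greatest) auto
qed

text \<open>By monotonicity of the paths the events \<open>v < inv\<close> and
  \<open>W v \<le> 1\<close> can differ only where \<open>inv = v\<close>, which has probability 0
  for almost every \<open>v\<close>.\<close>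

lemma prob_inv: "AE v in lborel. 0 < v \<longrightarrow> prob {\<omega> \<in> space Q. v < inv \<omega>} = surv v"
  using AE_lborel_no_atom[OF prob_space_axioms inv_measurable] AE_lborel_no_atom[OF prob_space_axioms meas_R]
proof eventually_elim
  case (elim v)
  show ?case
  proof
    assume v: "0 < v"
    have [measurable]: "W v \<in> borel_measurable Q" using v by simp
    have noatom: "AE \<omega> in Q. inv \<omega> \<noteq> v"
      by (rule AE_I[of _ _ "{\<omega> \<in> space Q. inv \<omega> = v}"]) (auto simp: emeasure_eq_measure elim)
    have "prob {\<omega> \<in> space Q. v < inv \<omega>} = prob {\<omega> \<in> space Q. W v \<omega> \<le> 1}"
    proof (rule finite_measure_eq_AE)
      show "AE \<omega> in Q. \<omega> \<in> {\<omega> \<in> space Q. v < inv \<omega>} \<longleftrightarrow> \<omega> \<in> {\<omega> \<in> space Q. W v \<omega> \<le> 1}"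
        using noatom AE_W_unbounded AE_space
      proof eventually_elim
        case (elim \<omega>)
        let ?S = "{s. 0 \<le> s \<and> 1 < W s \<omega>}"
        have ne: "?S \<noteq> {}" using elim(2) by (metis (mono_tags, lifting) Collect_empty_eq of_nat_0_le_iff)
        have "W v \<omega> \<le> 1" if "v < inv \<omega>"
        proof (rule ccontr)
          assume "\<not> W v \<omega> \<le> 1"
          then have "v \<in> ?S" using v by simp
          then have "inv \<omega> \<le> v" unfolding inverse_subordinator_def by (intro cInf_lower inv_bdd)
          then show False using that by simp
        qed
        moreover have "v < inv \<omega>" if "W v \<omega> \<le> 1"
        proof -
          have "v \<le> s" if "s \<in> ?S" for s
          proof (rule ccontr)
            assume "\<not> v \<le> s"
            then show False using W_mono[OF elim(3), of s v] that \<open>W v \<omega> \<le> 1\<close> by auto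
          qed
          then have "v \<le> inv \<omega>" unfolding inverse_subordinator_def by (intro cInf_greatest ne)
          then show ?thesis using elim(1) by simp
        qed
        ultimately show ?case using elim(3) by auto
      qed
    qed measurable
    also have "\<dots> = surv v" by (rule prob_W_le_1[OF v elim(2)])
    finally show "prob {\<omega> \<in> space Q. v < inv \<omega>} = surv v" .
  qed
qed

lemma expectation_inv: "expectation inv = stable_const \<alpha>"
proof -
  have "(\<integral>\<^sup>+\<omega>. ennreal (inv \<omega>) \<partial>Q) =
      (\<integral>\<^sup>+v. ennreal (indicator {0<..} v * prob {\<omega> \<in> space Q. v < inv \<omega>}) \<partial>lborel)"
    by (rule nn_integral_survival[OF prob_space_axioms inv_measurable AE_inv_nonneg, symmetric])
  also have "\<dots> = (\<integral>\<^sup>+v. ennreal (surv v) \<partial>lborel)"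
  proof (rule nn_integral_cong_AE)
    show "AE v in lborel. ennreal (indicator {0<..} v * prob {\<omega> \<in> space Q. v < inv \<omega>}) = ennreal (surv v)"
      using prob_inv by eventually_elim (simp add: surv_def split: split_indicator)
  qed
  finally show ?thesis
    using AE_inv_nonneg stable_const_pos[of \<alpha>] \<alpha>
    by (subst integral_eq_nn_integral) (auto simp: nn_integral_surv)
qed

end

lemma AE_lborel_scale:
  fixes a :: real
  assumes a: "0 < a" and P: "AE v in lborel. P v"
  shows "AE y in lborel. P (a * y)"
proof -
  obtain N where N: "N \<in> null_sets lborel" "{v. \<not> P v} \<subseteq> N"
    using P by (auto simp: eventually_ae_filter)
  have "AE y in lborel. a * y \<notin> N"
  proof -
    have [measurable]: "N \<in> sets borel" using N(1) by auto
    have "(\<integral>\<^sup>+y. indicator N y \<partial>lborel) = ennreal \<bar>a\<bar> * (\<integral>\<^sup>+y. indicator N (0 + a * y) \<partial>lborel)"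
      by (rule nn_integral_real_affine) (use a in auto)
    moreover have "(\<integral>\<^sup>+y. indicator N y \<partial>lborel) = 0" using N(1) by auto
    ultimately have "(\<integral>\<^sup>+y. indicator N (a * y) \<partial>lborel) = 0" using a by simp
    then have "AE y in lborel. indicator N (a * y) = (0::ennreal)"
      by (subst (asm) nn_integral_0_iff_AE) auto
    then show ?thesis by eventually_elim (auto split: split_indicator_asm)
  qed
  then show ?thesis by eventually_elim (use N(2) in auto)
qed

section \<open>A common description of the limit for zero and positive index\<close>

text \<open>
  \<open>Y\<close> has the moments of the limit of \<open>exp (- S\<^bsub>n(t)\<^esub> / t)\<close>, so that \<open>r\<close> is the limit of
  \<open>\<P>(S\<^bsub>n(t)\<^esub> \<le> t)\<close>. For \<open>\<alpha> = 0\<close> the limit is an indicator.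
\<close>

definition limit_law :: "'b measure \<Rightarrow> real \<Rightarrow> real \<Rightarrow> real \<Rightarrow> ('b \<Rightarrow> real) \<Rightarrow> bool" where
  "limit_law Q \<alpha> v r Y \<longleftrightarrow> Y \<in> borel_measurable Q \<and> (AE \<omega> in Q. Y \<omega> \<in> {0..1}) \<and>
     (\<forall>k>0. (LINT \<omega>|Q. Y \<omega> ^ k) = exp (- (v * (Gamma (1 - \<alpha>) * real k powr \<alpha>)))) \<and>
     measure Q {\<omega> \<in> space Q. Y \<omega> = exp (-1)} = 0 \<and> measure Q {\<omega> \<in> space Q. exp (-1) \<le> Y \<omega>} = r"

text \<open>Collects all that the main proof uses about \<open>Z\<close>, with one function
  \<open>q\<close> covering both cases. It is the limit of the step probabilities and, up to the
  scale \<open>stable_const \<alpha>\<close>, the survival function of \<open>Z\<close>.\<close>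

lemma is_Z_limit_law:
  assumes Z: "is_Z Q \<alpha> Z" and \<alpha>: "0 \<le> \<alpha>" "\<alpha> < 1"
  shows "Z \<in> borel_measurable Q \<and> (\<exists>q. q \<in> borel_measurable borel \<and> (\<forall>v\<le>0. q v = 0) \<and> (\<forall>v>0. 0 < q v \<and> q v < 1) \<and>
    integrable lborel q \<and> (LINT v|lborel. q v) = stable_const \<alpha> \<and>
    (AE y in lborel. 0 < y \<longrightarrow> measure Q {\<omega> \<in> space Q. y < Z \<omega>} = q (stable_const \<alpha> * y)) \<and>
    (AE v in lborel. 0 < v \<longrightarrow> (\<exists>Y. limit_law Q \<alpha> v (q v) Y)))"
proof (cases "\<alpha> = 0")
  case True
  with Z have Q: "prob_space Q" and D: "distributed Q lborel Z (exponential_density 1)"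
    by (auto simp: is_Z_def)
  interpret prob_space Q by fact
  have [measurable]: "Z \<in> borel_measurable Q" using distributed_measurable[OF D] by simp
  have gt: "prob {\<omega> \<in> space Q. v < Z \<omega>} = exp (- v)" if "0 < v" for v
    using exponential_distributedD_gt[OF D, of v] that by simp
  have const: "stable_const \<alpha> = 1" by (simp add: True stable_const_def)
  \<comment> \<open>This is \<open>exp (- v)\<close> for \<open>0 < v\<close>, written in the shape
    of \<open>Gamma_integral_scaled\<close> with both parameters 1.\<close>
  let ?q = "\<lambda>v::real. indicator {0<..} v * (v powr (1 - 1) * exp (- 1 * v))"
  \<comment> \<open>For \<open>\<alpha> = 0\<close> the prescribed moments equal
    \<open>exp (- v)\<close> for every positive \<open>k\<close>. They belong to a Bernoulli
    variable, realised here by the event \<open>v < Z\<close>.\<close>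
  have "limit_law Q \<alpha> v (?q v) (indicator {\<omega> \<in> space Q. v < Z \<omega>})" if v: "0 < v" for v
    unfolding limit_law_def
  proof (intro conjI allI impI)
    have set: "{\<omega> \<in> space Q. v < Z \<omega>} \<in> sets Q" by measurable
    have int: "{\<omega> \<in> space Q. v < Z \<omega>} \<inter> space Q = {\<omega> \<in> space Q. v < Z \<omega>}" by auto
    show "indicator {\<omega> \<in> space Q. v < Z \<omega>} \<in> borel_measurable Q" by measurable
    show "AE \<omega> in Q. indicat_real {\<omega> \<in> space Q. v < Z \<omega>} \<omega> \<in> {0..1}"
      by (auto split: split_indicator)
    fix k :: nat assume k: "0 < k"
    then have "(\<lambda>\<omega>. indicat_real {\<omega> \<in> space Q. v < Z \<omega>} \<omega> ^ k) = indicator {\<omega> \<in> space Q. v < Z \<omega>}"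
      by (auto simp: fun_eq_iff split: split_indicator)
    then show "expectation (\<lambda>\<omega>. indicat_real {\<omega> \<in> space Q. v < Z \<omega>} \<omega> ^ k) =
        exp (- (v * (Gamma (1 - \<alpha>) * real k powr \<alpha>)))"
      using k gt[OF v] int by (simp add: True)
  next
    have "{\<omega> \<in> space Q. indicat_real {\<omega> \<in> space Q. v < Z \<omega>} \<omega> = exp (-1)} = {}"
      by (auto split: split_indicator_asm)
    then show "prob {\<omega> \<in> space Q. indicat_real {\<omega> \<in> space Q. v < Z \<omega>} \<omega> = exp (-1)} = 0"
      by (simp only: measure_empty)
    have "{\<omega> \<in> space Q. exp (-1) \<le> indicat_real {\<omega> \<in> space Q. v < Z \<omega>} \<omega>} = {\<omega> \<in> space Q. v < Z \<omega>}"
      by (auto split: split_indicator split_indicator_asm)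
    then show "prob {\<omega> \<in> space Q. exp (-1) \<le> indicat_real {\<omega> \<in> space Q. v < Z \<omega>} \<omega>} = ?q v"
      using gt[OF v] v by simp
  qed
  then have "AE v in lborel. 0 < v \<longrightarrow> (\<exists>Y. limit_law Q \<alpha> v (?q v) Y)" by blast
  moreover have "AE y in lborel. 0 < y \<longrightarrow> prob {\<omega> \<in> space Q. y < Z \<omega>} = ?q (stable_const \<alpha> * y)"
    by (auto simp: gt const)
  moreover have "integrable lborel ?q" "(LINT v|lborel. ?q v) = stable_const \<alpha>"
    using Gamma_integral_scaled[of 1 1] by (auto simp: const)
  moreover have "\<forall>v\<le>0. ?q v = 0" "\<forall>v>0. 0 < ?q v \<and> ?q v < 1" by auto
  moreover have "?q \<in> borel_measurable borel" by measurable
  ultimately show ?thesis using \<open>Z \<in> borel_measurable Q\<close> by (intro exI[of _ ?q] conjI)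
next
  case False
  with \<alpha> have \<alpha>': "0 < \<alpha>" by simp
  from Z False obtain W where W: "stable_subordinator Q \<alpha> W"
    and Z_eq: "Z = (\<lambda>\<omega>. inverse_subordinator W 1 \<omega> / prob_space.expectation Q (inverse_subordinator W 1))"
    by (auto simp: is_Z_def)
  interpret subordinator Q \<alpha> W using W \<alpha>' \<alpha>(2) by unfold_locales
  have const: "0 < stable_const \<alpha>" using \<alpha>' \<alpha>(2) by (intro stable_const_pos) auto
  have "AE v in lborel. 0 < v \<longrightarrow> (\<exists>Y. limit_law Q \<alpha> v (surv v) Y)"
    using AE_lborel_no_atom[OF prob_space_axioms meas_R]
  proof eventually_elim
    case (elim v)
    show ?case
    proof
      assume v: "0 < v"
      have "limit_law Q \<alpha> v (surv v) (\<lambda>\<omega>. exp (- (v powr (1 / \<alpha>)) * W 1 \<omega>))"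
        unfolding limit_law_def
        by (intro conjI allI impI no_atom_R[OF v elim] scaled_moments[OF v])
      then show "\<exists>Y. limit_law Q \<alpha> v (surv v) Y"
        by (rule exI[where x = "\<lambda>\<omega>. exp (- (v powr (1 / \<alpha>)) * W 1 \<omega>)"])
    qed
  qed
  moreover have "AE y in lborel. 0 < y \<longrightarrow> prob {\<omega> \<in> space Q. y < Z \<omega>} = surv (stable_const \<alpha> * y)"
    using AE_lborel_scale[OF const prob_inv]
  proof eventually_elim
    case (elim y)
    show ?case
    proof
      assume "0 < y"
      then have "0 < stable_const \<alpha> * y" using const by simp
      moreover have "y < Z \<omega> \<longleftrightarrow> stable_const \<alpha> * y < inv \<omega>" for \<omega>
        unfolding Z_eq expectation_inv using const by (simp add: less_divide_eq mult.commute)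
      ultimately show "prob {\<omega> \<in> space Q. y < Z \<omega>} = surv (stable_const \<alpha> * y)" using elim by simp
    qed
  qed
  moreover have "Z \<in> borel_measurable Q" unfolding Z_eq by measurable
  moreover have "\<forall>v\<le>0. surv v = 0" by (auto simp: surv_def)
  moreover have "\<forall>v>0. 0 < surv v \<and> surv v < 1" by (simp add: surv_pos surv_less_1)
  ultimately show ?thesis
    by (intro exI[of _ surv] conjI surv_measurable surv_integral)
qed

subsection \<open>The rate function\<close>

lemma tilt_strict_mono:
  assumes "0 < x" "x < 1" "r < s" shows "tilt r x < tilt s x"
proof -
  have "exp r * (x * (1 - x)) < exp s * (x * (1 - x))" using assms by (intro mult_strict_right_mono) auto
  then have "exp r * x * (1 + (exp s - 1) * x) < exp s * x * (1 + (exp r - 1) * x)"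
    by (simp add: algebra_simps)
  then show ?thesis
    using tilt_denom_pos[of x r] tilt_denom_pos[of x s] assms unfolding tilt_def
    by (simp add: frac_less_eq divide_less_eq less_divide_eq mult.commute)
qed

lemma tilt_mono: "0 \<le> x \<Longrightarrow> x \<le> 1 \<Longrightarrow> r \<le> s \<Longrightarrow> tilt r x \<le> tilt s x"
  using tilt_strict_mono[of x r s] by (cases "x = 0 \<or> x = 1 \<or> r = s") (auto simp: tilt_def intro: less_imp_le)

lemma continuous_on_tilt: "continuous_on {0..1} (tilt s)"
  unfolding tilt_def[abs_def] using tilt_denom_pos[of _ s] by (intro continuous_intros) (force)

lemma continuous_on_ln_tilt_denom: "continuous_on {0..1} (\<lambda>x::real. ln (1 + (exp s - 1) * x))"
  using tilt_denom_pos[of _ s] by (intro continuous_intros) (force)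

lemma tilt_measurable [measurable]: "tilt s \<in> borel_measurable borel"
  unfolding tilt_def[abs_def] by measurable

locale survival =
  fixes q :: "real \<Rightarrow> real"
  assumes q_meas [measurable]: "q \<in> borel_measurable borel"
    and q_nonpos: "\<And>v. v \<le> 0 \<Longrightarrow> q v = 0" and q_pos: "\<And>v. 0 < v \<Longrightarrow> 0 < q v \<and> q v < 1"
    and q_int: "integrable lborel q"
begin

lemma q01: "0 \<le> q v" "q v \<le> 1"
  using q_nonpos[of v] q_pos[of v] by (cases "0 < v"; force)+

lemma integral_param:
  fixes h :: "real \<Rightarrow> real \<Rightarrow> real"
  assumes [measurable]: "\<And>s. h s \<in> borel_measurable borel"
    and cont: "\<And>s x. 0 \<le> x \<Longrightarrow> x \<le> 1 \<Longrightarrow> isCont (\<lambda>s. h s x) s"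
    and bound: "\<And>s x. 0 \<le> x \<Longrightarrow> x \<le> 1 \<Longrightarrow> \<bar>h s x\<bar> \<le> exp \<bar>s\<bar> * x"
  shows "integrable lborel (\<lambda>v. h s (q v))" and "isCont (\<lambda>s. LINT v|lborel. h s (q v)) s"
proof -
  show "integrable lborel (\<lambda>v. h s (q v))"
  proof (rule Bochner_Integration.integrable_bound)
    show "integrable lborel (\<lambda>v. exp \<bar>s\<bar> * q v)" by (intro integrable_mult_right q_int)
    show "AE v in lborel. norm (h s (q v)) \<le> norm (exp \<bar>s\<bar> * q v)"
      using bound[OF q01] q01 by (intro AE_I2) simp
  qed measurable
  show "isCont (\<lambda>s. LINT v|lborel. h s (q v)) s"
    unfolding continuous_at_sequentially comp_def
  proof (intro allI impI)
    fix x :: "nat \<Rightarrow> real" assume x: "x \<longlonglongrightarrow> s"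
    then have "Bseq x" by (rule convergent_imp_Bseq[OF convergentI])
    then obtain B where "\<forall>n. norm (x n) \<le> B" by (auto elim: BseqE)
    then have B: "\<bar>x n\<bar> \<le> B" for n by simp
    show "(\<lambda>n. LINT v|lborel. h (x n) (q v)) \<longlonglongrightarrow> (LINT v|lborel. h s (q v))"
    proof (rule integral_dominated_convergence[where w = "\<lambda>v. exp B * q v"])
      show "integrable lborel (\<lambda>v. exp B * q v)" by (intro integrable_mult_right q_int)
      show "AE v in lborel. (\<lambda>n. h (x n) (q v)) \<longlonglongrightarrow> h s (q v)"
        by (intro AE_I2 isCont_tendsto_compose[OF cont[OF q01] x])
      show "AE v in lborel. norm (h (x n) (q v)) \<le> exp B * q v" for n
      proof (rule AE_I2)
        fix v
        have "\<bar>h (x n) (q v)\<bar> \<le> exp \<bar>x n\<bar> * q v" by (rule bound[OF q01])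
        also have "\<dots> \<le> exp B * q v" using B[of n] q01 by (intro mult_right_mono) auto
        finally show "norm (h (x n) (q v)) \<le> exp B * q v" by simp
      qed
    qed measurable
  qed
qed

text \<open>\<open>D\<close> is \<open>F\<close> differentiated under the integral sign. Up to the
  factor \<open>G t\<close>, they are the limits of the log moment generating function and of the
  tilted mean of the count.\<close>

definition F where "F s = (LINT v|lborel. ln (1 + (exp s - 1) * q v))"
definition D where "D s = (LINT v|lborel. tilt s (q v))"

lemma F_cont: "isCont F s"
  unfolding F_def[abs_def]
proof (rule integral_param(2)[where h = "\<lambda>s x. ln (1 + (exp s - 1) * x)"])
  show "isCont (\<lambda>s. ln (1 + (exp s - 1) * x)) s" if "0 \<le> x" "x \<le> 1" for s x :: real
    using tilt_denom_pos[OF that, of s] by (intro continuous_intros) auto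
qed (use abs_ln_tilt_denom_le in auto)

lemma tilt_int: "integrable lborel (\<lambda>v. tilt s (q v))" and D_cont: "isCont D s"
proof -
  have 1: "isCont (\<lambda>s. tilt s x) s" if "0 \<le> x" "x \<le> 1" for s x
    unfolding tilt_def using tilt_denom_pos[OF that, of s] by (intro continuous_intros) auto
  have 2: "\<bar>tilt s x\<bar> \<le> exp \<bar>s\<bar> * x" if "0 \<le> x" "x \<le> 1" for s x
    using tilt_le[OF that, of s] tilt_nonneg[OF that, of s] by simp
  show "integrable lborel (\<lambda>v. tilt s (q v))" by (rule integral_param(1)[OF _ 1 2]) measurable
  show "isCont D s" unfolding D_def[abs_def] by (rule integral_param(2)[OF _ 1 2]) measurable
qed

text \<open>From \<open>ln x \<le> x - 1\<close>: after normalisation the right side is the log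
  moment generating function of a unit Poisson variable. This makes the rate positive later.\<close>

lemma F_le: "F s \<le> (exp s - 1) * (LINT v|lborel. q v)"
proof -
  have "F s \<le> (LINT v|lborel. (exp s - 1) * q v)"
    unfolding F_def
  proof (rule integral_mono)
    have 1: "isCont (\<lambda>s. ln (1 + (exp s - 1) * x)) s" if "0 \<le> x" "x \<le> 1" for s x :: real
      using tilt_denom_pos[OF that, of s] by (intro continuous_intros) auto
    show "integrable lborel (\<lambda>v. ln (1 + (exp s - 1) * q v))"
      by (rule integral_param(1)[where h = "\<lambda>s x. ln (1 + (exp s - 1) * x)", OF _ 1 abs_ln_tilt_denom_le]) measurable
    show "ln (1 + (exp s - 1) * q v) \<le> (exp s - 1) * q v" for v
      using ln_le_minus_one[OF tilt_denom_pos[OF q01, of s v]] by simp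
  qed (intro integrable_mult_right q_int)
  then show ?thesis by simp
qed

text \<open>Equal integrals would force equal tilted values almost everywhere, but on
  \<open>{0<..<1}\<close> the values of \<open>q\<close> lie strictly between 0 and 1, where tilting
  is strictly monotone.\<close>

lemma D_strict_mono: assumes "r < s" shows "D r < D s"
proof -
  let ?d = "\<lambda>v. tilt s (q v) - tilt r (q v)"
  have int: "integrable lborel ?d" by (intro Bochner_Integration.integrable_diff tilt_int)
  have nonneg: "0 \<le> ?d v" for v using tilt_mono[OF q01, of r s v] assms by simp
  have "D s - D r = (LINT v|lborel. ?d v)"
    unfolding D_def by (rule Bochner_Integration.integral_diff[symmetric]) (rule tilt_int)+
  moreover have "(LINT v|lborel. ?d v) \<noteq> 0"
  proof
    assume "(LINT v|lborel. ?d v) = 0"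
    then have "AE v in lborel. ?d v = 0"
      using integral_nonneg_eq_0_iff_AE[OF int] nonneg by simp
    then have "AE v in lborel. v \<notin> {0<..<1::real}"
      by eventually_elim (use tilt_strict_mono[OF _ _ assms] q_pos in force)
    then have "emeasure lborel {0<..<1::real} = 0"
      by (subst (asm) AE_iff_measurable[of "{0<..<1}"]) auto
    then show False by simp
  qed
  moreover have "0 \<le> (LINT v|lborel. ?d v)" by (intro Bochner_Integration.integral_nonneg nonneg)
  ultimately show ?thesis by linarith
qed

lemma D_surj: assumes b: "0 < b" shows "\<exists>s. D s = b"
proof -
  have lim0: "(\<lambda>n. exp (- real n)) \<longlonglongrightarrow> 0"
    by (intro filterlim_compose[OF exp_at_bot]) (simp add: filterlim_uminus_at_top[symmetric] filterlim_real_sequentially)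
  \<comment> \<open>Tilting towards minus infinity removes all mass because \<open>q\<close> stays
    below 1; \<open>q\<close> itself, the tilt at 0, dominates.\<close>
  have "(\<lambda>n. D (- real n)) \<longlonglongrightarrow> (LINT (v::real)|lborel. 0)"
    unfolding D_def
  proof (rule integral_dominated_convergence[where w = q])
    show "AE v in lborel. (\<lambda>n. tilt (- real n) (q v)) \<longlonglongrightarrow> 0"
    proof (rule AE_I2)
      fix v
      have "q v < 1" using q_nonpos[of v] q_pos[of v] by (cases "0 < v") auto
      then have "(\<lambda>n. tilt (- real n) (q v)) \<longlonglongrightarrow> 0 * q v / (1 + (0 - 1) * q v)"
        unfolding tilt_def by (intro tendsto_intros lim0) auto
      then show "(\<lambda>n. tilt (- real n) (q v)) \<longlonglongrightarrow> 0" by simp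
    qed
    show "AE v in lborel. norm (tilt (- real n) (q v)) \<le> q v" for n
    proof (rule AE_I2)
      fix v
      have "tilt (- real n) (q v) \<le> tilt 0 (q v)" by (rule tilt_mono[OF q01]) simp
      moreover have "tilt 0 (q v) = q v" by (simp add: tilt_def)
      ultimately show "norm (tilt (- real n) (q v)) \<le> q v" using tilt_nonneg[OF q01] by simp
    qed
  qed (use q_int in measurable)
  then have "(\<lambda>n. D (- real n)) \<longlonglongrightarrow> 0" by simp
  from eventually_happens'[OF sequentially_bot order_tendstoD(2)[OF this b]]
  obtain m :: nat where m: "D (- real m) < b" by auto
  \<comment> \<open>Where \<open>q\<close> is positive the tilted value tends to 1, so a window
    longer than \<open>b\<close> already pushes \<open>D\<close> beyond \<open>b\<close>. The
    intermediate value theorem then applies.\<close>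
  let ?A = "{0<..<b + 1}"
  have lim: "(\<lambda>n. LINT v|lborel. indicator ?A v * tilt (real n) (q v)) \<longlonglongrightarrow> (LINT v|lborel. indicator ?A v)"
  proof (rule integral_dominated_convergence[where w = "indicator ?A"])
    show "AE v in lborel. (\<lambda>n. indicator ?A v * tilt (real n) (q v)) \<longlonglongrightarrow> indicator ?A v"
    proof (rule AE_I2)
      fix v
      show "(\<lambda>n. indicator ?A v * tilt (real n) (q v)) \<longlonglongrightarrow> indicator ?A v"
      proof (cases "v \<in> ?A")
        case True
        then have q: "0 < q v" using q_pos by auto
        have "tilt (real n) (q v) = q v / (exp (- real n) * (1 - q v) + q v)" for n
        proof -
          have "exp (real n) * (exp (- real n) * (1 - q v) + q v) = 1 + (exp (real n) - 1) * q v"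
            by (simp add: algebra_simps exp_minus)
          then have "tilt (real n) (q v) = (exp (real n) * q v) / (exp (real n) * (exp (- real n) * (1 - q v) + q v))"
            by (simp add: tilt_def)
          then show ?thesis by simp
        qed
        moreover have "(\<lambda>n. q v / (exp (- real n) * (1 - q v) + q v)) \<longlonglongrightarrow> q v / (0 * (1 - q v) + q v)"
          using q by (intro tendsto_intros lim0) auto
        ultimately show ?thesis using True q by simp
      qed simp
    qed
    show "AE v in lborel. norm (indicator ?A v * tilt (real n) (q v)) \<le> indicator ?A v" for n
      using tilt_nonneg[OF q01] tilt_le_1[OF q01] by (intro AE_I2) (auto split: split_indicator)
  qed (use b in \<open>auto simp: integrable_indicator_iff\<close>)
  have "b < (LINT v|lborel. indicator ?A v)" using b by simp
  from eventually_happens'[OF sequentially_bot order_tendstoD(1)[OF lim this]]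
  obtain n :: nat where "b < (LINT v|lborel. indicator ?A v * tilt (real n) (q v))" by auto
  also have "\<dots> \<le> D (real n)"
    unfolding D_def
  proof (rule integral_mono)
    show "integrable lborel (\<lambda>v. indicator ?A v * tilt (real n) (q v))"
      using tilt_int[of "real n"] by (intro integrable_real_mult_indicator[of _ _ "\<lambda>v. tilt (real n) (q v)", simplified mult.commute]) auto
    show "indicator ?A v * tilt (real n) (q v) \<le> tilt (real n) (q v)" for v
      using tilt_nonneg[OF q01] by (auto split: split_indicator)
  qed (rule tilt_int)
  finally have "b < D (real n)" .
  then have "\<exists>s. - real m \<le> s \<and> s \<le> real n \<and> D s = b"
    using m D_cont by (intro IVT) auto
  then show ?thesis by blast
qed

end

section \<open>From tilted bounds to the exponential rate\<close>

text \<open>The lower bound at tilts near \<open>s0\<close> gives a rate of at most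
  \<open>s0 * b - f s0\<close>, and Chernoff at any \<open>s\<close> gives at least
  \<open>s * b - f s\<close>. Taking \<open>s = s0\<close> yields the limit, and comparing with
  every other \<open>s\<close> yields the optimality of \<open>s0\<close>.\<close>

lemma exponential_rate:
  fixes U P k :: "real \<Rightarrow> real" and \<Lambda> \<mu> :: "real \<Rightarrow> real \<Rightarrow> real" and f d :: "real \<Rightarrow> real"
  assumes U: "filterlim U at_top at_top"
    and \<Lambda>: "\<And>s. ((\<lambda>t. \<Lambda> s t / U t) \<longlongrightarrow> f s) at_top" and \<mu>: "\<And>s. ((\<lambda>t. \<mu> s t / U t) \<longlongrightarrow> d s) at_top"
    and k: "((\<lambda>t. k t / U t) \<longlongrightarrow> b) at_top"
    and upper: "\<And>s. \<forall>\<^sub>F t in at_top. P t \<le> exp (\<Lambda> s t - s * k t)"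
    and lower: "\<forall>\<^sub>F t in at_top. \<forall>r s \<delta>. 0 < \<delta> \<longrightarrow> 2 * \<mu> r t \<le> \<delta>\<^sup>2 \<longrightarrow> 2 * \<mu> s t \<le> \<delta>\<^sup>2 \<longrightarrow>
        \<mu> r t + \<delta> < k t \<longrightarrow> k t < \<mu> s t - \<delta> \<longrightarrow>
        exp (min (\<Lambda> r t - r * \<mu> r t - \<bar>r\<bar> * \<delta>) (\<Lambda> s t - s * \<mu> s t - \<bar>s\<bar> * \<delta>)) / (2 * (2 * \<delta> + 1)) \<le> P t"
    and f: "isCont f s0" and d: "isCont d s0" and d_mono: "\<And>r s. r < s \<Longrightarrow> d r < d s" and s0: "d s0 = b"
  shows "((\<lambda>t. - ln (P t) / U t) \<longlongrightarrow> s0 * b - f s0) at_top"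
    and "s * b - f s \<le> s0 * b - f s0"
proof -
  let ?J = "s0 * b - f s0"
  have U0: "\<forall>\<^sub>F t in at_top. 0 < U t" using U by (auto simp: filterlim_at_top_dense)
  \<comment> \<open>Positivity of \<open>P t\<close> is recorded as well, since the comparison of
    logarithms in \<open>up\<close> depends on it.\<close>
  have low: "\<forall>\<^sub>F t in at_top. 0 < P t \<and> - ln (P t) / U t < ?J + \<epsilon>" if \<epsilon>: "0 < \<epsilon>" for \<epsilon>
  proof -
    \<comment> \<open>The exponent paid at tilt \<open>s\<close> for values near the tilted mean
      \<open>d s * U t\<close>. By continuity, tilts close to \<open>s0\<close> on either side cost
      almost \<open>?h s0\<close>, which is the claimed rate.\<close>
    let ?h = "\<lambda>s. s * d s - f s"
    have "isCont ?h s0" by (intro continuous_intros f d)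
    then obtain \<eta>' where \<eta>': "0 < \<eta>'" "\<And>x. \<bar>x - s0\<bar> < \<eta>' \<Longrightarrow> \<bar>?h x - ?h s0\<bar> < \<epsilon> / 4"
      using \<epsilon> unfolding continuous_at_eps_delta dist_real_def by (metis divide_pos_pos zero_less_numeral)
    define \<eta> where "\<eta> = \<eta>' / 2"
    have \<eta>: "0 < \<eta>" "\<eta> < \<eta>'" using \<eta>'(1) by (auto simp: \<eta>_def)
    define r s where "r = s0 - \<eta>" and "s = s0 + \<eta>"
    have "\<bar>?h r - ?h s0\<bar> < \<epsilon> / 4" "\<bar>?h s - ?h s0\<bar> < \<epsilon> / 4"
      using \<eta> by (intro \<eta>'(2); simp add: r_def s_def)+
    then have h: "?h r < ?J + \<epsilon> / 4" "?h s < ?J + \<epsilon> / 4" unfolding s0 by linarith+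
    have ds: "d r < b" "b < d s" using d_mono[of r s0] d_mono[of s0 s] \<eta> s0 by (auto simp: r_def s_def)
    \<comment> \<open>The window radius is \<open>e * U t\<close>. The first entry keeps its cost in
      the exponent below \<open>\<epsilon> / 4\<close> per unit of \<open>U t\<close>, the other two
      keep the windows around the tilted means away from \<open>b\<close>.\<close>
    define e where "e = Min {\<epsilon> / (4 * (\<bar>r\<bar> + \<bar>s\<bar> + 1)), (b - d r) / 2, (d s - b) / 2}"
    have e: "0 < e" using \<epsilon> ds by (auto simp: e_def add_nonneg_pos)
    have e1: "d r + e < b" "b < d s - e"
    proof -
      have "e \<le> (b - d r) / 2" "e \<le> (d s - b) / 2" unfolding e_def by (intro Min_le; simp)+
      then show "d r + e < b" "b < d s - e" using ds by auto
    qed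
    have "e \<le> \<epsilon> / (4 * (\<bar>r\<bar> + \<bar>s\<bar> + 1))" by (auto simp: e_def)
    then have "(\<bar>r\<bar> + \<bar>s\<bar> + 1) * e \<le> \<epsilon> / 4"
      by (simp add: pos_le_divide_eq add_nonneg_pos mult_ac)
    then have e2: "\<bar>r\<bar> * e \<le> \<epsilon> / 4" "\<bar>s\<bar> * e \<le> \<epsilon> / 4"
      using e mult_nonneg_nonneg[of "\<bar>r\<bar>" e] mult_nonneg_nonneg[of "\<bar>s\<bar>" e]
      unfolding distrib_right by linarith+
    have B: "\<forall>\<^sub>F t in at_top. - (?J + \<epsilon> / 2) * U t < \<Lambda> x t - x * \<mu> x t - \<bar>x\<bar> * (e * U t)"
      if "?h x < ?J + \<epsilon> / 4" "\<bar>x\<bar> * e \<le> \<epsilon> / 4" for x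
    proof -
      have "((\<lambda>t. \<Lambda> x t / U t - x * (\<mu> x t / U t) - \<bar>x\<bar> * e) \<longlongrightarrow> f x - x * d x - \<bar>x\<bar> * e) at_top"
        by (intro tendsto_intros \<Lambda> \<mu>)
      moreover have "- (?J + \<epsilon> / 2) < f x - x * d x - \<bar>x\<bar> * e" using that by linarith
      ultimately have "\<forall>\<^sub>F t in at_top. - (?J + \<epsilon> / 2) < \<Lambda> x t / U t - x * (\<mu> x t / U t) - \<bar>x\<bar> * e"
        by (rule order_tendstoD(1))
      with U0 show ?thesis
      proof eventually_elim
        case (elim t)
        have "- (?J + \<epsilon> / 2) * U t < (\<Lambda> x t / U t - x * (\<mu> x t / U t) - \<bar>x\<bar> * e) * U t"
          using elim by (intro mult_strict_right_mono)
        also have "\<dots> = \<Lambda> x t - x * \<mu> x t - \<bar>x\<bar> * (e * U t)" using elim by (simp add: field_simps)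
        finally show ?case .
      qed
    qed
    \<comment> \<open>The mean grows linearly in \<open>U t\<close>, the squared window radius
      quadratically.\<close>
    have var: "\<forall>\<^sub>F t in at_top. 2 * \<mu> x t \<le> (e * U t)\<^sup>2" for x
    proof -
      have "\<forall>\<^sub>F t in at_top. \<mu> x t / U t < d x + 1" by (intro order_tendstoD(2)[OF \<mu>]) simp
      moreover have "\<forall>\<^sub>F t in at_top. 2 * (d x + 1) / e\<^sup>2 < U t" using U by (auto simp: filterlim_at_top_dense)
      ultimately show ?thesis using U0
      proof eventually_elim
        case (elim t)
        have "\<mu> x t < (d x + 1) * U t" using elim(1,3) by (simp add: pos_divide_less_eq)
        then have "2 * \<mu> x t \<le> 2 * ((d x + 1) * U t)" by (simp only: mult_le_cancel_left_pos zero_less_numeral less_imp_le)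
        also have "\<dots> = (2 * (d x + 1)) * U t" by (simp only: mult.assoc)
        also have "2 * (d x + 1) \<le> e\<^sup>2 * U t"
          using elim(2) e by (simp add: pos_divide_less_eq mult.commute)
        then have "(2 * (d x + 1)) * U t \<le> (e\<^sup>2 * U t) * U t"
          using elim(3) by (intro mult_right_mono) auto
        finally show ?case by (simp add: power2_eq_square mult_ac)
      qed
    qed
    have "((\<lambda>t. (k t / U t - \<mu> r t / U t) - e) \<longlongrightarrow> (b - d r) - e) at_top" by (intro tendsto_intros k \<mu>)
    then have "\<forall>\<^sub>F t in at_top. 0 < (k t / U t - \<mu> r t / U t) - e" by (rule order_tendstoD(1)) (use e1 in simp)
    with U0 have kr: "\<forall>\<^sub>F t in at_top. \<mu> r t + e * U t < k t"
    proof eventually_elim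
      case (elim t)
      then have "0 < ((k t / U t - \<mu> r t / U t) - e) * U t" by simp
      then show ?case using elim(1) by (simp add: left_diff_distrib)
    qed
    have "((\<lambda>t. (\<mu> s t / U t - k t / U t) - e) \<longlongrightarrow> (d s - b) - e) at_top" by (intro tendsto_intros k \<mu>)
    then have "\<forall>\<^sub>F t in at_top. 0 < (\<mu> s t / U t - k t / U t) - e" by (rule order_tendstoD(1)) (use e1 in simp)
    with U0 have ks: "\<forall>\<^sub>F t in at_top. k t < \<mu> s t - e * U t"
    proof eventually_elim
      case (elim t)
      then have "0 < ((\<mu> s t / U t - k t / U t) - e) * U t" by simp
      then show ?case using elim(1) by (simp add: left_diff_distrib)
    qed
    \<comment> \<open>The denominator of the local lower bound grows linearly in \<open>U t\<close>,
      so its logarithm is negligible. The factor \<open>4 * e + 2 * inverse (U t)\<close> below is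
      \<open>?y t / U t\<close>.\<close>
    let ?y = "\<lambda>t. 2 * (2 * (e * U t) + 1)"
    have eU: "filterlim (\<lambda>t. 4 * e * U t) at_top at_top"
      using e by (intro filterlim_tendsto_pos_mult_at_top[OF tendsto_const _ U]) simp
    have "filterlim ?y at_top at_top"
      by (rule filterlim_at_top_mono[OF eU]) (simp add: algebra_simps)
    then have "((\<lambda>t. ln (?y t) / ?y t) \<longlongrightarrow> 0) at_top" by (rule filterlim_compose[OF ln_x_over_x_tendsto_0])
    moreover have "((\<lambda>t. 4 * e + 2 * inverse (U t)) \<longlongrightarrow> 4 * e + 2 * 0) at_top"
      by (intro tendsto_intros filterlim_compose[OF tendsto_inverse_0_at_top[OF filterlim_ident] U])
    ultimately have "((\<lambda>t. ln (?y t) / ?y t * (4 * e + 2 * inverse (U t))) \<longlongrightarrow> 0 * (4 * e + 2 * 0)) at_top"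
      by (rule tendsto_mult)
    then have "\<forall>\<^sub>F t in at_top. ln (?y t) / ?y t * (4 * e + 2 * inverse (U t)) < \<epsilon> / 2"
      using \<epsilon> by (intro order_tendstoD(2)) auto
    with U0 have ln_small: "\<forall>\<^sub>F t in at_top. ln (?y t) < \<epsilon> / 2 * U t"
    proof eventually_elim
      case (elim t)
      have "0 < ?y t" using elim e by (simp add: add_pos_pos)
      moreover have "4 * e + 2 * inverse (U t) = ?y t / U t" using elim by (simp add: field_simps)
      ultimately have "ln (?y t) / U t < \<epsilon> / 2" using elim by simp
      then show ?case using elim by (simp add: divide_less_eq)
    qed
    from lower U0 B[OF h(1) e2(1)] B[OF h(2) e2(2)] var[of r] var[of s] kr ks ln_small
    show ?thesis
    proof eventually_elim
      case (elim t)
      let ?b = "\<lambda>x. \<Lambda> x t - x * \<mu> x t - \<bar>x\<bar> * (e * U t)"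
      have y: "0 < ?y t" using elim e by (simp add: add_pos_pos)
      have P: "exp (min (?b r) (?b s)) / ?y t \<le> P t"
        by (intro elim(1)[rule_format]) (use elim e in simp_all)
      have "exp (- (?J + \<epsilon> / 2) * U t) / ?y t \<le> exp (min (?b r) (?b s)) / ?y t"
        using elim y by (intro divide_right_mono) auto
      with P have P': "exp (- (?J + \<epsilon> / 2) * U t) / ?y t \<le> P t" by linarith
      have pos: "0 < exp (- (?J + \<epsilon> / 2) * U t) / ?y t" using y by simp
      with P' have P0: "0 < P t" by linarith
      have "ln (exp (- (?J + \<epsilon> / 2) * U t) / ?y t) \<le> ln (P t)"
        using pos P' by simp
      moreover have "ln (exp (- (?J + \<epsilon> / 2) * U t) / ?y t) = - ((?J + \<epsilon> / 2) * U t) - ln (?y t)"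
        using y by (subst ln_divide_pos) (simp_all only: exp_gt_zero ln_exp mult_minus_left)
      ultimately have "- ln (P t) \<le> (?J + \<epsilon> / 2) * U t + ln (?y t)" by linarith
      also have "\<dots> < (?J + \<epsilon> / 2) * U t + \<epsilon> / 2 * U t" using elim by simp
      also have "\<dots> = (?J + \<epsilon>) * U t" by (simp add: algebra_simps)
      finally have "- ln (P t) / U t < ?J + \<epsilon>"
        using pos_divide_less_eq[OF elim(2), of "- ln (P t)" "?J + \<epsilon>"] by blast
      with P0 show ?case ..
    qed
  qed
  have up: "\<forall>\<^sub>F t in at_top. a < - ln (P t) / U t" if a: "a < s * b - f s" for a s
  proof -
    have "((\<lambda>t. s * (k t / U t) - \<Lambda> s t / U t) \<longlongrightarrow> s * b - f s) at_top" by (intro tendsto_intros k \<Lambda>)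
    from order_tendstoD(1)[OF this a] U0 upper[of s] low[OF zero_less_one]
    show ?thesis
    proof eventually_elim
      case (elim t)
      then have "ln (P t) \<le> \<Lambda> s t - s * k t"
        by (metis ln_exp ln_le_cancel_iff exp_gt_zero)
      then have "s * k t - \<Lambda> s t \<le> - ln (P t)" by simp
      then have "(s * k t - \<Lambda> s t) / U t \<le> - ln (P t) / U t" using elim by (intro divide_right_mono) auto
      then show ?case using elim by (simp add: diff_divide_distrib)
    qed
  qed
  show "((\<lambda>t. - ln (P t) / U t) \<longlongrightarrow> ?J) at_top"
  proof (rule order_tendstoI)
    fix a assume "a < ?J" then show "\<forall>\<^sub>F t in at_top. a < - ln (P t) / U t" by (rule up)
  next
    fix a assume "?J < a"
    then show "\<forall>\<^sub>F t in at_top. - ln (P t) / U t < a"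
      using low[of "a - ?J"] by (auto elim: eventually_mono)
  qed
  show "s * b - f s \<le> ?J"
  proof (rule ccontr)
    assume "\<not> ?thesis"
    then have *: "?J < s * b - f s" by simp
    \<comment> \<open>The midpoint of the supposed gap would eventually be both exceeded by and
      larger than the same quotient.\<close>
    define m where "m = (?J + (s * b - f s)) / 2"
    have m1: "0 < m - ?J" and m2: "m < s * b - f s" using * unfolding m_def by argo+
    have "\<forall>\<^sub>F t in at_top :: real filter. False"
      using low[OF m1] up[OF m2] by eventually_elim linarith
    then show False by simp
  qed
qed

subsection \<open>The decoupled renewal count\<close>

lemma indep_sum_prob_Suc:
  fixes J :: "nat \<Rightarrow> 'a \<Rightarrow> real"
  assumes M: "prob_space M" and J: "prob_space.indep_vars M (\<lambda>_. borel) J {1..}"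
  shows "measure M {\<omega> \<in> space M. J (Suc m) \<omega> = a \<and> (\<Sum>i=1..m. J i \<omega>) = c} =
    measure M {\<omega> \<in> space M. J (Suc m) \<omega> = a} * measure M {\<omega> \<in> space M. (\<Sum>i=1..m. J i \<omega>) = c}"
proof -
  interpret prob_space M by fact
  have "indep_vars (\<lambda>_. borel) J (insert (Suc m) {1..m})"
    by (rule indep_vars_subset[OF J]) auto
  then have "indep_var borel (J (Suc m)) borel (\<lambda>\<omega>. \<Sum>i\<in>{1..m}. J i \<omega>)"
    by (intro indep_vars_sum) auto
  from indep_varD[OF this, of "{a}" "{c}"]
  have "prob ((\<lambda>\<omega>. (J (Suc m) \<omega>, \<Sum>i=1..m. J i \<omega>)) -` ({a} \<times> {c}) \<inter> space M) =
      prob (J (Suc m) -` {a} \<inter> space M) * prob ((\<lambda>\<omega>. \<Sum>i=1..m. J i \<omega>) -` {c} \<inter> space M)"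
    by simp
  moreover have "(\<lambda>\<omega>. (J (Suc m) \<omega>, \<Sum>i=1..m. J i \<omega>)) -` ({a} \<times> {c}) \<inter> space M =
      {\<omega> \<in> space M. J (Suc m) \<omega> = a \<and> (\<Sum>i=1..m. J i \<omega>) = c}" by auto
  moreover have "J (Suc m) -` {a} \<inter> space M = {\<omega> \<in> space M. J (Suc m) \<omega> = a}" by auto
  moreover have "(\<lambda>\<omega>. \<Sum>i=1..m. J i \<omega>) -` {c} \<inter> space M = {\<omega> \<in> space M. (\<Sum>i=1..m. J i \<omega>) = c}" by auto
  ultimately show ?thesis by simp
qed

text \<open>The level \<open>t\<close> is frozen, so the count is a sum of independent indicators.
  Trial \<open>n\<close> of the Poisson binomial recursion belongs to
  \<open>T (Suc n)\<close>.\<close>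

locale independent_walk =
  fixes M :: "'a measure" and T :: "nat \<Rightarrow> 'a \<Rightarrow> real" and t :: real and p :: "nat \<Rightarrow> real"
  assumes prob_space_M: "prob_space M" and indep_T: "prob_space.indep_vars M (\<lambda>_. borel) T {1..}"
    and p: "\<And>n. measure M {\<omega> \<in> space M. T (Suc n) \<omega> \<le> t} = p n"
    and sum_p: "summable p"
begin

sublocale prob_space M by (rule prob_space_M)

lemma meas_T: "1 \<le> i \<Longrightarrow> T i \<in> borel_measurable M"
  using indep_T by (auto simp: indep_vars_def)

lemma meas_T_Suc [measurable]: "T (Suc i) \<in> borel_measurable M"
  by (rule meas_T) simp

definition J :: "nat \<Rightarrow> 'a \<Rightarrow> real" where "J i \<omega> = indicator {..t} (T i \<omega>)"

definition S :: "nat \<Rightarrow> 'a \<Rightarrow> real" where "S m \<omega> = (\<Sum>i=1..m. J i \<omega>)"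

lemma S_Suc: "S (Suc m) \<omega> = S m \<omega> + J (Suc m) \<omega>" by (simp add: S_def)

lemma S_nonneg: "0 \<le> S m \<omega>" unfolding S_def J_def by (intro sum_nonneg) auto

lemma meas_S [measurable]: "S m \<in> borel_measurable M"
  unfolding S_def[abs_def] J_def by (intro borel_measurable_sum) (use meas_T in \<open>auto intro!: measurable_compose[OF _ borel_measurable_indicator]\<close>)

text \<open>The recursion for \<open>poisson_binomial\<close> is conditioning on the indicator
  \<open>J (Suc m)\<close>, which is independent of the preceding partial sum.\<close>

lemma prob_S: "prob {\<omega> \<in> space M. S m \<omega> = real k} = poisson_binomial p m k"
proof (induction m arbitrary: k)
  case 0
  then show ?case by (cases "k = 0") (auto simp: S_def prob_space)
next
  case (Suc m)
  have J_meas [measurable]: "J (Suc m) \<in> borel_measurable M" unfolding J_def by measurable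
  have J01: "J (Suc m) \<omega> = 0 \<or> J (Suc m) \<omega> = 1" for \<omega> by (auto simp: J_def split: split_indicator)
  have J1: "prob {\<omega> \<in> space M. J (Suc m) \<omega> = 1} = p m"
    unfolding p[symmetric] by (intro arg_cong[where f = prob]) (auto simp: J_def split: split_indicator_asm)
  have "prob {\<omega> \<in> space M. J (Suc m) \<omega> = 0} = prob (space M - {\<omega> \<in> space M. J (Suc m) \<omega> = 1})"
    using J01 by (intro arg_cong[where f = prob]) force
  also have "\<dots> = 1 - prob {\<omega> \<in> space M. J (Suc m) \<omega> = 1}" by (rule prob_compl) measurable
  finally have J0: "prob {\<omega> \<in> space M. J (Suc m) \<omega> = 0} = 1 - p m" unfolding J1 .
  have indep_J: "indep_vars (\<lambda>_. borel) J {1..}"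
    unfolding J_def[abs_def] by (rule indep_vars_compose2[OF indep_T]) measurable
  note split = indep_sum_prob_Suc[OF prob_space_M indep_J, of m, folded S_def]
  let ?A = "\<lambda>a c. {\<omega> \<in> space M. J (Suc m) \<omega> = a \<and> S m \<omega> = c}"
  have meas: "?A a c \<in> sets M" for a c by measurable
  have "{\<omega> \<in> space M. S (Suc m) \<omega> = real k} = ?A 0 (real k) \<union> ?A 1 (real k - 1)"
    using J01 by (auto simp: S_Suc) (smt (verit))+
  then have "prob {\<omega> \<in> space M. S (Suc m) \<omega> = real k} = prob (?A 0 (real k)) + prob (?A 1 (real k - 1))"
    by (simp only:) (intro finite_measure_Union meas, auto)
  also have "prob (?A 0 (real k)) = (1 - p m) * poisson_binomial p m k"
    unfolding split J0 Suc ..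
  also have "prob (?A 1 (real k - 1)) = p m * (if k = 0 then 0 else poisson_binomial p m (k - 1))"
  proof (cases "k = 0")
    case True
    have "?A 1 (real k - 1) = {}"
    proof (intro equals0I)
      fix \<omega> assume "\<omega> \<in> ?A 1 (real k - 1)"
      then show False using S_nonneg[of m \<omega>] True by simp
    qed
    then show ?thesis using True by (simp only: measure_empty) simp
  next
    case False
    then have "real k - 1 = real (k - 1)" by simp
    then have "prob (?A 1 (real k - 1)) = p m * poisson_binomial p m (k - 1)"
      by (simp only: split J1 Suc)
    then show ?thesis using False by (simp only: if_False)
  qed
  finally show ?case by simp
qed

lemma AE_eventually_gt: "AE \<omega> in M. \<forall>\<^sub>F n in sequentially. t < T (Suc n) \<omega>"
proof -
  have "AE \<omega> in M. \<forall>\<^sub>F n in sequentially. \<omega> \<in> space M - {\<omega> \<in> space M. T (Suc n) \<omega> \<le> t}"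
    by (rule borel_cantelli_AE1) (auto simp: p sum_p emeasure_eq_measure)
  then show ?thesis by eventually_elim (auto elim: eventually_mono)
qed

lemma meas_renewal_count [measurable]: "renewal_count T t \<in> borel_measurable M"
  unfolding renewal_count_def[abs_def] by measurable

lemma renewal_count_eq_S:
  assumes "\<And>n. N \<le> n \<Longrightarrow> t < T (Suc n) \<omega>" and "N \<le> m"
  shows "renewal_count T t \<omega> = ennreal (S m \<omega>)"
proof -
  have "renewal_count T t \<omega> = (\<Sum>n<m. indicator {..t} (T (Suc n) \<omega>))"
    unfolding renewal_count_def
  proof (rule suminf_finite)
    fix n assume "n \<notin> {..<m}"
    then have "t < T (Suc n) \<omega>" using assms by auto
    then show "indicator {..t} (T (Suc n) \<omega>) = (0::ennreal)" by simp
  qed simp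
  also have "\<dots> = (\<Sum>n<m. ennreal (J (Suc n) \<omega>))"
    by (intro sum.cong refl) (auto simp: J_def split: split_indicator)
  also have "\<dots> = ennreal (\<Sum>n<m. J (Suc n) \<omega>)"
    by (rule sum_ennreal) (simp add: J_def)
  also have "(\<Sum>n<m. J (Suc n) \<omega>) = S m \<omega>"
    unfolding S_def by (rule sum.reindex_bij_witness[of _ "\<lambda>i. i - 1" Suc]) auto
  finally show ?thesis .
qed

text \<open>By Borel-Cantelli the count almost surely agrees with its partial sums from some index
  on, so the indicators of the events converge and bounded convergence applies.\<close>

lemma prob_renewal_count:
  "(\<lambda>m. poisson_binomial p m k) \<longlonglongrightarrow> prob {\<omega> \<in> space M. renewal_count T t \<omega> = of_nat k}"
proof -
  let ?A = "{\<omega> \<in> space M. renewal_count T t \<omega> = of_nat k}" and ?B = "\<lambda>m. {\<omega> \<in> space M. S m \<omega> = real k}"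
  have A: "?A \<in> sets M" and B: "?B m \<in> sets M" for m by measurable
  have "(\<lambda>m. expectation (indicator (?B m))) \<longlonglongrightarrow> (expectation (indicator ?A) :: real)"
  proof (rule integral_dominated_convergence[where w = "\<lambda>_. 1"])
    show "AE \<omega> in M. (\<lambda>m. indicat_real (?B m) \<omega>) \<longlonglongrightarrow> indicator ?A \<omega>"
      using AE_eventually_gt AE_space
    proof eventually_elim
      case (elim \<omega>)
      then obtain N where N: "\<And>n. N \<le> n \<Longrightarrow> t < T (Suc n) \<omega>" by (auto simp: eventually_sequentially)
      have "indicat_real (?B m) \<omega> = indicator ?A \<omega>" if "N \<le> m" for m
      proof -
        have "renewal_count T t \<omega> = ennreal (S m \<omega>)"
          by (rule renewal_count_eq_S[OF _ that]) (rule N)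
        then have "renewal_count T t \<omega> = of_nat k \<longleftrightarrow> S m \<omega> = real k"
          unfolding ennreal_of_nat_eq_real_of_nat
          by (simp only: ennreal_inj[OF S_nonneg of_nat_0_le_iff])
        then show ?thesis using elim(2) by (simp add: indicator_def)
      qed
      then show ?case by (intro tendsto_eventually eventually_sequentiallyI[of N])
    qed
    show "indicat_real ?A \<in> borel_measurable M" using A by (rule borel_measurable_indicator)
    show "indicat_real (?B m) \<in> borel_measurable M" for m using B by (rule borel_measurable_indicator)
  qed (auto split: split_indicator)
  moreover have "expectation (indicat_real (?B m)) = poisson_binomial p m k" for m
  proof -
    have "?B m \<inter> space M = ?B m" by auto
    then show ?thesis using prob_S[of m k] by simp
  qed
  moreover have "expectation (indicat_real ?A) = prob ?A"
  proof -
    have "?A \<inter> space M = ?A" by auto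
    then show ?thesis by simp
  qed
  ultimately show ?thesis by simp
qed

lemma renewal_fun_eq: "renewal_fun M T t = (\<Sum>n. p n)"
proof -
  have p0: "0 \<le> p n" for n unfolding p[symmetric] by simp
  have "(\<integral>\<^sup>+\<omega>. renewal_count T t \<omega> \<partial>M) = (\<Sum>n. \<integral>\<^sup>+\<omega>. indicator {..t} (T (Suc n) \<omega>) \<partial>M)"
    unfolding renewal_count_def by (rule nn_integral_suminf) measurable
  also have "\<dots> = (\<Sum>n. ennreal (p n))"
  proof (intro suminf_cong)
    fix n
    have "(\<integral>\<^sup>+\<omega>. indicator {..t} (T (Suc n) \<omega>) \<partial>M) = (\<integral>\<^sup>+\<omega>. indicator {\<omega> \<in> space M. T (Suc n) \<omega> \<le> t} \<omega> \<partial>M)"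
      by (intro nn_integral_cong) (auto split: split_indicator)
    also have "\<dots> = emeasure M {\<omega> \<in> space M. T (Suc n) \<omega> \<le> t}" by (rule nn_integral_indicator) measurable
    finally show "(\<integral>\<^sup>+\<omega>. indicator {..t} (T (Suc n) \<omega>) \<partial>M) = ennreal (p n)"
      by (simp add: emeasure_eq_measure p)
  qed
  also have "\<dots> = ennreal (\<Sum>n. p n)" by (rule suminf_ennreal2[OF p0 sum_p])
  finally show ?thesis
    unfolding renewal_fun_def using suminf_nonneg[OF sum_p p0] by simp
qed

end

text \<open>The substitution of \<open>c * y\<close> for the integration variable brings out the
  factor \<open>1 / c\<close>. The same factor arises when limits relative to \<open>1 / G t\<close>
  are rewritten relative to \<open>U t\<close>.\<close>

lemma (in survival) log_mgf_eq:
  fixes Z :: "'b \<Rightarrow> real"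
  assumes Q: "prob_space Q" and Z: "Z \<in> borel_measurable Q" and c: "0 < c"
    and eq: "AE y in lborel. 0 < y \<longrightarrow> measure Q {\<omega> \<in> space Q. y < Z \<omega>} = q (c * y)"
  shows "log_mgf Q Z s = F s / c"
proof -
  let ?m = "\<lambda>y. indicator {0<..} y * measure Q {\<omega> \<in> space Q. y < Z \<omega>}"
  have m: "?m \<in> borel_measurable borel" by (rule survival_measurable[OF Q Z])
  have "log_mgf Q Z s = (LINT y|lborel. ln (1 + (exp s - 1) * ?m y))"
    unfolding log_mgf_def set_lebesgue_integral_def
    by (intro Bochner_Integration.integral_cong refl) (simp add: add.commute split: split_indicator)
  also have "\<dots> = (LINT y|lborel. ln (1 + (exp s - 1) * q (0 + c * y)))"
  proof (rule integral_cong_AE)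
    show "AE y in lborel. ln (1 + (exp s - 1) * ?m y) = ln (1 + (exp s - 1) * q (0 + c * y))"
      using eq
    proof eventually_elim
      case (elim y)
      show ?case
      proof (cases "0 < y")
        case False
        then have "c * y \<le> 0" using c by (simp add: mult_nonneg_nonpos)
        then show ?thesis using False by (simp add: q_nonpos)
      qed (use elim in simp)
    qed
  qed (use m in measurable)
  also have "\<dots> = F s / c"
    unfolding F_def using c
    by (subst (2) lborel_integral_real_affine[where c = c and t = 0]) auto
  finally show ?thesis .
qed

theorem theorem1:
  fixes M :: "'a measure" and \<xi> :: "'a \<Rightarrow> real"
    and X T :: "nat \<Rightarrow> 'a \<Rightarrow> real"
    and Q :: "'b measure" and Z :: "'b \<Rightarrow> real"
    and \<alpha> b :: real and l :: "real \<Rightarrow> real"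
  assumes "prob_space M"
    and "\<xi> \<in> borel_measurable M"
    and "AE \<omega> in M. 0 \<le> \<xi> \<omega>"
    and "\<not> (\<exists>c. AE \<omega> in M. \<xi> \<omega> = c)"
    and "decoupled_walk M \<xi> X T"
    and "0 < b" and "b \<noteq> 1"
    and "0 \<le> \<alpha>" and "\<alpha> < 1"
    and "slowly_varying l"
    and "(\<lambda>t. \<P>(\<omega> in M. \<xi> \<omega> > t)) \<sim>[at_top] (\<lambda>t. t powr (- \<alpha>) * l t)"
    and "is_Z Q \<alpha> Z"
  shows "((\<lambda>t. ereal (- ln (\<P>(\<omega> in M. renewal_count T t \<omega>
                  = of_nat (nat \<lfloor>b * renewal_fun M T t\<rfloor>)))
              / renewal_fun M T t))
            \<longlongrightarrow> legendre (log_mgf Q Z) b) at_top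
    \<and> 0 < legendre (log_mgf Q Z) b \<and> legendre (log_mgf Q Z) b < \<infinity>
    \<and> renewal_fun M T \<sim>[at_top]
        (\<lambda>t. 1 / (Gamma (1 - \<alpha>) * Gamma (1 + \<alpha>)) * (t powr \<alpha> / l t))"
proof -
  interpret prob_space M by fact
  let ?G = "\<lambda>t. prob {\<omega> \<in> space M. t < \<xi> \<omega>}"
  note tail = assms(11)
  have walk: "indep_vars (\<lambda>_. borel) X {1..}" "\<And>i. 1 \<le> i \<Longrightarrow> distr M borel (X i) = distr M borel \<xi>"
    "indep_vars (\<lambda>_. borel) T {1..}"
    "\<And>n. 1 \<le> n \<Longrightarrow> distr M borel (T n) = distr M borel (\<lambda>\<omega>. \<Sum>i=1..n. X i \<omega>)"
    using assms(5) by (auto simp: decoupled_walk_def)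
  \<comment> \<open>The asymptotics give a nonzero tail only for large arguments; monotonicity
    carries positivity to every \<open>t\<close>.\<close>
  have tail_pos: "0 < ?G t" for t
  proof -
    obtain N where N: "\<And>u. N \<le> u \<Longrightarrow> ?G u \<noteq> 0"
      using regularly_varying_nonzero[OF assms(10) tail] by (auto simp: eventually_at_top_linorder)
    have "0 < ?G (max N t)" using N[of "max N t"] by (simp add: zero_less_measure_iff)
    also have "\<dots> \<le> ?G t" using assms(2) by (intro finite_measure_mono) auto
    finally show ?thesis .
  qed
  interpret W: regularly_varying_walk M \<xi> X \<alpha>
    by unfold_locales (fact assms walk tail_pos regularly_varying_ratio[OF assms(10) tail])+
  define c where "c = stable_const \<alpha>"
  have c: "0 < c" unfolding c_def by (rule stable_const_pos[OF assms(8,9)])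
  obtain q where Z: "Z \<in> borel_measurable Q" and q: "q \<in> borel_measurable borel" "\<And>v. v \<le> 0 \<Longrightarrow> q v = 0"
      "\<And>v. 0 < v \<Longrightarrow> 0 < q v \<and> q v < 1" "integrable lborel q" and q_mean: "(LINT v|lborel. q v) = c"
    and Zq: "AE y in lborel. 0 < y \<longrightarrow> measure Q {\<omega> \<in> space Q. y < Z \<omega>} = q (c * y)"
    and law: "AE v in lborel. 0 < v \<longrightarrow> (\<exists>Y. limit_law Q \<alpha> v (q v) Y)"
    using is_Z_limit_law[OF assms(12,8,9)] unfolding c_def by auto
  interpret q: survival q by unfold_locales (fact q)+
  have Q: "prob_space Q" using assms(12) by (simp add: is_Z_def)
  have lim: "AE y in lborel. 0 < y \<longrightarrow> (\<forall>n. ((\<lambda>t. real (n t) * W.G t) \<longlongrightarrow> y) at_top \<longrightarrow>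
      ((\<lambda>t. W.p (n t) t) \<longlongrightarrow> q y) at_top)"
    using law
  proof eventually_elim
    case (elim y)
    show ?case
    proof (intro impI allI)
      fix n assume y: "0 < y" and n: "((\<lambda>t. real (n t) * W.G t) \<longlongrightarrow> y) at_top"
      obtain Y where Y: "limit_law Q \<alpha> y (q y) Y" using elim y by blast
      have "((\<lambda>t. W.p (n t) t) \<longlongrightarrow> measure Q {\<omega> \<in> space Q. exp (-1) \<le> Y \<omega>}) at_top"
        using Y by (intro W.p_tendsto[OF Q _ _ _ _ n]) (auto simp: limit_law_def)
      then show "((\<lambda>t. W.p (n t) t) \<longlongrightarrow> q y) at_top" using Y by (simp add: limit_law_def)
    qed
  qed
  obtain \<kappa> where \<kappa>: "0 < \<kappa>"
    and dom: "\<forall>\<^sub>F t in at_top. \<forall>n. W.p n t \<le> exp 1 * exp (- \<kappa> * (real (Suc n) * W.G t))"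
    by (rule W.p_exponential_bound)
  \<comment> \<open>Instantiated three times: with the identity for the renewal function, with the
    logarithm for \<open>\<Lambda>\<close>, and with \<open>tilt s\<close> for
    \<open>\<mu>\<close>.\<close>
  note sums = scaled_sum_tendsto_integral[OF W.G_pos W.G_tendsto_0 W.p_bounds \<kappa> dom q(1,2) lim]
  define U where "U t = (\<Sum>n. W.p n t)" for t
  define \<Lambda> where "\<Lambda> s t = (\<Sum>n. ln (1 + (exp s - 1) * W.p n t))" for s t
  define \<mu> where "\<mu> s t = (\<Sum>n. tilt s (W.p n t))" for s t
  have summ: "\<forall>\<^sub>F t in at_top. summable (\<lambda>n. \<bar>W.p n t\<bar>)"
    and GU: "((\<lambda>t. W.G t * U t) \<longlongrightarrow> c) at_top"
    using sums[of "\<lambda>x. x" 1] q_mean by (simp_all add: U_def continuous_on_id)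
  have G\<Lambda>: "((\<lambda>t. W.G t * \<Lambda> s t) \<longlongrightarrow> q.F s) at_top" for s
    unfolding \<Lambda>_def q.F_def
    by (rule sums(2)[where C = "exp \<bar>s\<bar>"]) (use continuous_on_ln_tilt_denom abs_ln_tilt_denom_le in auto)
  have G\<mu>: "((\<lambda>t. W.G t * \<mu> s t) \<longlongrightarrow> q.D s) at_top" for s
    unfolding \<mu>_def q.D_def
    by (rule sums(2)[where C = "exp \<bar>s\<bar>"])
       (use continuous_on_tilt tilt_le tilt_nonneg in auto)
  have walk_t: "\<forall>\<^sub>F t in at_top. independent_walk M T t (\<lambda>n. W.p n t)"
    using summ
  proof eventually_elim
    case (elim t)
    show ?case
    proof
      fix n
      have "T (Suc n) \<in> borel_measurable M" using walk(3) by (auto simp: indep_vars_def)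
      then show "prob {\<omega> \<in> space M. T (Suc n) \<omega> \<le> t} = W.p n t"
        unfolding W.p_def using walk(4)[of "Suc n"] W.meas_sum_X[of "Suc n"]
        by (intro prob_eq_of_distr_eq[where P = "\<lambda>x. x \<le> t"]) auto
    qed (use walk(3) summable_rabs_cancel[OF elim] in auto)
  qed
  have renewal_U: "\<forall>\<^sub>F t in at_top. renewal_fun M T t = U t"
    using walk_t by eventually_elim (simp add: independent_walk.renewal_fun_eq U_def)
  have invG: "filterlim (\<lambda>t. inverse (W.G t)) at_top at_top"
    by (rule filterlim_inverse_at_top[OF W.G_tendsto_0]) (simp add: W.G_pos)
  have "filterlim (\<lambda>t. W.G t * U t * inverse (W.G t)) at_top at_top"
    by (rule filterlim_tendsto_pos_mult_at_top[OF GU c invG])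
  moreover have "W.G t * U t * inverse (W.G t) = U t" for t using W.G_pos[of t] by simp
  ultimately have U_top: "filterlim U at_top at_top" by simp
  \<comment> \<open>The tail \<open>G t\<close> cancels in the quotient, so its asymptotic form is
    irrelevant for limits relative to \<open>U t\<close>.\<close>
  have ratio: "((\<lambda>t. f t / U t) \<longlongrightarrow> a / c) at_top" if "((\<lambda>t. W.G t * f t) \<longlongrightarrow> a) at_top" for f a
  proof -
    have "((\<lambda>t. (W.G t * f t) / (W.G t * U t)) \<longlongrightarrow> a / c) at_top"
      using c by (intro tendsto_divide that GU) simp
    moreover have "(W.G t * f t) / (W.G t * U t) = f t / U t" for t using W.G_pos[of t] by simp
    ultimately show ?thesis by simp
  qed
  define k where "k t = nat \<lfloor>b * U t\<rfloor>" for t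
  have k: "((\<lambda>t. real (k t) / U t) \<longlongrightarrow> b) at_top"
  proof -
    have U0: "\<forall>\<^sub>F t in at_top. 0 < U t" using U_top by (auto simp: filterlim_at_top_dense)
    have "((\<lambda>t. inverse (U t)) \<longlongrightarrow> 0) at_top"
      by (intro filterlim_compose[OF tendsto_inverse_0_at_top[OF filterlim_ident] U_top])
    then have "((\<lambda>t. b - inverse (U t)) \<longlongrightarrow> b - 0) at_top" by (intro tendsto_intros)
    then have low: "((\<lambda>t. b - inverse (U t)) \<longlongrightarrow> b) at_top" by simp
    show ?thesis
    proof (rule tendsto_sandwich[OF _ _ low tendsto_const])
      show "\<forall>\<^sub>F t in at_top. b - inverse (U t) \<le> real (k t) / U t"
        using U0
      proof eventually_elim
        case (elim t)
        have "b * U t - 1 \<le> real (k t)" unfolding k_def by linarith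
        then have "(b * U t - 1) / U t \<le> real (k t) / U t" using elim by (intro divide_right_mono) auto
        then show ?case using elim by (simp add: diff_divide_distrib inverse_eq_divide)
      qed
      show "\<forall>\<^sub>F t in at_top. real (k t) / U t \<le> b"
        using U0
      proof eventually_elim
        case (elim t)
        have "0 \<le> b * U t" using elim assms(6) by simp
        then have "real (k t) \<le> b * U t" unfolding k_def by simp
        then show ?case using elim by (simp add: pos_divide_le_eq)
      qed
    qed
  qed
  define P where "P t = prob {\<omega> \<in> space M. renewal_count T t \<omega> = of_nat (k t)}" for t
  \<comment> \<open>The tilt under which the mean of the count is asymptotically
    \<open>b * U t\<close>.\<close>
  obtain s0 where s0: "q.D s0 = b * c" using q.D_surj[of "b * c"] assms(6) c by auto
  let ?f = "\<lambda>s. q.F s / c"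
  have upper: "\<forall>\<^sub>F t in at_top. P t \<le> exp (\<Lambda> s t - s * real (k t))" for s
    using walk_t
  proof eventually_elim
    case (elim t)
    interpret independent_walk M T t "\<lambda>n. W.p n t" by fact
    show ?case
      unfolding P_def \<Lambda>_def by (rule Chernoff_bound[OF W.p_bounds sum_p prob_renewal_count])
  qed
  have lower: "\<forall>\<^sub>F t in at_top. \<forall>r s \<delta>. 0 < \<delta> \<longrightarrow> 2 * \<mu> r t \<le> \<delta>\<^sup>2 \<longrightarrow> 2 * \<mu> s t \<le> \<delta>\<^sup>2 \<longrightarrow>
      \<mu> r t + \<delta> < real (k t) \<longrightarrow> real (k t) < \<mu> s t - \<delta> \<longrightarrow>
      exp (min (\<Lambda> r t - r * \<mu> r t - \<bar>r\<bar> * \<delta>) (\<Lambda> s t - s * \<mu> s t - \<bar>s\<bar> * \<delta>)) / (2 * (2 * \<delta> + 1)) \<le> P t"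
    using walk_t
  proof eventually_elim
    case (elim t)
    interpret independent_walk M T t "\<lambda>n. W.p n t" by fact
    show ?case
      unfolding P_def \<Lambda>_def \<mu>_def
      by (intro allI impI local_lower_bound[OF W.p_bounds sum_p prob_renewal_count])
  qed
  have "isCont ?f s0" using c by (intro continuous_intros q.F_cont) simp
  moreover have "isCont (\<lambda>s. q.D s / c) s0" using c by (intro continuous_intros q.D_cont) simp
  moreover have "q.D r / c < q.D s / c" if "r < s" for r s
    using q.D_strict_mono[OF that] c by (intro divide_strict_right_mono)
  moreover have "q.D s0 / c = b" using s0 c by simp
  ultimately have rate: "((\<lambda>t. - ln (P t) / U t) \<longlongrightarrow> s0 * b - ?f s0) at_top"
    and sup: "\<And>s. s * b - ?f s \<le> s0 * b - ?f s0"
    using exponential_rate[OF U_top ratio[OF G\<Lambda>] ratio[OF G\<mu>] k upper lower] by blast+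
  have legendre: "legendre (log_mgf Q Z) b = ereal (s0 * b - ?f s0)"
    unfolding legendre_def q.log_mgf_eq[OF Q Z c Zq]
    by (intro antisym SUP_least SUP_upper2[of s0]) (simp_all add: sup)
  \<comment> \<open>For the Poisson majorant \<open>exp s - 1\<close> the supremum of
    \<open>s * b - (exp s - 1)\<close> is attained at \<open>s = ln b\<close>, with value
    \<open>b * ln b - b + 1\<close>. This is positive because \<open>b \<noteq> 1\<close>.\<close>
  have "?f s \<le> exp s - 1" for s
    using q.F_le[of s] c by (simp add: q_mean pos_divide_le_eq)
  from this[of "ln b"] have "ln b * b - ?f (ln b) \<ge> b * ln b - b + 1" using assms(6) by simp
  moreover have "0 < b * ln b - b + 1"
  proof -
    have "ln (1 / b) \<noteq> 1 / b - 1" using ln_eq_minus_one[of "1 / b"] assms(6,7) by auto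
    then have "ln (1 / b) < 1 / b - 1" using ln_le_minus_one[of "1 / b"] assms(6) by simp
    then have "b * ln (1 / b) < b * (1 / b - 1)" using assms(6) by simp
    then show ?thesis using assms(6) by (simp add: ln_div right_diff_distrib)
  qed
  ultimately have J_pos: "0 < s0 * b - ?f s0" using sup[of "ln b"] by linarith
  have "\<forall>\<^sub>F t in at_top. - ln (P t) / U t = - ln (\<P>(\<omega> in M. renewal_count T t \<omega>
      = of_nat (nat \<lfloor>b * renewal_fun M T t\<rfloor>))) / renewal_fun M T t"
    using renewal_U by eventually_elim (simp add: P_def k_def)
  from tendsto_cong[OF this] rate
  have "((\<lambda>t. - ln (\<P>(\<omega> in M. renewal_count T t \<omega>
      = of_nat (nat \<lfloor>b * renewal_fun M T t\<rfloor>))) / renewal_fun M T t) \<longlongrightarrow> s0 * b - ?f s0) at_top"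
    by simp
  then have goal1: "((\<lambda>t. ereal (- ln (\<P>(\<omega> in M. renewal_count T t \<omega>
      = of_nat (nat \<lfloor>b * renewal_fun M T t\<rfloor>))) / renewal_fun M T t)) \<longlongrightarrow> legendre (log_mgf Q Z) b) at_top"
    unfolding legendre by (rule tendsto_ereal)
  \<comment> \<open>The product of renewal function and tail tends to \<open>c\<close>; dividing by
    the assumed equivalent of the tail gives the asymptotics of the renewal function.\<close>
  have "(\<lambda>t. renewal_fun M T t * W.G t) \<sim>[at_top] (\<lambda>_. c)"
  proof (rule asymp_equivI'_const[where g = "\<lambda>_. 1", simplified])
    have "\<forall>\<^sub>F t in at_top. W.G t * U t = renewal_fun M T t * W.G t"
      using renewal_U by eventually_elim simp
    from tendsto_cong[OF this] GU show "((\<lambda>t. renewal_fun M T t * W.G t) \<longlongrightarrow> c) at_top" by simp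
  qed (use c in simp)
  from asymp_equiv_divide[OF this tail]
  have "(\<lambda>t. renewal_fun M T t * W.G t / ?G t) \<sim>[at_top] (\<lambda>t. c / (t powr (- \<alpha>) * l t))" .
  moreover have "(\<lambda>t. renewal_fun M T t * W.G t / ?G t) = renewal_fun M T"
    using tail_pos by (simp add: W.G_def fun_eq_iff less_imp_neq[symmetric])
  moreover have "c / (t powr (- \<alpha>) * l t) = 1 / (Gamma (1 - \<alpha>) * Gamma (1 + \<alpha>)) * (t powr \<alpha> / l t)" for t
    by (simp add: c_def stable_const_def powr_minus field_simps)
  ultimately have goal2: "renewal_fun M T \<sim>[at_top]
      (\<lambda>t. 1 / (Gamma (1 - \<alpha>) * Gamma (1 + \<alpha>)) * (t powr \<alpha> / l t))"
    by simp
  show ?thesis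
    using goal1 goal2 J_pos by (simp add: legendre)
qed

end
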